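(* Let $d\ge 2$ and let $C\subset\overline{\mathbb{R}}=\mathbb{R}\cup\{\infty\}$ be a set of $2d-2$ distinct points. The number of equivalence classes of generic rational functions of degree $d$ with critical set $C$ is the $d$-Catalan number $$\rho_d=\frac{1}{d}\binom{2d-2}{d-1}.$$
   Context: A rational function of degree $d$ is generic if it has $2d-2$ distinct critical points. Two rational functions $f,g$ of the same degree are equivalent if $f=\sigma\circ g$ for some $\sigma\in\mathrm{Aut}(\overline{\mathbb{C}})$ (a Möbius transformation). *)

theory Defs
  imports "HOL-Complex_Analysis.Complex_Analysis" "HOL-Computational_Algebra.Computational_Algebra"
begin

text \<open>The Riemann sphere is the one-point compactification of the complex plane: \<open>Some z\<close> is
  the finite point \<open>z\<close> and \<open>None\<close> is the point at infinity.\<close>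

type_synonym sphere = "complex option"

definition real_circle :: "sphere set" where
  "real_circle = insert None (Some ` \<real>)"

text \<open>The self-map \<open>p / q\<close> of the sphere. The formula is only meaningful if \<open>p\<close> and \<open>q\<close> have no
  common zero. The value at infinity is the limit of \<open>p z / q z\<close>, read off from the coefficients
  of index \<open>max (degree p) (degree q)\<close>, at least one of which is nonzero.\<close>

definition rat_map :: "complex poly \<Rightarrow> complex poly \<Rightarrow> sphere \<Rightarrow> sphere" where
  "rat_map p q x =
     (case x of
        Some z \<Rightarrow> if poly q z = 0 then None else Some (poly p z / poly q z)
      | None \<Rightarrow>
          let n = max (degree p) (degree q)
          in if coeff q n = 0 then None else Some (coeff p n / coeff q n))"

definition rational_function :: "nat \<Rightarrow> (sphere \<Rightarrow> sphere) \<Rightarrow> bool" where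
  "rational_function d f \<longleftrightarrow>
     (\<exists>p q. coprime p q \<and> max (degree p) (degree q) = d \<and> f = rat_map p q)"

definition moebius :: "(sphere \<Rightarrow> sphere) set" where
  "moebius = {rat_map [:b, a:] [:d, c:] | a b c d. a * d - b * c \<noteq> 0}"

text \<open>A point is critical if the derivative vanishes in local coordinates. \<open>param x\<close> is a local
  parametrization sending \<open>0\<close> to \<open>x\<close>, with parameter \<open>1 / z\<close> near infinity. \<open>coord y\<close> is the
  coordinate \<open>w\<close> if \<open>y\<close> is finite and \<open>1 / w\<close> if \<open>y\<close> is infinity; its values at infinity resp.
  at zero, outside the domain of the chart, are immaterial.\<close>

definition param :: "sphere \<Rightarrow> complex \<Rightarrow> sphere" where
  "param x t =
     (case x of
        Some z \<Rightarrow> Some (z + t)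
      | None \<Rightarrow> if t = 0 then None else Some (1 / t))"

definition coord :: "sphere \<Rightarrow> sphere \<Rightarrow> complex" where
  "coord y u =
     (case y of
        Some _ \<Rightarrow> (case u of Some w \<Rightarrow> w | None \<Rightarrow> 0)
      | None \<Rightarrow> (case u of Some w \<Rightarrow> 1 / w | None \<Rightarrow> 0))"

definition critical_set :: "(sphere \<Rightarrow> sphere) \<Rightarrow> sphere set" where
  "critical_set f = {x. ((\<lambda>t. coord (f x) (f (param x t))) has_field_derivative 0) (at 0)}"

definition generic :: "nat \<Rightarrow> (sphere \<Rightarrow> sphere) \<Rightarrow> bool" where
  "generic d f \<longleftrightarrow> rational_function d f \<and> card (critical_set f) = 2 * d - 2"

definition rat_equiv :: "nat \<Rightarrow> (sphere \<Rightarrow> sphere) rel" where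
  "rat_equiv d =
     {(f, g). rational_function d f \<and> rational_function d g \<and> (\<exists>\<sigma>\<in>moebius. f = \<sigma> \<circ> g)}"

end

theory Submission
  imports Defs
begin

text \<open>Let \<open>Z\<close> be the set of critical points, moved into the real line, with \<open>2 k = 2 d - 2\<close> elements. The plane
  spanned by numerator and denominator of a rational function with critical set \<open>Z\<close> consists of the
  polynomials of degree at most \<open>d\<close> with \<open>y' = h z * y\<close> at all \<open>z \<in> Z\<close>; it solves the equation
  \<open>W y'' - W' y' + U y = 0\<close> with \<open>W\<close> the product of the \<open>x - z\<close> and \<open>U / W\<close> the sum of the \<open>h z / (x - z)\<close>.
  Absence of logarithms at \<open>z\<close> says that the square of \<open>h z\<close> is the sum of the
  \<open>(h z - h j) / (z - j)\<close> over \<open>j \<noteq> z\<close>, and the behaviour at infinity that \<open>\<Sum>z. h z = 0\<close> and \<open>\<Sum>z. z * h z = k * (k + 1)\<close>.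

  The same quadratic relations hold for the commuting Gaudin operators \<open>G z\<close>, the sum over \<open>j\<close> of the
  \<open>(1 - P z j) / (z - j)\<close>, where the transpositions \<open>P z j\<close> act on functions on subsets of \<open>Z\<close>, and also for
  \<open>K z = lower z + G z\<close>. Each solution \<open>h\<close>
  is a joint eigenvalue of the \<open>K z\<close>, whose eigenvector is determined by its value at the empty set; its
  top part is a joint eigenvector of the \<open>G z\<close> in the kernel of the total lowering operator on
  functions on \<open>k\<close>-subsets. Conversely an eigenvector of the latter kind lifts to one of the \<open>K z\<close>, so joint
  eigenspaces of the \<open>G z\<close> there are lines. For real \<open>Z\<close> the \<open>G z\<close> are self-adjoint, hence the number of solutions is
  the dimension of this kernel, which is the Catalan number.\<close>

section \<open>Gaudin operators on functions on subsets\<close>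

text \<open>The obstacle is multiplicity. Self-adjointness yields joint eigenvectors of the
  \<open>G z\<close>, but neither that an eigenvalue \<open>h\<close> occurs only once nor that
  every admissible \<open>h\<close> is an eigenvalue. Both come from the summand
  \<open>lower z\<close> of \<open>K z\<close>. It drops the cardinality while \<open>G z\<close>
  preserves it, so the products of the \<open>K z\<close> over the subsets of \<open>Z\<close>, each
  followed by evaluation at the empty set, form a unitriangular system of linear coordinates on
  functions on subsets. In these coordinates an eigenvector with value 1 at the empty set can only
  be \<open>prod h\<close>, and the quadratic relations are what makes this choice an eigenvector.
  Passing back from \<open>G\<close> to \<open>K\<close> takes one more operator that commutes with
  all \<open>K z\<close>: the sum of the \<open>z * K z\<close>, whose diagonal entries on primitive
  functions separate level \<open>k\<close> from the lower levels.\<close>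

lemma underdetermined_system:
  fixes a :: "'i \<Rightarrow> 'j \<Rightarrow> 'a::field"
  assumes "finite I" "finite J" "card I < card J"
  shows "\<exists>x. (\<exists>j\<in>J. x j \<noteq> 0) \<and> (\<forall>j. j \<notin> J \<longrightarrow> x j = 0) \<and> (\<forall>i\<in>I. (\<Sum>j\<in>J. a i j * x j) = 0)"
  using assms
proof (induction I arbitrary: J a rule: finite_induct)
  case empty
  then obtain j where "j \<in> J" by fastforce
  then show ?case by (intro exI[of _ "\<lambda>i. if i = j then 1 else 0"]) auto
next
  case (insert i I)
  show ?case
  proof (cases "\<forall>j\<in>J. a i j = 0")
    case True
    have "card I < card J" using insert by simp
    then obtain x where x: "\<exists>j\<in>J. x j \<noteq> 0" "\<forall>j. j \<notin> J \<longrightarrow> x j = 0"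
        "\<forall>i\<in>I. (\<Sum>j\<in>J. a i j * x j) = 0"
      using insert.IH[OF insert.prems(1), of a] by blast
    moreover have "(\<Sum>j\<in>J. a i j * x j) = 0" using True by simp
    ultimately show ?thesis by (intro exI[of _ x]) simp
  next
    case False
    then obtain j0 where j0: "j0 \<in> J" "a i j0 \<noteq> 0" by blast
    define J' where "J' = J - {j0}"
    have J': "finite J'" "card I < card J'" "J = insert j0 J'" "j0 \<notin> J'"
      using insert j0 by (auto simp: J'_def)
    \<comment> \<open>Gaussian elimination: equation \<open>i\<close> serves to remove the unknown
      \<open>j0\<close>, which leaves one equation and one unknown fewer; \<open>t\<close> is then
      the value of the unknown \<open>j0\<close> that satisfies equation \<open>i\<close>.\<close>
    obtain x where x: "\<exists>j\<in>J'. x j \<noteq> 0" "\<And>j. j \<notin> J' \<Longrightarrow> x j = 0"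
      "\<And>l. l \<in> I \<Longrightarrow> (\<Sum>j\<in>J'. (a l j - a l j0 * a i j / a i j0) * x j) = 0"
      using insert.IH[OF J'(1,2), of "\<lambda>l j. a l j - a l j0 * a i j / a i j0"] by blast
    define t where "t = - (\<Sum>j\<in>J'. a i j * x j) / a i j0"
    have split: "(\<Sum>j\<in>J. a l j * (x(j0 := t)) j) = a l j0 * t + (\<Sum>j\<in>J'. a l j * x j)" for l
    proof -
      have "(\<Sum>j\<in>J'. a l j * (x(j0 := t)) j) = (\<Sum>j\<in>J'. a l j * x j)"
        using J'(4) by (intro sum.cong) auto
      then show ?thesis using J' by (simp del: fun_upd_apply add: fun_upd_same)
    qed
    have "(\<Sum>j\<in>J. a l j * (x(j0 := t)) j) = 0" if "l \<in> insert i I" for l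
    proof (cases "l = i")
      case True
      then show ?thesis unfolding split using j0 by (simp add: t_def)
    next
      case False
      then have "0 = (\<Sum>j\<in>J'. (a l j - a l j0 * a i j / a i j0) * x j)" using x(3) that by auto
      also have "\<dots> = (\<Sum>j\<in>J'. a l j * x j) - (\<Sum>j\<in>J'. a l j0 / a i j0 * (a i j * x j))"
        by (simp add: algebra_simps sum_subtractf)
      also have "\<dots> = (\<Sum>j\<in>J'. a l j * x j) + a l j0 * t"
        unfolding t_def sum_distrib_left[symmetric] by simp
      finally show ?thesis unfolding split by (simp add: add.commute)
    qed
    moreover have "\<exists>j\<in>J. (x(j0 := t)) j \<noteq> 0" using x(1) J' by auto
    moreover have "\<forall>j. j \<notin> J \<longrightarrow> (x(j0 := t)) j = 0" using x(2) J' by auto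
    ultimately show ?thesis by blast
  qed
qed

section \<open>Transpositions acting on subsets\<close>

definition swap_set :: "'a \<Rightarrow> 'a \<Rightarrow> 'a set \<Rightarrow> 'a set" where
  "swap_set i j S = Transposition.transpose i j ` S"

lemma mem_swap_set: "x \<in> swap_set i j S \<longleftrightarrow> Transposition.transpose i j x \<in> S"
  unfolding swap_set_def by (metis image_iff transpose_involutory)

lemma swap_set_commute: "swap_set i j S = swap_set j i S"
  by (simp add: swap_set_def transpose_commute)

lemma swap_set_same [simp]: "swap_set i i S = S"
  by (simp add: swap_set_def)

lemma swap_set_invol [simp]: "swap_set i j (swap_set i j S) = S"
  by (auto simp: mem_swap_set)

lemma card_swap_set [simp]: "card (swap_set i j S) = card S"
  by (simp add: swap_set_def card_image)

lemma swap_set_subset_iff: "i \<in> Z \<Longrightarrow> j \<in> Z \<Longrightarrow> swap_set i j S \<subseteq> Z \<longleftrightarrow> S \<subseteq> Z"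
  by (auto simp: swap_set_def subset_iff Transposition.transpose_def split: if_splits)

text \<open>The six products of two different transpositions of \<open>i\<close>, \<open>j\<close>,
  \<open>l\<close> are the two 3-cycles, with three factorizations each; the equations identify
  factorizations of the same 3-cycle.\<close>

lemma swap_set_conj:
  assumes "i \<noteq> j" "j \<noteq> l" "i \<noteq> l"
  shows "swap_set i j (swap_set j l S) = swap_set j l (swap_set i l S)"
    "swap_set i l (swap_set i j S) = swap_set j l (swap_set i l S)"
    "swap_set j l (swap_set i j S) = swap_set i l (swap_set j l S)"
    "swap_set i j (swap_set i l S) = swap_set i l (swap_set j l S)"
  using assms by (auto simp: mem_swap_set Transposition.transpose_def)

lemma swap_set_disjoint:
  assumes "i \<noteq> k" "i \<noteq> l" "j \<noteq> k" "j \<noteq> l"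
  shows "swap_set i j (swap_set k l S) = swap_set k l (swap_set i j S)"
proof -
  have "Transposition.transpose k l (Transposition.transpose i j x)
      = Transposition.transpose i j (Transposition.transpose k l x)" for x
    using assms by (simp add: Transposition.transpose_def)
  then show ?thesis by (simp add: set_eq_iff mem_swap_set)
qed

lemma swap_set_eq: "i \<in> S \<longleftrightarrow> j \<in> S \<Longrightarrow> swap_set i j S = S"
  by (auto simp: mem_swap_set Transposition.transpose_def split: if_splits)

lemma swap_set_move: "i \<in> S \<Longrightarrow> j \<notin> S \<Longrightarrow> swap_set i j S = insert j (S - {i})"
  by (auto simp: mem_swap_set Transposition.transpose_def split: if_splits)

lemma swap_set_insert: "swap_set i j (insert x S) = insert (Transposition.transpose i j x) (swap_set i j S)"
  by (simp add: swap_set_def)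

definition lower :: "'a \<Rightarrow> ('a set \<Rightarrow> complex) \<Rightarrow> 'a set \<Rightarrow> complex" where
  "lower i \<phi> S = (if i \<in> S then 0 else \<phi> (insert i S))"

section \<open>The commuting operators G and their quadratic relations\<close>

locale gaudin =
  fixes Z :: "complex set"
  assumes finite_Z [simp, intro]: "finite Z"
begin

text \<open>A subset records which of the two-state sites in \<open>Z\<close> are flipped. This is
  the Gaudin Hamiltonian of site \<open>i\<close> up to sign and an additive constant. The term
  \<open>j = i\<close> is 0, so the sum may run over all of \<open>Z\<close>.\<close>

definition G :: "complex \<Rightarrow> (complex set \<Rightarrow> complex) \<Rightarrow> complex set \<Rightarrow> complex" where
  "G i \<phi> S = (\<Sum>j\<in>Z. (\<phi> S - \<phi> (swap_set i j S)) / (i - j))"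

definition K :: "complex \<Rightarrow> (complex set \<Rightarrow> complex) \<Rightarrow> complex set \<Rightarrow> complex" where
  "K i \<phi> S = lower i \<phi> S + G i \<phi> S"

definition Q :: "complex \<Rightarrow> complex \<Rightarrow> (complex set \<Rightarrow> complex) \<Rightarrow> complex set \<Rightarrow> complex" where
  "Q i j \<phi> S = \<phi> S - \<phi> (swap_set i j S)"

lemma G_Q: "G i \<phi> S = (\<Sum>j\<in>Z. Q i j \<phi> S / (i - j))"
  by (simp add: G_def Q_def)

lemma G_G: "G i (G j \<phi>) S = (\<Sum>a\<in>Z. \<Sum>b\<in>Z. Q i a (Q j b \<phi>) S / ((i - a) * (j - b)))"
  unfolding G_def[of i]
  by (intro sum.cong refl)
     (simp add: G_Q sum_subtractf[symmetric] sum_divide_distrib Q_def[of i] diff_divide_distrib mult.commute)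

lemma sum_two_out:
  fixes g :: "complex \<Rightarrow> complex"
  assumes "i \<in> Z" "j \<in> Z" "i \<noteq> j"
  shows "sum g Z = g i + g j + sum g (Z - {i, j})"
proof -
  have "sum g Z = g i + sum g (Z - {i})" using assms by (simp add: sum.remove)
  also have "sum g (Z - {i}) = g j + sum g (Z - {i} - {j})" using assms by (intro sum.remove) auto
  also have "Z - {i} - {j} = Z - {i, j}" by auto
  finally show ?thesis by simp
qed

text \<open>The Arnold relation between three differences, which makes the contributions of each
  triple of points to a commutator cancel.\<close>

lemma partial_fraction_3:
  fixes i j l :: complex
  assumes "i \<noteq> j" "j \<noteq> l" "i \<noteq> l"
  shows "1 / ((i - j) * (j - l)) + 1 / ((i - l) * (j - i)) - 1 / ((i - l) * (j - l)) = 0"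
proof -
  have "i - j \<noteq> 0" "j - l \<noteq> 0" "i - l \<noteq> 0" "j - i \<noteq> 0" using assms by auto
  then show ?thesis by (simp add: divide_simps) (simp add: algebra_simps)
qed

text \<open>The swaps of \<open>i, a\<close> and of \<open>j, b\<close> commute unless the two pairs
  share exactly one point. For each third point \<open>l\<close> this leaves three terms; each is
  plus or minus the difference \<open>t\<close> of the two 3-cycles on \<open>i, j, l\<close>, and
  the coefficients add up to 0 by \<open>partial_fraction_3\<close>.\<close>

lemma G_commute:
  assumes "i \<in> Z" "j \<in> Z"
  shows "G i (G j \<phi>) S = G j (G i \<phi>) S"
proof (cases "i = j")
  case False
  define c where "c a b = (Q i a (Q j b \<phi>) S - Q j b (Q i a \<phi>) S) / ((i - a) * (j - b))" for a b
  have c: "c a b = (\<phi> (swap_set j b (swap_set i a S)) - \<phi> (swap_set i a (swap_set j b S))) / ((i - a) * (j - b))" for a b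
    by (simp add: c_def Q_def)
  have "G i (G j \<phi>) S - G j (G i \<phi>) S = (\<Sum>a\<in>Z. \<Sum>b\<in>Z. c a b)"
  proof -
    have "G j (G i \<phi>) S = (\<Sum>a\<in>Z. \<Sum>b\<in>Z. Q j b (Q i a \<phi>) S / ((j - b) * (i - a)))"
      unfolding G_G by (rule sum.swap)
    then show ?thesis unfolding G_G c_def
      by (simp add: sum_subtractf diff_divide_distrib mult.commute)
  qed
  also have "\<dots> = (\<Sum>b\<in>Z. c i b) + (\<Sum>b\<in>Z. c j b) + (\<Sum>a\<in>Z - {i, j}. \<Sum>b\<in>Z. c a b)"
    using assms False by (rule sum_two_out)
  also have "(\<Sum>b\<in>Z. c i b) = 0" by (simp add: c)
  also have "(\<Sum>b\<in>Z. c j b) = (\<Sum>b\<in>Z - {i, j}. c j b)"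
    using assms False by (subst sum_two_out[of i j]) (auto simp: c swap_set_commute)
  also have "(\<Sum>a\<in>Z - {i, j}. \<Sum>b\<in>Z. c a b) = (\<Sum>a\<in>Z - {i, j}. c a i + c a a)"
  proof (intro sum.cong refl)
    fix a assume a: "a \<in> Z - {i, j}"
    have "(\<Sum>b\<in>Z. c a b) = (\<Sum>b\<in>{i, a}. c a b)"
    proof (rule sum.mono_neutral_right)
      show "\<forall>b\<in>Z - {i, a}. c a b = 0"
      proof
        fix b assume "b \<in> Z - {i, a}"
        then show "c a b = 0"
          using a False by (cases "b = j") (auto simp: c swap_set_disjoint[where i = i and j = a and k = j and l = b])
      qed
    qed (use a assms in auto)
    also have "\<dots> = c a i + c a a" using a by (auto simp: sum.insert_if)
    finally show "(\<Sum>b\<in>Z. c a b) = c a i + c a a" .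
  qed
  also have "0 + (\<Sum>b\<in>Z - {i, j}. c j b) + (\<Sum>a\<in>Z - {i, j}. c a i + c a a)
      = (\<Sum>l\<in>Z - {i, j}. c j l + (c l i + c l l))" by (simp add: sum.distrib)
  also have "\<dots> = 0"
  proof (intro sum.neutral ballI)
    fix l assume "l \<in> Z - {i, j}"
    then have l: "l \<in> Z" "l \<noteq> i" "l \<noteq> j" by auto
    define t where "t = \<phi> (swap_set i l (swap_set j l S)) - \<phi> (swap_set j l (swap_set i l S))"
    have 1: "c j l = t * (1 / ((i - j) * (j - l)))"
      using l False swap_set_conj(3,1)[of i j l S] by (simp add: c t_def)
    have 2: "c l i = t * (1 / ((i - l) * (j - i)))"
      using l False swap_set_conj(2,4)[of i j l S] by (simp add: c t_def swap_set_commute[of j i])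
    have 3: "c l l = - t * (1 / ((i - l) * (j - l)))"
      using l False by (simp add: c t_def diff_divide_distrib)
    have "c j l + (c l i + c l l) = t * (1 / ((i - j) * (j - l)) + 1 / ((i - l) * (j - i)) - 1 / ((i - l) * (j - l)))"
      unfolding 1 2 3 by (simp add: algebra_simps)
    then show "c j l + (c l i + c l l) = 0"
      using partial_fraction_3[of i j l] l False by auto
  qed
  finally show ?thesis by simp
qed simp

lemma sum_symm:
  fixes g :: "complex \<Rightarrow> complex \<Rightarrow> complex"
  shows "2 * (\<Sum>a\<in>Z. \<Sum>b\<in>Z. g a b) = (\<Sum>a\<in>Z. \<Sum>b\<in>Z. g a b + g b a)"
proof -
  have "(\<Sum>a\<in>Z. \<Sum>b\<in>Z. g a b) = (\<Sum>a\<in>Z. \<Sum>b\<in>Z. g b a)" by (rule sum.swap)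
  then show ?thesis by (simp only: sum.distrib mult_2)
qed

lemma Q_commute: "Q a b = Q b a"
  by (simp add: Q_def swap_set_commute fun_eq_iff)

lemma Q_divide_antisym: "Q b a \<phi> S / (b - a) = - (Q a b \<phi> S / (a - b))"
  using minus_divide_right[of "Q a b \<phi> S" "a - b"] by (simp add: Q_commute[of b a])

lemma sum_G: "(\<Sum>i\<in>Z. G i \<phi> S) = 0"
proof -
  have "2 * (\<Sum>i\<in>Z. G i \<phi> S) = 0"
    unfolding G_Q sum_symm
    by (intro sum.neutral ballI) (subst Q_divide_antisym, simp)
  then show ?thesis by simp
qed

text \<open>On the two-state space three transpositions satisfy the Temperley--Lieb relation: the
  antisymmetrizer of three sites vanishes.\<close>
lemma Q_anticommute:
  assumes "i \<noteq> j" "j \<noteq> l" "i \<noteq> l"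
  shows "Q i j (Q i l \<phi>) S + Q i l (Q i j \<phi>) S = Q i j \<phi> S + Q i l \<phi> S - Q j l \<phi> S"
proof -
  consider "i \<in> S \<longleftrightarrow> j \<in> S" | "i \<in> S \<longleftrightarrow> l \<in> S" | "j \<in> S \<longleftrightarrow> l \<in> S" by blast
  then have "\<phi> (swap_set i l (swap_set i j S)) + \<phi> (swap_set i j (swap_set i l S)) + \<phi> S
      = \<phi> (swap_set i j S) + \<phi> (swap_set i l S) + \<phi> (swap_set j l S)"
  proof cases
    case 1
    have "swap_set i j (swap_set i l S) = swap_set j l S"
      using swap_set_conj(4)[OF assms, of S] swap_set_conj(3)[OF assms, of S] 1 by (simp add: swap_set_eq)
    then show ?thesis using 1 by (simp add: swap_set_eq)
  next
    case 2
    have "swap_set i l (swap_set i j S) = swap_set j l S"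
      using swap_set_conj(2)[OF assms, of S] 2 by (simp add: swap_set_eq)
    then show ?thesis using 2 by (simp add: swap_set_eq)
  next
    case 3
    have "swap_set i l (swap_set i j S) = swap_set i j S" "swap_set i j (swap_set i l S) = swap_set i l S"
      using 3 swap_set_conj(1,3)[OF assms, of S] swap_set_conj(2,4)[OF assms, of S]
      by (auto simp: swap_set_eq)
    then show ?thesis using 3 by (simp add: swap_set_eq)
  qed
  then show ?thesis by (simp add: Q_def algebra_simps)
qed

lemma Q_Q_same: "Q i j (Q i j \<phi>) S = 2 * Q i j \<phi> S"
  by (simp add: Q_def)

lemma partial_fraction_2:
  fixes i j l :: complex
  assumes "i \<noteq> j" "j \<noteq> l" "i \<noteq> l"
  shows "1 / ((i - j) * (j - l)) + 1 / ((i - l) * (l - j)) = 1 / ((i - j) * (i - l))"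
proof -
  have "i - j \<noteq> 0" "j - l \<noteq> 0" "i - l \<noteq> 0" "l - j \<noteq> 0" using assms by auto
  then show ?thesis by (simp add: divide_simps) (simp add: algebra_simps)
qed

text \<open>After symmetrization in \<open>j\<close> and \<open>l\<close>,
  \<open>Q_anticommute\<close> makes the product of \<open>Q i j\<close> and \<open>Q i l\<close>
  linear, and partial fractions turn the result into difference quotients.\<close>

lemma G_square:
  assumes "i \<in> Z"
  shows "G i (G i \<phi>) S = (\<Sum>j\<in>Z. (G i \<phi> S - G j \<phi> S) / (i - j))"
proof -
  define X where "X j l = Q i j (Q i l \<phi>) S / ((i - j) * (i - l))" for j l
  define Y where "Y j l = (if j = i then 0 else (Q i l \<phi> S / (i - l) - Q j l \<phi> S / (j - l)) / (i - j))" for j l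
  have "G i (G i \<phi>) S = (\<Sum>j\<in>Z. \<Sum>l\<in>Z. X j l)"
    by (simp add: G_G X_def)
  moreover have "(\<Sum>j\<in>Z. (G i \<phi> S - G j \<phi> S) / (i - j)) = (\<Sum>j\<in>Z. \<Sum>l\<in>Z. Y j l)"
  proof (intro sum.cong refl)
    fix j show "(G i \<phi> S - G j \<phi> S) / (i - j) = (\<Sum>l\<in>Z. Y j l)"
      by (cases "j = i") (simp_all add: G_Q Y_def sum_divide_distrib flip: sum_subtractf)
  qed
  moreover have "2 * (\<Sum>j\<in>Z. \<Sum>l\<in>Z. X j l) = 2 * (\<Sum>j\<in>Z. \<Sum>l\<in>Z. Y j l)"
  proof -
    \<comment> \<open>Without corrections the two sides match when \<open>i\<close>,
      \<open>j\<close>, \<open>l\<close> are distinct. The last three summands record the rest: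
      \<open>X\<close> exceeds \<open>Y\<close> on the diagonal, where \<open>Q_Q_same\<close> gives
      a factor 2, and \<open>Y\<close> has entries with one index equal to \<open>i\<close>, where
      \<open>X\<close> vanishes. These corrections sum to zero.\<close>
    have "(\<Sum>j\<in>Z. \<Sum>l\<in>Z. X j l + X l j) = (\<Sum>j\<in>Z. \<Sum>l\<in>Z. Y j l + Y l j
        + (if l = i then Q i j \<phi> S / (i - j)^2 * -1 else 0)
        + (if j = i then Q i l \<phi> S / (i - l)^2 * -1 else 0)
        + (if j = l then 2 * Q i j \<phi> S / (i - j)^2 else 0))"
    proof (intro sum.cong refl)
      fix j l assume "j \<in> Z" "l \<in> Z"
      consider "j = i" "l = i" | "j = i" "l \<noteq> i" | "j \<noteq> i" "l = i" | "j \<noteq> i" "l = j"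
        | "j \<noteq> i" "l \<noteq> i" "l \<noteq> j" by blast
      then show "X j l + X l j = Y j l + Y l j
        + (if l = i then Q i j \<phi> S / (i - j)^2 * -1 else 0)
        + (if j = i then Q i l \<phi> S / (i - l)^2 * -1 else 0)
        + (if j = l then 2 * Q i j \<phi> S / (i - j)^2 else 0)"
      proof cases
        case 5
        have "X j l + X l j = (Q i j (Q i l \<phi>) S + Q i l (Q i j \<phi>) S) / ((i - j) * (i - l))"
          by (simp add: X_def add_divide_distrib mult.commute)
        also have "\<dots> = (Q i j \<phi> S + Q i l \<phi> S) / ((i - j) * (i - l)) - Q j l \<phi> S * (1 / ((i - j) * (i - l)))"
          using 5 by (subst Q_anticommute) (auto simp: diff_divide_distrib)
        also have "\<dots> = (Q i j \<phi> S + Q i l \<phi> S) / ((i - j) * (i - l))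
            - Q j l \<phi> S * (1 / ((i - j) * (j - l)) + 1 / ((i - l) * (l - j)))"
          using 5 by (subst partial_fraction_2) auto
        also have "\<dots> = Y j l + Y l j"
          using 5 by (simp add: Y_def diff_divide_distrib add_divide_distrib algebra_simps Q_commute[of l j])
        finally show ?thesis using 5 by simp
      next
        case 2
        have "Q l i \<phi> S / (l - i) = - (Q i l \<phi> S / (i - l))" by (rule Q_divide_antisym)
        with 2 show ?thesis by (simp add: X_def Y_def Q_def power2_eq_square)
      next
        case 3
        have "Q j i \<phi> S / (j - i) = - (Q i j \<phi> S / (i - j))" by (rule Q_divide_antisym)
        with 3 show ?thesis by (simp add: X_def Y_def Q_def power2_eq_square)
      next
        case 4
        then show ?thesis
          by (simp add: X_def Y_def Q_Q_same power2_eq_square)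
      qed (simp add: X_def Y_def Q_def)
    qed
    also have "\<dots> = (\<Sum>j\<in>Z. \<Sum>l\<in>Z. Y j l + Y l j)"
    proof -
      define a where "a = (\<lambda>j. Q i j \<phi> S / (i - j)^2)"
      have 1: "(\<Sum>j\<in>Z. \<Sum>l\<in>Z. if l = i then Q i j \<phi> S / (i - j)^2 * -1 else 0) = - sum a Z"
        using assms by (simp add: sum.delta sum_negf a_def)
      have "(\<Sum>j\<in>Z. \<Sum>l\<in>Z. if j = i then Q i l \<phi> S / (i - l)^2 * -1 else 0)
          = (\<Sum>l\<in>Z. \<Sum>j\<in>Z. if j = i then Q i l \<phi> S / (i - l)^2 * -1 else 0)"
        by (rule sum.swap)
      then have 2: "(\<Sum>j\<in>Z. \<Sum>l\<in>Z. if j = i then Q i l \<phi> S / (i - l)^2 * -1 else 0) = - sum a Z"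
        using assms by (simp add: sum.delta sum_negf a_def)
      have 3: "(\<Sum>j\<in>Z. \<Sum>l\<in>Z. if j = l then 2 * Q i j \<phi> S / (i - j)^2 else 0) = 2 * sum a Z"
        by (simp add: sum.delta' sum.delta a_def sum_distrib_left)
      show ?thesis unfolding sum.distrib 1 2 3 by simp
    qed
    finally show ?thesis by (simp add: sum_symm)
  qed
  ultimately show ?thesis by simp
qed

section \<open>The operators K: G deformed by lowering\<close>

lemma lower_G_commute:
  assumes "i \<in> Z" "j \<in> Z" "i \<noteq> j"
  shows "lower i (G j \<phi>) S - G j (lower i \<phi>) S =
    (lower i \<phi> (swap_set i j S) - (if i \<in> S then 0 else \<phi> (swap_set i j (insert i S)))) / (j - i)"
proof -
  have "lower i (G j \<phi>) S - G j (lower i \<phi>) S =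
     (\<Sum>b\<in>Z. (lower i \<phi> (swap_set j b S) - (if i \<in> S then 0 else \<phi> (swap_set j b (insert i S)))) / (j - b))"
    by (auto simp: lower_def G_def sum_subtractf diff_divide_distrib sum_negf)
  \<comment> \<open>Only the swap with \<open>b = i\<close> moves the site on which
    \<open>lower i\<close> acts; every other term of \<open>G j\<close> commutes with it.\<close>
  also have "\<dots> = (\<Sum>b\<in>{i}. (lower i \<phi> (swap_set j b S) - (if i \<in> S then 0 else \<phi> (swap_set j b (insert i S)))) / (j - b))"
  proof (rule sum.mono_neutral_right)
    show "\<forall>b\<in>Z - {i}. (lower i \<phi> (swap_set j b S) - (if i \<in> S then 0 else \<phi> (swap_set j b (insert i S)))) / (j - b) = 0"
    proof
      fix b assume "b \<in> Z - {i}"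
      then have "i \<in> swap_set j b S \<longleftrightarrow> i \<in> S" "swap_set j b (insert i S) = insert i (swap_set j b S)"
        using assms by (auto simp: mem_swap_set swap_set_insert)
      then show "(lower i \<phi> (swap_set j b S) - (if i \<in> S then 0 else \<phi> (swap_set j b (insert i S)))) / (j - b) = 0"
        by (simp add: lower_def)
    qed
  qed (use assms in auto)
  finally show ?thesis by (simp add: swap_set_commute[of j i])
qed

lemma G_add: "G i (\<lambda>S. \<phi> S + \<psi> S) S = G i \<phi> S + G i \<psi> S"
  by (simp add: G_def sum.distrib[symmetric] add_divide_distrib[symmetric] algebra_simps)

lemma lower_add: "lower i (\<lambda>S. \<phi> S + \<psi> S) S = lower i \<phi> S + lower i \<psi> S"
  by (simp add: lower_def)

lemma K_add: "K i (\<lambda>S. \<phi> S + \<psi> S) S = K i \<phi> S + K i \<psi> S"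
  by (simp add: K_def G_add lower_add)

lemma G_scale: "G i (\<lambda>S. c * \<phi> S) S = c * G i \<phi> S"
  by (simp add: G_def sum_distrib_left right_diff_distrib)

lemma K_scale: "K i (\<lambda>S. c * \<phi> S) S = c * K i \<phi> S"
  by (simp add: K_def G_scale lower_def algebra_simps)

lemma K_K: "K i (K j \<phi>) S = lower i (lower j \<phi>) S + lower i (G j \<phi>) S + G i (lower j \<phi>) S + G i (G j \<phi>) S"
proof -
  have "K j \<phi> = (\<lambda>S. lower j \<phi> S + G j \<phi> S)" by (simp add: fun_eq_iff K_def)
  then show ?thesis by (simp add: K_def G_add lower_add)
qed

lemma lower_commute: "lower i (lower j \<phi>) S = lower j (lower i \<phi>) S"
  by (simp add: lower_def insert_commute)

text \<open>Both kinds of summands commute among themselves. The cross terms fail to do so only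
  through the swap of \<open>i\<close> and \<open>j\<close>: the two defects \<open>x\<close> and
  \<open>y\<close> are opposite and stand over opposite differences, so they cancel in the
  commutator.\<close>

lemma K_commute:
  assumes "i \<in> Z" "j \<in> Z"
  shows "K i (K j \<phi>) = K j (K i \<phi>)"
proof (rule ext, cases "i = j")
  fix S assume ne: "i \<noteq> j"
  define x where "x = lower i \<phi> (swap_set i j S) - (if i \<in> S then 0 else \<phi> (swap_set i j (insert i S)))"
  define y where "y = lower j \<phi> (swap_set i j S) - (if j \<in> S then 0 else \<phi> (swap_set i j (insert j S)))"
  have "x + y = 0"
    using ne by (auto simp: x_def y_def lower_def mem_swap_set swap_set_insert insert_commute)
  then have y: "y = - x" by (simp add: eq_neg_iff_add_eq_0 add.commute)
  have "K i (K j \<phi>) S - K j (K i \<phi>) S =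
     (lower i (G j \<phi>) S - G j (lower i \<phi>) S) - (lower j (G i \<phi>) S - G i (lower j \<phi>) S)"
    using assms by (simp add: K_K lower_commute[of j] G_commute[of j i])
  also have "\<dots> = x / (j - i) - y / (i - j)"
    using assms ne by (simp add: lower_G_commute x_def y_def swap_set_commute[of j i])
  also have "\<dots> = 0" unfolding y using ne by (simp add: divide_simps) (simp add: algebra_simps)
  finally show "K i (K j \<phi>) S = K j (K i \<phi>) S" by simp
qed simp

text \<open>\<open>lower i\<close> squares to zero, and its anticommutator with \<open>G i\<close>
  is the sum of the \<open>(lower i - lower j) / (i - j)\<close>. So the deformation keeps the
  relation of \<open>G_square\<close>.\<close>

lemma K_square:
  assumes "i \<in> Z"
  shows "K i (K i \<phi>) S = (\<Sum>j\<in>Z. (K i \<phi> S - K j \<phi> S) / (i - j))"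
proof -
  have "lower i (G i \<phi>) S + G i (lower i \<phi>) S = (\<Sum>j\<in>Z. (lower i \<phi> S - lower j \<phi> S) / (i - j))"
  proof -
    have "lower i (G i \<phi>) S + G i (lower i \<phi>) S = (\<Sum>j\<in>Z. ((if i \<in> S then 0 else Q i j \<phi> (insert i S)) + Q i j (lower i \<phi>) S) / (i - j))"
      by (auto simp: lower_def G_def Q_def sum_subtractf diff_divide_distrib sum_negf add_divide_distrib sum.distrib)
    also have "\<dots> = (\<Sum>j\<in>Z. (lower i \<phi> S - lower j \<phi> S) / (i - j))"
    proof (intro sum.cong refl)
      fix j assume "j \<in> Z"
      show "((if i \<in> S then 0 else Q i j \<phi> (insert i S)) + Q i j (lower i \<phi>) S) / (i - j)
        = (lower i \<phi> S - lower j \<phi> S) / (i - j)"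
      proof (cases "i = j")
        case False
        have "i \<notin> S \<Longrightarrow> j \<notin> S \<Longrightarrow> swap_set i j S = S" "i \<in> S \<Longrightarrow> j \<in> S \<Longrightarrow> swap_set i j S = S"
          by (auto simp: swap_set_eq)
        moreover have "i \<in> S \<Longrightarrow> j \<notin> S \<Longrightarrow> insert i (swap_set i j S) = insert j S"
          using False by (auto simp: swap_set_move)
        moreover have "i \<notin> S \<Longrightarrow> j \<in> S \<Longrightarrow> insert j (swap_set i j S) = insert i S"
          using False by (auto simp: swap_set_move swap_set_commute[of i j])
        ultimately show ?thesis using False
          by (cases "i \<in> S"; cases "j \<in> S") (auto simp: Q_def lower_def mem_swap_set swap_set_insert)
      qed simp
    qed
    finally show ?thesis .
  qed
  moreover have "lower i (lower i \<phi>) S = 0" by (simp add: lower_def)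
  ultimately show ?thesis using assms
    by (simp add: K_K G_square sum.distrib[symmetric] add_divide_distrib[symmetric])
       (intro sum.cong refl, simp add: K_def algebra_simps)
qed

abbreviation supported :: "(complex set \<Rightarrow> complex) \<Rightarrow> bool" where
  "supported \<phi> \<equiv> \<forall>S. \<not> S \<subseteq> Z \<longrightarrow> \<phi> S = 0"

lemma supported_G: "i \<in> Z \<Longrightarrow> supported \<phi> \<Longrightarrow> supported (G i \<phi>)"
  by (simp add: G_def swap_set_subset_iff)

lemma supported_lower: "supported \<phi> \<Longrightarrow> supported (lower i \<phi>)"
  by (simp add: lower_def)

lemma supported_K: "i \<in> Z \<Longrightarrow> supported \<phi> \<Longrightarrow> supported (K i \<phi>)"
  using supported_G[of i \<phi>] supported_lower[of \<phi> i] by (simp add: K_def)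

lemma G_eq_0:
  assumes "i \<in> Z" "S \<subseteq> Z" "\<And>T. T \<subseteq> Z \<Longrightarrow> card T = card S \<Longrightarrow> \<phi> T = 0"
  shows "G i \<phi> S = 0"
  using assms by (simp add: G_def swap_set_subset_iff)

text \<open>Solved for \<open>lower i\<close>, the eigenvalue equation at \<open>S'\<close> gives
  the value at \<open>insert i S'\<close> in terms of values at sets of the size of
  \<open>S'\<close>, since \<open>G i\<close> preserves cardinality. All values thus propagate from
  the empty set.\<close>

lemma K_eigenvector_eq_0:
  assumes "\<And>i S. i \<in> Z \<Longrightarrow> K i \<phi> S = h i * \<phi> S" "\<phi> {} = 0" "supported \<phi>"
  shows "\<phi> S = 0"
proof -
  have "\<forall>S. S \<subseteq> Z \<longrightarrow> card S = m \<longrightarrow> \<phi> S = 0" for m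
  proof (induction m)
    case 0
    then show ?case using assms(2) finite_subset[OF _ finite_Z] by auto
  next
    case (Suc m)
    show ?case
    proof (intro allI impI)
      fix S assume S: "S \<subseteq> Z" "card S = Suc m"
      then obtain i S' where S': "S = insert i S'" "i \<notin> S'" "card S' = m"
        by (metis card_Suc_eq)
      then have "\<phi> S = lower i \<phi> S'" by (simp add: lower_def)
      also have "\<dots> = h i * \<phi> S' - G i \<phi> S'" using assms(1)[of i S'] S S' by (simp add: K_def eq_diff_eq)
      also have "\<dots> = 0" using Suc S S' by (subst G_eq_0) auto
      finally show "\<phi> S = 0" .
    qed
  qed
  then show ?thesis using assms(3) by blast
qed

section \<open>Products of the operators K as linear coordinates\<close>

definition K_set :: "complex set \<Rightarrow> (complex set \<Rightarrow> complex) \<Rightarrow> complex set \<Rightarrow> complex" where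
  "K_set S \<phi> = Finite_Set.fold K \<phi> S"

lemma comp_fun_commute_K: "comp_fun_commute_on Z K"
  by unfold_locales (simp add: fun_eq_iff K_commute)

lemma K_set_empty [simp]: "K_set {} \<phi> = \<phi>"
  by (simp add: K_set_def)

lemma K_set_insert: "insert i S \<subseteq> Z \<Longrightarrow> i \<notin> S \<Longrightarrow> K_set (insert i S) \<phi> = K i (K_set S \<phi>)"
  unfolding K_set_def
  by (rule comp_fun_commute_on.fold_insert[OF comp_fun_commute_K]) (auto intro: finite_subset)

lemma K_set_K: "insert i S \<subseteq> Z \<Longrightarrow> K_set S (K i \<phi>) = K i (K_set S \<phi>)"
  unfolding K_set_def
  by (rule comp_fun_commute_on.fold_fun_left_comm[OF comp_fun_commute_K, symmetric]) (auto intro: finite_subset)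

lemma K_lincomb: "K i (\<lambda>T. a * \<phi> T + b * \<psi> T) = (\<lambda>T. a * K i \<phi> T + b * K i \<psi> T)"
  by (simp add: fun_eq_iff K_add K_scale)

lemma K_set_lincomb:
  assumes "S \<subseteq> Z"
  shows "K_set S (\<lambda>T. a * \<phi> T + b * \<psi> T) = (\<lambda>T. a * K_set S \<phi> T + b * K_set S \<psi> T)"
proof -
  have "finite S" using assms finite_subset by blast
  then show ?thesis using assms
  proof (induction S rule: finite_induct)
    case (insert i S)
    then show ?case by (simp add: K_set_insert K_lincomb)
  qed simp
qed

definition vanishes_below :: "nat \<Rightarrow> (complex set \<Rightarrow> complex) \<Rightarrow> bool" where
  "vanishes_below m \<phi> \<longleftrightarrow> (\<forall>S. S \<subseteq> Z \<longrightarrow> card S < m \<longrightarrow> \<phi> S = 0)"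

lemma vanishes_below_K:
  assumes "vanishes_below (Suc m) \<phi>" "i \<in> Z"
  shows "vanishes_below m (K i \<phi>)"
  unfolding vanishes_below_def
proof (intro allI impI)
  fix S assume S: "S \<subseteq> Z" "card S < m"
  then have "finite S" using finite_subset by blast
  then have "lower i \<phi> S = 0" using S assms by (simp add: lower_def vanishes_below_def)
  moreover have "G i \<phi> S = 0" using S assms by (intro G_eq_0) (auto simp: vanishes_below_def)
  ultimately show "K i \<phi> S = 0" by (simp add: K_def)
qed

lemma vanishes_below_K_set:
  assumes "S \<subseteq> Z" "vanishes_below (card S + m) \<phi>"
  shows "vanishes_below m (K_set S \<phi>)"
proof -
  have "finite S" using assms finite_subset by blast
  then show ?thesis using assms
  proof (induction S arbitrary: m rule: finite_induct)
    case (insert i S)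
    then show ?case by (simp add: K_set_insert vanishes_below_K)
  qed simp
qed

text \<open>The value at \<open>T\<close> involves \<open>\<phi>\<close> only on sets with at most
  \<open>card S + card T\<close> elements, and the largest size is reached only if every factor
  contributes its lowering part.\<close>

lemma K_set_leading:
  assumes "S \<subseteq> Z" "T \<subseteq> Z" "S \<inter> T = {}" "vanishes_below (card S + card T) \<phi>"
  shows "K_set S \<phi> T = \<phi> (S \<union> T)"
proof -
  have "finite S" using assms finite_subset by blast
  then show ?thesis using assms
  proof (induction S arbitrary: T rule: finite_induct)
    case (insert i S)
    have fT: "finite T" using insert.prems(2) finite_subset[OF _ finite_Z] by blast
    have 1: "vanishes_below (Suc (card T)) (K_set S \<phi>)"
      using insert.prems insert.hyps by (intro vanishes_below_K_set) auto
    have "K_set (insert i S) \<phi> T = K i (K_set S \<phi>) T" using insert.prems insert.hyps by (simp add: K_set_insert)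
    also have "\<dots> = K_set S \<phi> (insert i T)"
      using 1 insert.prems by (simp add: K_def lower_def) (intro G_eq_0, auto simp: vanishes_below_def)
    also have "\<dots> = \<phi> (S \<union> insert i T)" using insert.prems insert.hyps fT by (intro insert.IH) auto
    finally show ?case by simp
  qed simp
qed

text \<open>By \<open>K_set_leading\<close> with \<open>T = {}\<close>, the functionals sending
  \<open>\<phi>\<close> to \<open>K_set S \<phi> {}\<close> are unitriangular with respect to
  cardinality; hence they separate supported functions.\<close>

lemma K_set_inj:
  assumes "supported \<phi>" "\<And>S. S \<subseteq> Z \<Longrightarrow> K_set S \<phi> {} = 0"
  shows "\<phi> S = 0"
proof -
  have "vanishes_below m \<phi>" for m
  proof (induction m)
    case (Suc m)
    have "\<phi> S = 0" if "S \<subseteq> Z" "card S = m" for S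
      using K_set_leading[of S "{}" \<phi>] Suc that assms(2)[of S] by simp
    with Suc show ?case by (auto simp: vanishes_below_def less_Suc_eq)
  qed (simp add: vanishes_below_def)
  then show ?thesis using assms(1) unfolding vanishes_below_def by blast
qed

lemma K_set_surj: "\<exists>\<phi>. supported \<phi> \<and> (\<forall>S. S \<subseteq> Z \<longrightarrow> K_set S \<phi> {} = g S)"
proof -
  have "\<exists>\<phi>. supported \<phi> \<and> (\<forall>S. S \<subseteq> Z \<longrightarrow> card S < m \<longrightarrow> K_set S \<phi> {} = g S)" for m
  proof (induction m)
    case 0
    show ?case by (intro exI[of _ "\<lambda>_. 0"]) simp
  next
    case (Suc m)
    then obtain \<phi> where \<phi>: "supported \<phi>" "\<And>S. S \<subseteq> Z \<Longrightarrow> card S < m \<Longrightarrow> K_set S \<phi> {} = g S" by blast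
    \<comment> \<open>The correction lives on level \<open>m\<close>: it adjusts the coordinates of
      sets of size \<open>m\<close> and leaves those of smaller sets unchanged.\<close>
    define \<psi> where "\<psi> = (\<lambda>S. if S \<subseteq> Z \<and> card S = m then g S - K_set S \<phi> {} else 0)"
    have V: "vanishes_below m \<psi>" by (simp add: vanishes_below_def \<psi>_def)
    have 1: "K_set S (\<lambda>T. \<phi> T + \<psi> T) {} = g S" if S: "S \<subseteq> Z" "card S < Suc m" for S
    proof -
      have "K_set S (\<lambda>T. \<phi> T + \<psi> T) {} = K_set S \<phi> {} + K_set S \<psi> {}"
        using K_set_lincomb[OF S(1), of 1 \<phi> 1 \<psi>] by simp
      also have "K_set S \<psi> {} = \<psi> S"
      proof -
        have "vanishes_below (card S + card {}) \<psi>" using V S by (simp add: vanishes_below_def)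
        from K_set_leading[OF S(1) _ _ this] show ?thesis by simp
      qed
      also have "K_set S \<phi> {} + \<psi> S = g S"
        using S \<phi>(2)[of S] by (cases "card S = m") (auto simp: \<psi>_def)
      finally show ?thesis .
    qed
    have 2: "supported (\<lambda>T. \<phi> T + \<psi> T)" using \<phi>(1) by (simp add: \<psi>_def)
    show ?case by (intro exI[of _ "\<lambda>T. \<phi> T + \<psi> T"] conjI 2 allI impI 1)
  qed
  from this[of "Suc (card Z)"] show ?thesis
    by (auto simp: less_Suc_eq_le card_mono)
qed

definition quadratic :: "(complex \<Rightarrow> complex) \<Rightarrow> bool" where
  "quadratic h \<longleftrightarrow> (\<forall>i\<in>Z. (h i)^2 = (\<Sum>j\<in>Z. (h i - h j) / (i - j)))"

text \<open>An eigenvector with value 1 at the empty set must have the coordinates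
  \<open>prod h S\<close>, and \<open>K_set_surj\<close> supplies a function with them. The
  eigenvalue equation is checked in the same coordinates; for \<open>i \<notin> S\<close> it holds
  by construction, for \<open>i \<in> S\<close> it rests on \<open>quadratic\<close>.\<close>

lemma quadratic_eigenvector:
  assumes h: "quadratic h"
  obtains \<phi> where "supported \<phi>" "\<phi> {} = 1" "\<And>i S. i \<in> Z \<Longrightarrow> K i \<phi> S = h i * \<phi> S"
proof -
  obtain \<phi> where \<phi>: "supported \<phi>" "\<And>S. S \<subseteq> Z \<Longrightarrow> K_set S \<phi> {} = prod h S"
    using K_set_surj[of "prod h"] by blast
  have step: "K_set S (K i \<phi>) {} = h i * prod h S" if "S \<subseteq> Z" "i \<in> Z" for S i
    using that
  proof (induction "card S" arbitrary: S i rule: less_induct)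
    case less
    have fin: "finite S" using less.prems(1) finite_subset[OF _ finite_Z] by blast
    show ?case
    proof (cases "i \<in> S")
      case False
      then have "K_set S (K i \<phi>) = K_set (insert i S) \<phi>" using less.prems by (simp add: K_set_K K_set_insert)
      then show ?thesis using False less.prems \<phi>(2)[of "insert i S"] fin by simp
    next
      case True
      define S' where "S' = S - {i}"
      have S': "S = insert i S'" "i \<notin> S'" "S' \<subseteq> Z" "finite S'" using True less.prems fin by (auto simp: S'_def)
      \<comment> \<open>All \<open>j\<close> in \<open>Z\<close> are covered, also members of
        \<open>S'\<close>. This is needed because \<open>K_square\<close> trades the double factor
        \<open>K i\<close> for a sum of single factors \<open>K j\<close>.\<close>
      have IH: "K j (K_set S' \<phi>) {} = h j * prod h S'" if "j \<in> Z" for j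
      proof -
        have "K_set S' (K j \<phi>) {} = h j * prod h S'"
          using less.hyps[of S' j] S' that fin by (simp add: card_insert_if)
        then show ?thesis using S' that by (simp add: K_set_K)
      qed
      have "K_set S (K i \<phi>) = K i (K i (K_set S' \<phi>))" using S' less.prems by (simp add: K_set_K K_set_insert)
      then have "K_set S (K i \<phi>) {} = (\<Sum>j\<in>Z. (h i * prod h S' - h j * prod h S') / (i - j))"
        using less.prems by (simp add: K_square IH)
      also have "\<dots> = (\<Sum>j\<in>Z. (h i - h j) / (i - j)) * prod h S'"
        by (simp add: sum_distrib_right left_diff_distrib)
      also have "\<dots> = (h i)^2 * prod h S'" using h less.prems by (simp add: quadratic_def)
      also have "\<dots> = h i * prod h S" using S' by (simp add: power2_eq_square)
      finally show ?thesis .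
    qed
  qed
  have "K i \<phi> S - h i * \<phi> S = 0" if i: "i \<in> Z" for i S
  proof (rule K_set_inj[of "\<lambda>S. K i \<phi> S - h i * \<phi> S"])
    show "supported (\<lambda>S. K i \<phi> S - h i * \<phi> S)" using supported_K[OF i \<phi>(1)] \<phi>(1) by simp
    fix S assume S: "S \<subseteq> Z"
    have "K_set S (\<lambda>S. K i \<phi> S - h i * \<phi> S) {} = K_set S (K i \<phi>) {} - h i * K_set S \<phi> {}"
      using K_set_lincomb[OF S, of 1 "K i \<phi>" "- h i" \<phi>] by simp
    then show "K_set S (\<lambda>S. K i \<phi> S - h i * \<phi> S) {} = 0" using S i step \<phi>(2) by simp
  qed
  moreover have "\<phi> {} = 1" using \<phi>(2)[of "{}"] by simp
  ultimately show ?thesis using that \<phi>(1) by simp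
qed

section \<open>Raising and lowering operators, inner product\<close>

definition total_lower :: "(complex set \<Rightarrow> complex) \<Rightarrow> complex set \<Rightarrow> complex" where
  "total_lower \<phi> S = (\<Sum>i\<in>Z. lower i \<phi> S)"

definition total_raise :: "(complex set \<Rightarrow> complex) \<Rightarrow> complex set \<Rightarrow> complex" where
  "total_raise \<phi> S = (if S \<subseteq> Z then \<Sum>j\<in>S. \<phi> (S - {j}) else 0)"

lemma total_lower_K: "total_lower \<phi> S = (\<Sum>i\<in>Z. K i \<phi> S)"
  by (simp add: total_lower_def K_def sum.distrib sum_G)

lemma total_lower_subset:
  assumes "S \<subseteq> Z"
  shows "total_lower \<phi> S = (\<Sum>i\<in>Z - S. \<phi> (insert i S))"
  unfolding total_lower_def using assms
  by (intro sum.mono_neutral_cong_right) (auto simp: lower_def)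

text \<open>For \<open>n\<close> sites, primitive functions on level \<open>a\<close> have spin
  \<open>s = n/2 - a\<close>, and the value is \<open>n/2 * (n/2 + 1) - s * (s + 1)\<close>, a
  difference of Casimir eigenvalues of sl2.\<close>

definition casimir :: "nat \<Rightarrow> complex" where
  "casimir a = of_nat a * (of_nat (card Z) + 1 - of_nat a)"

lemma sum_Q_cross:
  assumes "S \<subseteq> Z"
  shows "(\<Sum>i\<in>Z. \<Sum>j\<in>Z. Q i j \<phi> S) = 2 * (\<Sum>i\<in>S. \<Sum>j\<in>Z - S. Q i j \<phi> S)"
proof -
  have fS: "finite S" using assms finite_subset by blast
  have split: "sum g Z = sum g S + sum g (Z - S)" for g :: "complex \<Rightarrow> complex"
    using sum.subset_diff[OF assms finite_Z, of g] by (simp add: add.commute)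
  have "(\<Sum>i\<in>S. \<Sum>j\<in>S. Q i j \<phi> S) = 0" "(\<Sum>i\<in>Z - S. \<Sum>j\<in>Z - S. Q i j \<phi> S) = 0"
    by (auto intro!: sum.neutral simp: Q_def swap_set_eq)
  moreover have "(\<Sum>i\<in>Z - S. \<Sum>j\<in>S. Q i j \<phi> S) = (\<Sum>i\<in>S. \<Sum>j\<in>Z - S. Q i j \<phi> S)"
    by (subst sum.swap) (simp add: Q_commute)
  ultimately show ?thesis by (simp add: split sum.distrib)
qed

lemma total_raise_total_lower:
  assumes "S \<subseteq> Z"
  shows "total_raise (total_lower \<phi>) S
    = of_nat (card S) * \<phi> S + (\<Sum>i\<in>S. \<Sum>j\<in>Z - S. \<phi> (insert j (S - {i})))"
proof -
  have "total_raise (total_lower \<phi>) S = (\<Sum>i\<in>S. \<Sum>j\<in>Z - (S - {i}). \<phi> (insert j (S - {i})))"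
    using assms by (simp add: total_raise_def) (intro sum.cong refl total_lower_subset, auto)
  also have "\<dots> = (\<Sum>i\<in>S. \<phi> S + (\<Sum>j\<in>Z - S. \<phi> (insert j (S - {i}))))"
  proof (intro sum.cong refl)
    fix i assume i: "i \<in> S"
    have "Z - (S - {i}) = insert i (Z - S)" using i assms by auto
    then show "(\<Sum>j\<in>Z - (S - {i}). \<phi> (insert j (S - {i}))) = \<phi> S + (\<Sum>j\<in>Z - S. \<phi> (insert j (S - {i})))"
      using i by (simp add: insert_absorb)
  qed
  also have "\<dots> = of_nat (card S) * \<phi> S + (\<Sum>i\<in>S. \<Sum>j\<in>Z - S. \<phi> (insert j (S - {i})))"
    by (simp add: sum.distrib)
  finally show ?thesis .
qed

text \<open>Exchanging the summation indices cancels the denominators, as \<open>i / (i - j)\<close>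
  and \<open>j / (j - i)\<close> add up to 1. What remains is a sum over all exchanges of two sites,
  which no longer involves the positions and is expressed by raising and lowering.\<close>

lemma weighted_sum_G:
  assumes "S \<subseteq> Z"
  shows "(\<Sum>i\<in>Z. i * G i \<phi> S) = casimir (card S) * \<phi> S - total_raise (total_lower \<phi>) S"
proof -
  have fS: "finite S" using assms finite_subset by blast
  define B where "B = (\<Sum>i\<in>S. \<Sum>j\<in>Z - S. \<phi> (insert j (S - {i})))"
  have cZ: "of_nat (card (Z - S)) = (of_nat (card Z) - of_nat (card S) :: complex)"
    using assms fS by (simp add: card_Diff_subset of_nat_diff card_mono)
  have "2 * (\<Sum>i\<in>Z. i * G i \<phi> S) = 2 * (\<Sum>i\<in>Z. \<Sum>j\<in>Z. i * (Q i j \<phi> S / (i - j)))"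
    by (simp add: G_Q sum_distrib_left)
  also have "\<dots> = (\<Sum>i\<in>Z. \<Sum>j\<in>Z. Q i j \<phi> S)"
    unfolding sum_symm
  proof (intro sum.cong refl)
    fix i j
    show "i * (Q i j \<phi> S / (i - j)) + j * (Q j i \<phi> S / (j - i)) = Q i j \<phi> S"
    proof (cases "i = j")
      case False
      have "i * (Q i j \<phi> S / (i - j)) + j * (Q j i \<phi> S / (j - i)) = (i - j) * (Q i j \<phi> S / (i - j))"
      proof -
        have "i * q + j * - q = (i - j) * q" for q by (simp add: algebra_simps)
        then show ?thesis unfolding Q_divide_antisym[of j i] .
      qed
      then show ?thesis using False by simp
    qed (simp add: Q_def)
  qed
  also have "\<dots> = 2 * (\<Sum>i\<in>S. \<Sum>j\<in>Z - S. Q i j \<phi> S)" by (rule sum_Q_cross[OF assms])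
  also have "(\<Sum>i\<in>S. \<Sum>j\<in>Z - S. Q i j \<phi> S) = (\<Sum>i\<in>S. \<Sum>j\<in>Z - S. \<phi> S - \<phi> (insert j (S - {i})))"
    by (intro sum.cong refl) (simp add: Q_def swap_set_move)
  also have "\<dots> = of_nat (card S) * (of_nat (card Z) - of_nat (card S)) * \<phi> S - B"
    unfolding sum_subtractf B_def by (simp add: cZ)
  finally have 1: "(\<Sum>i\<in>Z. i * G i \<phi> S) = of_nat (card S) * (of_nat (card Z) - of_nat (card S)) * \<phi> S - B"
    by (simp only: mult_cancel_left) simp
  show ?thesis unfolding 1 total_raise_total_lower[OF assms] by (simp add: B_def casimir_def algebra_simps)
qed

lemma weighted_sum_G_primitive:
  assumes "S \<subseteq> Z" "\<And>S. total_lower \<phi> S = 0"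
  shows "(\<Sum>i\<in>Z. i * G i \<phi> S) = casimir (card S) * \<phi> S"
  using assms by (simp add: weighted_sum_G total_raise_def)

text \<open>The sl2 commutation relation: both orders produce the same exchange terms
  \<open>B\<close> and differ only in how often they return to \<open>S\<close>, namely
  \<open>card (Z - S)\<close> against \<open>card S\<close> times.\<close>

lemma total_lower_total_raise:
  assumes "S \<subseteq> Z"
  shows "total_lower (total_raise \<phi>) S = total_raise (total_lower \<phi>) S
    + (of_nat (card Z) - 2 * of_nat (card S)) * \<phi> S"
proof -
  have fS: "finite S" using assms finite_subset by blast
  have cZ: "of_nat (card (Z - S)) = (of_nat (card Z) - of_nat (card S) :: complex)"
    using assms fS by (simp add: card_Diff_subset of_nat_diff card_mono)
  define B where "B = (\<Sum>i\<in>S. \<Sum>j\<in>Z - S. \<phi> (insert j (S - {i})))"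
  have 1: "total_raise (total_lower \<phi>) S = of_nat (card S) * \<phi> S + B"
    by (simp add: total_raise_total_lower[OF assms] B_def)
  have "total_lower (total_raise \<phi>) S = (\<Sum>j\<in>Z - S. \<Sum>i\<in>insert j S. \<phi> (insert j S - {i}))"
    using assms by (simp add: total_lower_subset total_raise_def)
  also have "\<dots> = (\<Sum>j\<in>Z - S. \<phi> S + (\<Sum>i\<in>S. \<phi> (insert j (S - {i}))))"
  proof (intro sum.cong refl)
    fix j assume j: "j \<in> Z - S"
    then have "(\<Sum>i\<in>S. \<phi> (insert j S - {i})) = (\<Sum>i\<in>S. \<phi> (insert j (S - {i})))"
      by (intro sum.cong refl arg_cong[of _ _ \<phi>]) auto
    then show "(\<Sum>i\<in>insert j S. \<phi> (insert j S - {i})) = \<phi> S + (\<Sum>i\<in>S. \<phi> (insert j (S - {i})))"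
      using j fS by simp
  qed
  also have "\<dots> = (of_nat (card Z) - of_nat (card S)) * \<phi> S + (\<Sum>j\<in>Z - S. \<Sum>i\<in>S. \<phi> (insert j (S - {i})))"
    by (simp add: sum.distrib cZ)
  also have "(\<Sum>j\<in>Z - S. \<Sum>i\<in>S. \<phi> (insert j (S - {i}))) = B" unfolding B_def by (rule sum.swap)
  finally show ?thesis unfolding 1 by (simp add: algebra_simps)
qed

definition ip :: "(complex set \<Rightarrow> complex) \<Rightarrow> (complex set \<Rightarrow> complex) \<Rightarrow> complex" where
  "ip \<phi> \<psi> = (\<Sum>S\<in>Pow Z. \<phi> S * cnj (\<psi> S))"

definition norm_sq :: "(complex set \<Rightarrow> complex) \<Rightarrow> real" where
  "norm_sq \<phi> = (\<Sum>S\<in>Pow Z. (cmod (\<phi> S))\<^sup>2)"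

lemma ip_self: "ip \<phi> \<phi> = of_real (norm_sq \<phi>)"
  by (simp add: ip_def norm_sq_def complex_norm_square del: of_real_power)

lemma ip_cnj: "cnj (ip \<phi> \<psi>) = ip \<psi> \<phi>"
  by (simp add: ip_def mult.commute)

lemma norm_sq_nonneg: "norm_sq \<phi> \<ge> 0"
  by (simp add: norm_sq_def sum_nonneg)

lemma norm_sq_eq_0: "norm_sq \<phi> = 0 \<Longrightarrow> supported \<phi> \<Longrightarrow> \<phi> S = 0"
  by (cases "S \<subseteq> Z") (simp_all add: norm_sq_def sum_nonneg_eq_0_iff)

lemma ip_total_raise: "ip (total_raise \<phi>) \<psi> = ip \<phi> (total_lower \<psi>)"
proof -
  have "ip (total_raise \<phi>) \<psi> = (\<Sum>S\<in>Pow Z. \<Sum>j\<in>S. \<phi> (S - {j}) * cnj (\<psi> S))"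
    by (simp add: ip_def total_raise_def sum_distrib_right)
  also have "\<dots> = (\<Sum>(S, j)\<in>Sigma (Pow Z) (\<lambda>S. S). \<phi> (S - {j}) * cnj (\<psi> S))"
    by (intro sum.Sigma) (auto intro: finite_subset)
  also have "\<dots> = (\<Sum>(S, j)\<in>Sigma (Pow Z) (\<lambda>S. Z - S). \<phi> S * cnj (\<psi> (insert j S)))"
    by (rule sum.reindex_bij_witness[of _ "\<lambda>(S, j). (insert j S, j)" "\<lambda>(S, j). (S - {j}, j)"])
       (auto simp: insert_absorb)
  also have "\<dots> = (\<Sum>S\<in>Pow Z. \<Sum>j\<in>Z - S. \<phi> S * cnj (\<psi> (insert j S)))"
    by (intro sum.Sigma[symmetric]) auto
  also have "\<dots> = ip \<phi> (total_lower \<psi>)"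
    by (simp add: ip_def total_lower_subset sum_distrib_left)
  finally show ?thesis .
qed

definition homogeneous :: "nat \<Rightarrow> (complex set \<Rightarrow> complex) \<Rightarrow> bool" where
  "homogeneous a \<phi> \<longleftrightarrow> (\<forall>S. \<phi> S \<noteq> 0 \<longrightarrow> S \<subseteq> Z \<and> card S = a)"

lemma homogeneous_supported: "homogeneous a \<phi> \<Longrightarrow> supported \<phi>"
  by (auto simp: homogeneous_def)

text \<open>Adjointness turns the sl2 relation into an identity of norms. The sign of
  \<open>card Z - 2 * a\<close> then makes raising injective below the middle level and lowering
  injective above it.\<close>

lemma norm_sq_total_raise:
  assumes "homogeneous a \<phi>"
  shows "norm_sq (total_raise \<phi>) = norm_sq (total_lower \<phi>) + (real (card Z) - 2 * real a) * norm_sq \<phi>"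
proof -
  have "of_real (norm_sq (total_raise \<phi>)) = ip \<phi> (total_lower (total_raise \<phi>))"
    by (simp flip: ip_self add: ip_total_raise)
  also have "\<dots> = (\<Sum>S\<in>Pow Z. \<phi> S * cnj (total_raise (total_lower \<phi>) S) + (of_nat (card Z) - 2 * of_nat a) * (\<phi> S * cnj (\<phi> S)))"
    unfolding ip_def
  proof (intro sum.cong refl)
    fix S assume "S \<in> Pow Z"
    then show "\<phi> S * cnj (total_lower (total_raise \<phi>) S) = \<phi> S * cnj (total_raise (total_lower \<phi>) S) + (of_nat (card Z) - 2 * of_nat a) * (\<phi> S * cnj (\<phi> S))"
      using assms by (cases "\<phi> S = 0") (simp_all add: total_lower_total_raise homogeneous_def algebra_simps)
  qed
  also have "\<dots> = ip \<phi> (total_raise (total_lower \<phi>)) + (of_nat (card Z) - 2 * of_nat a) * ip \<phi> \<phi>"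
    by (simp add: ip_def sum.distrib sum_distrib_left)
  also have "ip \<phi> (total_raise (total_lower \<phi>)) = ip (total_lower \<phi>) (total_lower \<phi>)"
    by (metis ip_cnj ip_total_raise)
  finally have "complex_of_real (norm_sq (total_raise \<phi>)) =
     of_real (norm_sq (total_lower \<phi>) + (real (card Z) - 2 * real a) * norm_sq \<phi>)"
    by (simp add: ip_self)
  then show ?thesis by (simp only: of_real_eq_iff)
qed

lemma total_raise_inj:
  assumes "homogeneous a \<phi>" "2 * a < card Z" "\<And>S. total_raise \<phi> S = 0"
  shows "\<phi> S = 0"
proof -
  have "norm_sq (total_raise \<phi>) = 0" using assms by (simp add: norm_sq_def)
  with norm_sq_total_raise[OF assms(1)]
  have "norm_sq (total_lower \<phi>) + (real (card Z) - 2 * real a) * norm_sq \<phi> = 0" by simp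
  moreover have "(real (card Z) - 2 * real a) * norm_sq \<phi> \<ge> 0"
    using assms(2) norm_sq_nonneg by (intro mult_nonneg_nonneg) auto
  ultimately have "(real (card Z) - 2 * real a) * norm_sq \<phi> = 0"
    using norm_sq_nonneg[of "total_lower \<phi>"] by linarith
  then have "norm_sq \<phi> = 0" using assms(2) by auto
  then show ?thesis using assms(1) homogeneous_supported norm_sq_eq_0 by metis
qed

lemma total_lower_inj:
  assumes "homogeneous a \<phi>" "2 * a > card Z" "\<And>S. total_lower \<phi> S = 0"
  shows "\<phi> S = 0"
proof -
  have "norm_sq (total_lower \<phi>) = 0" using assms by (simp add: norm_sq_def)
  with norm_sq_total_raise[OF assms(1)]
  have "(2 * real a - real (card Z)) * norm_sq \<phi> = - norm_sq (total_raise \<phi>)" by (simp add: algebra_simps)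
  moreover have "(2 * real a - real (card Z)) * norm_sq \<phi> \<ge> 0"
    using assms(2) norm_sq_nonneg by (intro mult_nonneg_nonneg) auto
  ultimately have "(2 * real a - real (card Z)) * norm_sq \<phi> = 0"
    using norm_sq_nonneg[of "total_raise \<phi>"] by linarith
  then have "norm_sq \<phi> = 0" using assms(2) by auto
  then show ?thesis using assms(1) homogeneous_supported norm_sq_eq_0 by metis
qed

text \<open>Realness of \<open>Z\<close> enters here: each swap permutes the subsets and is its own
  inverse, hence self-adjoint, and the coefficients \<open>1 / (i - j)\<close> are real.\<close>

lemma ip_G:
  assumes "i \<in> Z" "Z \<subseteq> \<real>"
  shows "ip (G i \<phi>) \<psi> = ip \<phi> (G i \<psi>)"
proof -
  have swap: "(\<Sum>S\<in>Pow Z. \<phi> (swap_set i j S) * cnj (\<psi> S)) = (\<Sum>S\<in>Pow Z. \<phi> S * cnj (\<psi> (swap_set i j S)))"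
    if "j \<in> Z" for j
    by (rule sum.reindex_bij_witness[of _ "swap_set i j" "swap_set i j"])
       (use that assms in \<open>simp_all add: swap_set_subset_iff\<close>)
  have cnj: "cnj (i - j) = i - j" if "j \<in> Z" for j
    using assms that by (metis Reals_cnj_iff Reals_diff subsetD)
  have "ip (G i \<phi>) \<psi> = (\<Sum>j\<in>Z. ((\<Sum>S\<in>Pow Z. \<phi> S * cnj (\<psi> S)) - (\<Sum>S\<in>Pow Z. \<phi> (swap_set i j S) * cnj (\<psi> S))) / (i - j))"
    unfolding ip_def G_def sum_distrib_right
    by (subst sum.swap) (simp add: sum_subtractf[symmetric] sum_divide_distrib left_diff_distrib)
  also have "\<dots> = (\<Sum>j\<in>Z. ((\<Sum>S\<in>Pow Z. \<phi> S * cnj (\<psi> S)) - (\<Sum>S\<in>Pow Z. \<phi> S * cnj (\<psi> (swap_set i j S)))) / (i - j))"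
    by (intro sum.cong refl) (simp add: swap)
  also have "\<dots> = (\<Sum>j\<in>Z. \<Sum>S\<in>Pow Z. \<phi> S * cnj ((\<psi> S - \<psi> (swap_set i j S)) / (i - j)))"
    by (intro sum.cong refl) (simp add: cnj[simplified] sum_subtractf[symmetric] sum_divide_distrib right_diff_distrib)
  also have "\<dots> = ip \<phi> (G i \<psi>)"
    unfolding ip_def G_def cnj_sum sum_distrib_left by (rule sum.swap)
  finally show ?thesis .
qed

section \<open>Joint eigenvectors\<close>

lemma K_sum: "K i (\<lambda>S. \<Sum>j\<in>J. f j S) S = (\<Sum>j\<in>J. K i (f j) S)"
  by (induction J rule: infinite_finite_induct) (simp_all add: K_add, simp_all add: K_def lower_def G_def)

lemma G_sum: "G i (\<lambda>S. \<Sum>j\<in>J. f j S) S = (\<Sum>j\<in>J. G i (f j) S)"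
  by (induction J rule: infinite_finite_induct) (simp_all add: G_add, simp_all add: G_def)

lemma total_lower_lincomb:
  "total_lower (\<lambda>T. a * \<phi> T + b * \<psi> T) S = a * total_lower \<phi> S + b * total_lower \<psi> S"
  by (simp add: total_lower_K K_lincomb sum.distrib sum_distrib_left)

lemma total_lower_K_commute:
  assumes "i \<in> Z"
  shows "total_lower (K i \<phi>) S = K i (total_lower \<phi>) S"
proof -
  have "total_lower \<phi> = (\<lambda>S. \<Sum>j\<in>Z. K j \<phi> S)" by (simp add: fun_eq_iff total_lower_K)
  then show ?thesis using assms by (simp add: total_lower_K K_sum K_commute[of i])
qed

lemma total_lower_lower: "total_lower (lower i \<phi>) S = lower i (total_lower \<phi>) S"
  by (auto simp: total_lower_def lower_def intro!: sum.neutral sum.cong simp: insert_commute)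

section \<open>Primitive functions and lifting from G to K\<close>

definition primitive :: "(complex set \<Rightarrow> complex) \<Rightarrow> bool" where
  "primitive \<phi> \<longleftrightarrow> supported \<phi> \<and> (\<forall>S. total_lower \<phi> S = 0)"

text \<open>Being a combination of the \<open>K i\<close>, it commutes with all of them; the weights
  \<open>i\<close> are those for which \<open>weighted_sum_G\<close> makes the \<open>G\<close>-part
  a scalar on each level of the primitive functions.\<close>

definition T :: "(complex set \<Rightarrow> complex) \<Rightarrow> complex set \<Rightarrow> complex" where
  "T \<phi> S = (\<Sum>i\<in>Z. i * K i \<phi> S)"

lemma T_lincomb: "T (\<lambda>S. a * \<phi> S + b * \<psi> S) = (\<lambda>S. a * T \<phi> S + b * T \<psi> S)"
  by (simp add: fun_eq_iff T_def K_lincomb sum.distrib sum_distrib_left algebra_simps)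

lemma T_K_commute:
  assumes "i \<in> Z"
  shows "T (K i \<phi>) S = K i (T \<phi>) S"
proof -
  have "T \<phi> = (\<lambda>S. \<Sum>j\<in>Z. j * K j \<phi> S)" by (simp add: fun_eq_iff T_def)
  then show ?thesis using assms by (simp add: T_def K_sum K_scale K_commute[of i])
qed

lemma primitive_lincomb: "primitive \<phi> \<Longrightarrow> primitive \<psi> \<Longrightarrow> primitive (\<lambda>S. a * \<phi> S + b * \<psi> S)"
  by (simp add: primitive_def total_lower_lincomb)

lemma primitive_0 [simp]: "primitive (\<lambda>_. 0)"
  by (simp add: primitive_def total_lower_def lower_def)

lemma primitive_sum: "(\<And>j. j \<in> J \<Longrightarrow> primitive (f j)) \<Longrightarrow> primitive (\<lambda>S. \<Sum>j\<in>J. x j * f j S)"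
proof (induction J rule: infinite_finite_induct)
  case (insert j J)
  then show ?case using primitive_lincomb[of "f j" "\<lambda>S. \<Sum>j\<in>J. x j * f j S" "x j" 1] by simp
qed simp_all

lemma primitive_K:
  assumes "i \<in> Z" "primitive \<phi>"
  shows "primitive (K i \<phi>)"
proof -
  have "total_lower \<phi> = (\<lambda>S. 0)" using assms by (simp add: primitive_def fun_eq_iff)
  then show ?thesis using assms supported_K[OF assms(1)]
    unfolding primitive_def by (simp add: total_lower_K_commute) (simp add: K_def lower_def G_def)
qed

lemma primitive_lower:
  assumes "primitive \<phi>"
  shows "primitive (lower i \<phi>)"
proof -
  have "total_lower \<phi> = (\<lambda>S. 0)" using assms by (simp add: primitive_def fun_eq_iff)
  then show ?thesis using assms supported_lower
    unfolding primitive_def by (simp add: total_lower_lower) (simp add: lower_def)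
qed

lemma primitive_T: "primitive \<phi> \<Longrightarrow> primitive (T \<phi>)"
  unfolding T_def[abs_def] by (intro primitive_sum primitive_K)

lemma T_primitive:
  assumes "primitive \<phi>" "S \<subseteq> Z"
  shows "T \<phi> S = (\<Sum>i\<in>Z. i * lower i \<phi> S) + casimir (card S) * \<phi> S"
  using weighted_sum_G_primitive[OF assms(2), of \<phi>] assms(1)
  by (simp add: T_def K_def distrib_left sum.distrib primitive_def)

text \<open>On primitive functions \<open>T\<close> is triangular with respect to cardinality, with diagonal entry \<open>casimir a\<close> on
  the \<open>a\<close>-subsets. So the product of the \<open>T - casimir a\<close> over \<open>a < k\<close> kills everything below level \<open>k\<close> and
  maps level \<open>k\<close> into the \<open>casimir k\<close>-eigenspace of \<open>T\<close>.\<close>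

fun lift :: "nat \<Rightarrow> (complex set \<Rightarrow> complex) \<Rightarrow> complex set \<Rightarrow> complex" where
  "lift 0 \<phi> = \<phi>"
| "lift (Suc m) \<phi> = lift m (\<lambda>S. 1 * T \<phi> S + (- casimir m) * \<phi> S)"

lemma lift_lincomb: "lift m (\<lambda>S. a * \<phi> S + b * \<psi> S) = (\<lambda>S. a * lift m \<phi> S + b * lift m \<psi> S)"
proof (induction m arbitrary: \<phi> \<psi>)
  case (Suc m)
  have "(\<lambda>S. 1 * T (\<lambda>S. a * \<phi> S + b * \<psi> S) S + (- casimir m) * (a * \<phi> S + b * \<psi> S))
     = (\<lambda>S. a * (1 * T \<phi> S + (- casimir m) * \<phi> S) + b * (1 * T \<psi> S + (- casimir m) * \<psi> S))"
    by (simp add: fun_eq_iff T_lincomb algebra_simps)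
  then show ?case by (simp only: lift.simps Suc)
qed simp

lemma lift_K:
  assumes "i \<in> Z"
  shows "lift m (K i \<phi>) = K i (lift m \<phi>)"
proof (induction m arbitrary: \<phi>)
  case (Suc m)
  have "(\<lambda>S. 1 * T (K i \<phi>) S + (- casimir m) * K i \<phi> S) = K i (\<lambda>S. 1 * T \<phi> S + (- casimir m) * \<phi> S)"
    unfolding K_lincomb using assms by (simp add: T_K_commute)
  then show ?case by (simp only: lift.simps Suc)
qed simp

lemma sum_lower_eq_0:
  assumes "\<And>S. S \<subseteq> Z \<Longrightarrow> card S > m \<Longrightarrow> \<phi> S = 0" "supported \<phi>" "S \<subseteq> Z" "card S \<ge> m"
  shows "(\<Sum>i\<in>Z. i * lower i \<phi> S) = 0"
proof (intro sum.neutral ballI)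
  fix i assume "i \<in> Z"
  moreover have "finite S" using assms(3) finite_subset by blast
  ultimately show "i * lower i \<phi> S = 0" using assms by (simp add: lower_def)
qed

lemma lift_step_vanishes:
  assumes "primitive \<phi>" "\<And>S. S \<subseteq> Z \<Longrightarrow> card S > m \<Longrightarrow> \<phi> S = 0" "S \<subseteq> Z" "card S \<ge> m"
  shows "1 * T \<phi> S + (- casimir m) * \<phi> S = 0"
  using sum_lower_eq_0[of m \<phi> S] assms T_primitive[OF assms(1,3)]
  by (cases "card S = m") (simp_all add: primitive_def)

text \<open>\<open>lift m\<close> applies the factor with index \<open>m - 1\<close> first. That
  factor kills the current top level \<open>m - 1\<close>, and \<open>T\<close> reaches no larger
  sets, so the factors clear the levels one after the other.\<close>

lemma lift_eq_0:
  assumes "primitive \<phi>" "\<And>S. S \<subseteq> Z \<Longrightarrow> card S \<ge> m \<Longrightarrow> \<phi> S = 0"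
  shows "lift m \<phi> S = 0"
  using assms
proof (induction m arbitrary: \<phi>)
  case 0
  then show ?case by (auto simp: primitive_def)
next
  case (Suc m)
  have "lift m (\<lambda>S. 1 * T \<phi> S + (- casimir m) * \<phi> S) S = 0"
  proof (rule Suc.IH)
    show "primitive (\<lambda>S. 1 * T \<phi> S + (- casimir m) * \<phi> S)"
      using Suc.prems(1) by (intro primitive_lincomb primitive_T)
    fix S assume "S \<subseteq> Z" "card S \<ge> m"
    then show "1 * T \<phi> S + (- casimir m) * \<phi> S = 0"
      using Suc.prems by (intro lift_step_vanishes) auto
  qed
  then show ?case by simp
qed

text \<open>On the top level the lowering part of \<open>T\<close> contributes nothing, so
  \<open>T\<close> acts there as the scalar \<open>casimir k\<close>.\<close>

lemma lift_leading:
  assumes "primitive \<phi>" "\<And>S. S \<subseteq> Z \<Longrightarrow> card S > k \<Longrightarrow> \<phi> S = 0" "S \<subseteq> Z" "card S = k"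
  shows "lift m \<phi> S = (\<Prod>a<m. casimir k - casimir a) * \<phi> S"
  using assms(1,2)
proof (induction m arbitrary: \<phi>)
  case (Suc m)
  define \<psi> where "\<psi> = (\<lambda>S. 1 * T \<phi> S + (- casimir m) * \<phi> S)"
  have v: "\<psi> S' = (casimir (card S') - casimir m) * \<phi> S'" if "S' \<subseteq> Z" "card S' \<ge> k" for S'
    using sum_lower_eq_0[of k \<phi> S'] Suc.prems that T_primitive[OF Suc.prems(1) that(1)]
    by (simp add: primitive_def \<psi>_def algebra_simps)
  have "lift m \<psi> S = (\<Prod>a<m. casimir k - casimir a) * \<psi> S"
  proof (rule Suc.IH)
    show "primitive \<psi>" unfolding \<psi>_def
      using Suc.prems(1) by (intro primitive_lincomb primitive_T)
    show "\<psi> S' = 0" if "S' \<subseteq> Z" "card S' > k" for S'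
      using v[of S'] that Suc.prems(2)[of S'] by simp
  qed
  then show ?case using assms(3,4) v[of S] by (simp add: \<psi>_def mult.assoc)
qed simp

text \<open>The second root \<open>a = k + 1\<close> reflects the symmetry between the spins
  \<open>s\<close> and \<open>- 1 - s\<close>; it has to be excluded by a separate argument in
  \<open>spectrum_gaudin_eigen\<close>.\<close>

lemma casimir_diff:
  assumes "card Z = 2 * k"
  shows "casimir k - casimir a = (of_nat k - of_nat a) * (of_nat k + 1 - of_nat a)"
  using assms by (simp add: casimir_def algebra_simps)

lemma casimir_neq:
  assumes "card Z = 2 * k" "a < k"
  shows "casimir k - casimir a \<noteq> 0"
proof -
  have "(of_nat k + 1 - of_nat a :: complex) \<noteq> 0"
    using assms(2) by (metis (no_types, lifting) eq_iff_diff_eq_0 less_SucI of_nat_Suc of_nat_eq_iff add.commute nat_neq_iff)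
  then show ?thesis using assms by (simp add: casimir_diff)
qed

definition gaudin_eigen :: "nat \<Rightarrow> (complex \<Rightarrow> complex) \<Rightarrow> (complex set \<Rightarrow> complex) \<Rightarrow> bool" where
  "gaudin_eigen k h \<psi> \<longleftrightarrow> homogeneous k \<psi> \<and> primitive \<psi> \<and> (\<forall>i\<in>Z. \<forall>S. G i \<psi> S = h i * \<psi> S)"

lemma gaudin_eigen_above: "gaudin_eigen k h \<psi> \<Longrightarrow> card S > k \<Longrightarrow> \<psi> S = 0"
  by (auto simp: gaudin_eigen_def homogeneous_def)

text \<open>On \<open>\<psi>\<close> the operators \<open>K i\<close> and \<open>G i\<close> differ
  by \<open>lower i \<psi>\<close>, a primitive function on sets with fewer than \<open>k\<close>
  elements. \<open>lift k\<close> commutes with \<open>K i\<close> and kills such functions.\<close>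

lemma lift_eigen:
  assumes "gaudin_eigen k h \<psi>" "i \<in> Z"
  shows "K i (lift k \<psi>) S = h i * lift k \<psi> S"
proof -
  have "K i \<psi> = (\<lambda>S. h i * \<psi> S + 1 * lower i \<psi> S)"
    using assms by (simp add: fun_eq_iff K_def gaudin_eigen_def)
  then have "K i (lift k \<psi>) S = h i * lift k \<psi> S + lift k (lower i \<psi>) S"
    unfolding lift_K[OF assms(2), symmetric] by (simp only: lift_lincomb) simp
  also have "lift k (lower i \<psi>) S = 0"
  proof (rule lift_eq_0)
    show "primitive (lower i \<psi>)" using assms by (intro primitive_lower) (simp add: gaudin_eigen_def)
    fix S assume S: "S \<subseteq> Z" "card S \<ge> k"
    then have "finite S" using finite_subset by blast
    then show "lower i \<psi> S = 0"
      using assms S gaudin_eigen_above[OF assms(1), of "insert i S"] by (simp add: lower_def)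
  qed
  finally show ?thesis by simp
qed

lemma primitive_lift: "primitive \<phi> \<Longrightarrow> primitive (lift m \<phi>)"
proof (induction m arbitrary: \<phi>)
  case (Suc m)
  have "primitive (\<lambda>S. 1 * T \<phi> S + (- casimir m) * \<phi> S)"
    by (intro primitive_lincomb primitive_T Suc.prems)
  then show ?case unfolding lift.simps by (rule Suc.IH)
qed simp

lemma supported_lift: "primitive \<phi> \<Longrightarrow> supported (lift m \<phi>)"
  using primitive_lift primitive_def by blast

text \<open>The lift is a joint eigenvector of the \<open>K i\<close> and vanishes with its value at
  the empty set, while on level \<open>k\<close> it is a nonzero multiple of
  \<open>\<psi>\<close>.\<close>

lemma gaudin_eigen_eq_0:
  assumes "card Z = 2 * k" "gaudin_eigen k h \<psi>" "lift k \<psi> {} = 0"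
  shows "\<psi> S = 0"
proof (cases "S \<subseteq> Z \<and> card S = k")
  case True
  have prim: "primitive \<psi>" using assms(2) by (simp add: gaudin_eigen_def)
  have "lift k \<psi> S = 0"
    using lift_eigen[OF assms(2)] assms(3) supported_lift[OF prim] by (rule K_eigenvector_eq_0)
  moreover have "lift k \<psi> S = (\<Prod>a<k. casimir k - casimir a) * \<psi> S"
    using True gaudin_eigen_above[OF assms(2)] by (intro lift_leading prim) auto
  moreover have "(\<Prod>a<k. casimir k - casimir a) \<noteq> 0"
    using casimir_neq[OF assms(1)] by simp
  ultimately show ?thesis by simp
next
  case False
  then show ?thesis using assms(2) unfolding gaudin_eigen_def homogeneous_def by blast
qed

lemma homogeneous_lincomb: "homogeneous k \<phi> \<Longrightarrow> homogeneous k \<psi> \<Longrightarrow> homogeneous k (\<lambda>S. a * \<phi> S + b * \<psi> S)"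
  unfolding homogeneous_def by (metis add.right_neutral mult_zero_right)

lemma G_lincomb: "G i (\<lambda>S. a * \<phi> S + b * \<psi> S) S = a * G i \<phi> S + b * G i \<psi> S"
  by (simp add: G_add G_scale)

text \<open>Sending \<open>\<psi>\<close> to \<open>lift k \<psi> {}\<close> is an injective linear
  form on the joint eigenspace, which is therefore at most a line; \<open>\<xi>\<close> is the
  combination on which the form vanishes.\<close>

lemma gaudin_eigen_proportional:
  assumes "card Z = 2 * k" "gaudin_eigen k h \<psi>" "gaudin_eigen k h \<psi>'" "\<psi>' S' \<noteq> 0"
  obtains c where "\<And>S. \<psi> S = c * \<psi>' S"
proof -
  define b where "b = lift k \<psi> {}"
  define b' where "b' = lift k \<psi>' {}"
  have b': "b' \<noteq> 0" using gaudin_eigen_eq_0[OF assms(1,3)] assms(4) by (auto simp: b'_def)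
  define \<xi> where "\<xi> = (\<lambda>S. b' * \<psi> S + (- b) * \<psi>' S)"
  have "gaudin_eigen k h \<xi>"
    using assms(2,3) unfolding gaudin_eigen_def \<xi>_def
    by (simp only: homogeneous_lincomb primitive_lincomb G_lincomb) (simp add: algebra_simps)
  moreover have "lift k \<xi> {} = 0" unfolding \<xi>_def lift_lincomb b_def b'_def by simp
  ultimately have "\<xi> S = 0" for S by (rule gaudin_eigen_eq_0[OF assms(1)])
  then have "\<psi> S = b / b' * \<psi>' S" for S using b' by (simp add: \<xi>_def field_simps)
  then show ?thesis using that by blast
qed

text \<open>Values outside \<open>Z\<close> are fixed to 0, so that an element is determined by its
  values on \<open>Z\<close> and elements can be counted. For \<open>card Z = 2 * k\<close> the last
  number is \<open>casimir k\<close>.\<close>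

definition spectrum :: "nat \<Rightarrow> (complex \<Rightarrow> complex) set" where
  "spectrum k = {h. (\<forall>z. z \<notin> Z \<longrightarrow> h z = 0) \<and> quadratic h \<and> (\<Sum>z\<in>Z. h z) = 0 \<and> (\<Sum>z\<in>Z. z * h z) = of_nat k * (of_nat k + 1)}"

lemma spectrum_gaudin_eigen:
  assumes Z: "card Z = 2 * k" and h: "h \<in> spectrum k"
  shows "\<exists>\<psi>. gaudin_eigen k h \<psi> \<and> (\<exists>S. \<psi> S \<noteq> 0)"
proof -
  have quad: "quadratic h" and s0: "(\<Sum>z\<in>Z. h z) = 0" and s1: "(\<Sum>z\<in>Z. z * h z) = casimir k"
    using h Z by (simp_all add: spectrum_def casimir_def)
  obtain \<phi> where \<phi>: "supported \<phi>" "\<phi> {} = 1" "\<And>i S. i \<in> Z \<Longrightarrow> K i \<phi> S = h i * \<phi> S"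
    using quadratic_eigenvector[OF quad] by blast
  have tl: "total_lower \<phi> S = 0" for S
    using \<phi>(3) s0 by (simp add: total_lower_K sum_distrib_right[symmetric])
  \<comment> \<open>These are the cardinalities on which \<open>\<phi>\<close> does not vanish. On
    the largest one, \<open>a\<close>, the lowering part of \<open>K i\<close> contributes nothing,
    so the top part \<open>\<psi>\<close> is an eigenvector of the \<open>G i\<close>.\<close>
  define A where "A = {a. \<exists>S. card S = a \<and> \<phi> S \<noteq> 0}"
  have A: "A \<subseteq> {..card Z}" using \<phi>(1) by (auto simp: A_def intro!: card_mono)
  have finA: "finite A" using A finite_subset by blast
  moreover have "A \<noteq> {}" using \<phi>(2) unfolding A_def by (metis (mono_tags, lifting) empty_iff mem_Collect_eq zero_neq_one)
  ultimately have MaxA: "Max A \<in> A" by (rule Max_in)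
  define a where "a = Max A"
  have above: "\<phi> S = 0" if "card S > a" for S
    using that Max_ge[OF finA, of "card S"] by (auto simp: a_def A_def)
  define \<psi> where "\<psi> = (\<lambda>S. if card S = a then \<phi> S else 0)"
  have "a \<in> A" using MaxA by (simp add: a_def)
  then obtain S0 where "card S0 = a" "\<phi> S0 \<noteq> 0" by (auto simp: A_def)
  then have S0: "\<psi> S0 \<noteq> 0" by (simp add: \<psi>_def)
  have hom: "homogeneous a \<psi>" using \<phi>(1) by (auto simp: homogeneous_def \<psi>_def)
  have prim: "total_lower \<psi> S = 0" for S
  proof (cases "S \<subseteq> Z")
    case True
    then have "finite S" using finite_subset by blast
    then have "total_lower \<psi> S = (if Suc (card S) = a then total_lower \<phi> S else 0)"
      using True by (auto simp: total_lower_subset \<psi>_def intro!: sum.neutral)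
    then show ?thesis using tl by simp
  next
    case False
    then have "\<phi> (insert i S) = 0" for i using \<phi>(1) by simp
    then show ?thesis by (auto simp: total_lower_def lower_def \<psi>_def intro!: sum.neutral)
  qed
  have G: "G i \<psi> S = h i * \<psi> S" if i: "i \<in> Z" for i S
  proof (cases "card S = a \<and> S \<subseteq> Z")
    case True
    then have fS: "finite S" using finite_subset by blast
    have "G i \<psi> S = G i \<phi> S" using True by (simp add: G_def \<psi>_def)
    also have "\<dots> = K i \<phi> S" using True fS above[of "insert i S"] by (simp add: K_def lower_def)
    finally show ?thesis using \<phi>(3)[OF i] True by (simp add: \<psi>_def)
  next
    case False
    then have "\<psi> S = 0" "\<psi> (swap_set i j S) = 0" if "j \<in> Z" for j
      using \<phi>(1) i that by (auto simp: \<psi>_def swap_set_subset_iff)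
    then show ?thesis using i by (simp add: G_def)
  qed
  have "S0 \<subseteq> Z" "card S0 = a" using hom S0 by (auto simp: homogeneous_def)
  \<comment> \<open>Computing the weighted sum in two ways gives
    \<open>casimir a = casimir k\<close>, so \<open>a\<close> is \<open>k\<close> or
    \<open>k + 1\<close>. Level \<open>k + 1\<close> lies above the middle, where lowering is
    injective and a primitive function must vanish.\<close>
  have "casimir a * \<psi> S0 = (\<Sum>i\<in>Z. i * G i \<psi> S0)"
    using weighted_sum_G_primitive[OF \<open>S0 \<subseteq> Z\<close> prim] \<open>card S0 = a\<close> by simp
  also have "\<dots> = casimir k * \<psi> S0"
    unfolding s1[symmetric] by (simp add: G sum_distrib_right mult.assoc)
  finally have "casimir k - casimir a = 0" using S0 by simp
  then have "(of_nat k :: complex) = of_nat a \<or> (of_nat (k + 1) :: complex) = of_nat a"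
    unfolding casimir_diff[OF Z] by (simp add: add.commute)
  then have "a = k \<or> a = k + 1" by (metis of_nat_eq_iff)
  moreover have "a \<noteq> k + 1"
  proof
    assume "a = k + 1"
    then have "\<psi> S0 = 0" using Z by (intro total_lower_inj[OF hom _ prim]) simp
    then show False using S0 by simp
  qed
  ultimately have "a = k" by simp
  then have "gaudin_eigen k h \<psi>"
    using hom prim G homogeneous_supported[OF hom] by (simp add: gaudin_eigen_def primitive_def)
  then show ?thesis using S0 by blast
qed

lemma gaudin_eigen_spectrum:
  assumes Z: "card Z = 2 * k" and "gaudin_eigen k g \<psi>" "\<psi> S0 \<noteq> 0"
  shows "(\<lambda>z. if z \<in> Z then g z else 0) \<in> spectrum k"
proof -
  have S0: "S0 \<subseteq> Z" "card S0 = k" and G: "\<And>i S. i \<in> Z \<Longrightarrow> G i \<psi> S = g i * \<psi> S"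
    and prim: "\<And>S. total_lower \<psi> S = 0"
    using assms by (auto simp: gaudin_eigen_def homogeneous_def primitive_def)
  have "(g i)^2 = (\<Sum>j\<in>Z. (g i - g j) / (i - j))" if i: "i \<in> Z" for i
  proof -
    have "G i \<psi> = (\<lambda>S. g i * \<psi> S)" using G i by (simp add: fun_eq_iff)
    then have "G i (G i \<psi>) S0 = (g i)^2 * \<psi> S0"
      using i by (simp add: G_scale G power2_eq_square)
    moreover have "G i (G i \<psi>) S0 = (\<Sum>j\<in>Z. (g i - g j) / (i - j)) * \<psi> S0"
      using i by (simp add: G_square G sum_distrib_right left_diff_distrib)
    ultimately show ?thesis using assms(3) by simp
  qed
  moreover have "(\<Sum>i\<in>Z. g i) * \<psi> S0 = 0"
    using sum_G[of \<psi> S0] by (simp add: G sum_distrib_right)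
  moreover have "(\<Sum>i\<in>Z. i * g i) * \<psi> S0 = casimir k * \<psi> S0"
    using weighted_sum_G_primitive[OF S0(1) prim] by (simp add: G S0(2) sum_distrib_right mult.assoc)
  ultimately show ?thesis using assms(3) Z by (simp add: spectrum_def quadratic_def casimir_def)
qed

section \<open>Eigenvectors in invariant subspaces\<close>

lemma G_eigenvector:
  assumes i: "i \<in> Z" and \<psi>: "\<psi> \<in> Y" "\<psi> S0 \<noteq> 0"
    and supp: "\<And>\<phi>. \<phi> \<in> Y \<Longrightarrow> supported \<phi>"
    and G: "\<And>\<phi>. \<phi> \<in> Y \<Longrightarrow> G i \<phi> \<in> Y"
    and closed: "\<And>x f (M::nat). (\<And>j. f j \<in> Y) \<Longrightarrow> (\<lambda>S. \<Sum>j\<le>M. x j * f j S) \<in> Y"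
  shows "\<exists>\<phi>\<in>Y. \<exists>r. (\<exists>S. \<phi> S \<noteq> 0) \<and> (\<forall>S. G i \<phi> S = r * \<phi> S)"
proof -
  \<comment> \<open>\<open>N\<close> is the dimension of the space of supported functions, so the
    \<open>N + 1\<close> iterates \<open>v 0, ..., v N\<close> are linearly dependent.
    \<open>ev p\<close> is the polynomial \<open>p\<close> in \<open>G i\<close>, truncated at
    degree \<open>N\<close>, applied to \<open>\<psi>\<close>.\<close>
  define N where "N = card (Pow Z)"
  define v where "v j = ((G i) ^^ j) \<psi>" for j
  have v0: "v 0 = \<psi>" and vSuc: "G i (v j) = v (Suc j)" for j by (simp_all add: v_def)
  have vY: "v j \<in> Y" for j by (induction j) (use \<psi> G in \<open>simp_all add: v0 flip: vSuc\<close>)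
  define ev where "ev p = (\<lambda>S. \<Sum>j\<le>N. coeff p j * v j S)" for p
  have evY: "ev p \<in> Y" for p unfolding ev_def by (rule closed[OF vY])
  define P where "P p \<longleftrightarrow> p \<noteq> 0 \<and> degree p \<le> N \<and> (\<forall>S. ev p S = 0)" for p
  obtain x where x: "\<exists>j\<in>{..N}. x j \<noteq> 0" "\<forall>j. j \<notin> {..N} \<longrightarrow> x j = 0" "\<forall>S\<in>Pow Z. (\<Sum>j\<in>{..N}. v j S * x j) = 0"
    using underdetermined_system[of "Pow Z" "{..N}" "\<lambda>S j. v j S"] by (auto simp: N_def)
  define p0 where "p0 = (\<Sum>j\<le>N. monom (x j) j)"
  have c0: "coeff p0 j = x j" for j using x(2) by (auto simp: p0_def coeff_sum)
  have "ev p0 S = 0" for S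
  proof (cases "S \<subseteq> Z")
    case True
    then show ?thesis using x(3) by (simp add: ev_def c0 mult.commute)
  next
    case False
    then show ?thesis using supp[OF evY] by blast
  qed
  moreover have "p0 \<noteq> 0" using x(1) c0 by (metis coeff_0)
  moreover have "degree p0 \<le> N" using x(2) c0 by (intro degree_le) auto
  ultimately have "P p0" by (simp add: P_def)
  \<comment> \<open>Least degree among the polynomials in \<open>G i\<close> that annihilate
    \<open>\<psi>\<close>. Splitting off a root \<open>r\<close> leaves a cofactor \<open>q\<close>;
    by minimality \<open>ev q\<close> is nonzero, and it is an eigenvector for
    \<open>r\<close>.\<close>
  then obtain p where p: "P p" "\<And>q. P q \<Longrightarrow> degree p \<le> degree q"
    using ex_has_least_nat[of P p0 degree] by blast
  have "degree p \<noteq> 0"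
  proof
    assume "degree p = 0"
    then obtain a where a: "p = [:a:]" by (meson degree_eq_zeroE)
    have "ev p S = a * \<psi> S" for S
    proof -
      have "ev p S = (\<Sum>j\<in>{..N}. if j = 0 then a * \<psi> S else 0)"
        unfolding ev_def a by (intro sum.cong refl) (auto simp: v0 coeff_pCons split: nat.splits)
      then show ?thesis by simp
    qed
    then show False using p(1) \<psi>(2) a by (auto simp: P_def)
  qed
  then obtain r where r: "poly p r = 0"
    using fundamental_theorem_of_algebra[of p] by (auto simp: constant_degree)
  then obtain q where q: "p = [:- r, 1:] * q" by (metis dvdE poly_eq_0_iff_dvd)
  have q0: "q \<noteq> 0" using p(1) q by (auto simp: P_def)
  then have deg: "degree p = Suc (degree q)" unfolding q by (subst degree_mult_eq) auto
  then have "\<not> P q" using p(2)[of q] by auto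
  then obtain S1 where S1: "ev q S1 \<noteq> 0" using q0 deg p(1) by (auto simp: P_def)
  obtain M where M: "N = Suc M" using deg p(1) by (cases N) (auto simp: P_def)
  have "G i (ev q) S = r * ev q S" for S
  proof -
    have "ev p S = (\<Sum>j\<le>N. coeff (pCons 0 q) j * v j S) - r * ev q S"
      by (simp add: ev_def q sum_subtractf[symmetric] sum_distrib_left algebra_simps)
    also have "(\<Sum>j\<le>N. coeff (pCons 0 q) j * v j S) = (\<Sum>j\<le>M. coeff q j * v (Suc j) S)"
      unfolding M by (subst sum.atMost_Suc_shift) simp
    also have "\<dots> = (\<Sum>j\<le>N. coeff q j * v (Suc j) S)"
      using deg p(1) unfolding M by (simp add: P_def M coeff_eq_0)
    also have "\<dots> = G i (ev q) S"
      unfolding ev_def by (simp add: G_sum G_scale vSuc)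
    finally show ?thesis using p(1) by (simp add: P_def)
  qed
  then show ?thesis using evY S1 by blast
qed

lemma joint_G_eigenvector:
  assumes F: "finite F" "F \<subseteq> Z" and \<psi>: "\<psi> \<in> Y" "\<psi> S0 \<noteq> 0"
    and supp: "\<And>\<phi>. \<phi> \<in> Y \<Longrightarrow> supported \<phi>"
    and G: "\<And>\<phi> i. i \<in> Z \<Longrightarrow> \<phi> \<in> Y \<Longrightarrow> G i \<phi> \<in> Y"
    and closed: "\<And>x f (M::nat). (\<And>j. f j \<in> Y) \<Longrightarrow> (\<lambda>S. \<Sum>j\<le>M. x j * f j S) \<in> Y"
  shows "\<exists>\<phi>\<in>Y. (\<exists>S. \<phi> S \<noteq> 0) \<and> (\<exists>g. \<forall>i\<in>F. \<forall>S. G i \<phi> S = g i * \<phi> S)"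
  using F
proof (induction F rule: finite_induct)
  case empty
  then show ?case using \<psi> by blast
next
  case (insert i F)
  then have "\<exists>\<phi>\<in>Y. (\<exists>S. \<phi> S \<noteq> 0) \<and> (\<exists>g. \<forall>j\<in>F. \<forall>S. G j \<phi> S = g j * \<phi> S)" by simp
  then obtain \<phi> g S1 where \<phi>: "\<phi> \<in> Y" "\<phi> S1 \<noteq> 0" "\<forall>j\<in>F. \<forall>S. G j \<phi> S = g j * \<phi> S" by blast
  \<comment> \<open>The joint eigenspace for the operators treated so far is invariant under
    \<open>G i\<close>, because the operators commute.\<close>
  define Y' where "Y' = {\<phi>\<in>Y. \<forall>j\<in>F. \<forall>S. G j \<phi> S = g j * \<phi> S}"
  have "\<exists>\<phi>\<in>Y'. \<exists>r. (\<exists>S. \<phi> S \<noteq> 0) \<and> (\<forall>S. G i \<phi> S = r * \<phi> S)"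
  proof (rule G_eigenvector)
    show "i \<in> Z" "\<phi> \<in> Y'" "\<phi> S1 \<noteq> 0" using insert.prems \<phi> by (auto simp: Y'_def)
    show "supported \<phi>" if "\<phi> \<in> Y'" for \<phi> using that supp unfolding Y'_def by blast
    show "G i \<phi> \<in> Y'" if "\<phi> \<in> Y'" for \<phi>
    proof -
      have "G j (G i \<phi>) S = g j * G i \<phi> S" if "j \<in> F" for j S
      proof -
        have "G j \<phi> = (\<lambda>S. g j * \<phi> S)" using \<open>\<phi> \<in> Y'\<close> that by (simp add: Y'_def fun_eq_iff)
        then show ?thesis using that insert.prems G_commute[of j i \<phi> S] by (auto simp: G_scale)
      qed
      then show ?thesis using that insert.prems G by (simp add: Y'_def)
    qed
    show "(\<lambda>S. \<Sum>j\<le>M. x j * f j S) \<in> Y'" if "\<And>j. f j \<in> Y'" for x f and M :: nat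
      using that closed[of f x M] by (simp add: Y'_def G_sum G_scale sum_distrib_left algebra_simps)
  qed
  then obtain \<phi>' r S2 where \<phi>': "\<phi>' \<in> Y'" "\<phi>' S2 \<noteq> 0" "\<And>S. G i \<phi>' S = r * \<phi>' S" by blast
  then have "\<forall>j\<in>insert i F. \<forall>S. G j \<phi>' S = (g(i := r)) j * \<phi>' S"
    using insert.hyps by (auto simp: Y'_def)
  then show ?case using \<phi>' unfolding Y'_def by blast
qed

lemma gaudin_eigen_real:
  assumes "Z \<subseteq> \<real>" "gaudin_eigen k h \<psi>" "\<psi> S0 \<noteq> 0" "i \<in> Z"
  shows "cnj (h i) = h i"
proof -
  have "G i \<psi> = (\<lambda>S. h i * \<psi> S)" using assms by (simp add: gaudin_eigen_def fun_eq_iff)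
  then have "h i * ip \<psi> \<psi> = cnj (h i) * ip \<psi> \<psi>"
    using ip_G[OF assms(4,1), of \<psi> \<psi>] by (simp add: ip_def sum_distrib_left algebra_simps)
  moreover have "norm_sq \<psi> \<noteq> 0"
    using norm_sq_eq_0[of \<psi> S0] assms homogeneous_supported[of k \<psi>] by (auto simp: gaudin_eigen_def)
  ultimately show ?thesis by (simp add: ip_self)
qed

lemma gaudin_eigen_orthogonal:
  assumes "Z \<subseteq> \<real>" "gaudin_eigen k h \<psi>" "gaudin_eigen k h' \<psi>'" "\<psi>' S0 \<noteq> 0" "i \<in> Z" "h i \<noteq> h' i"
  shows "ip \<psi> \<psi>' = 0"
proof -
  have "G i \<psi> = (\<lambda>S. h i * \<psi> S)" "G i \<psi>' = (\<lambda>S. h' i * \<psi>' S)"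
    using assms by (simp_all add: gaudin_eigen_def fun_eq_iff)
  then have "h i * ip \<psi> \<psi>' = cnj (h' i) * ip \<psi> \<psi>'"
    using ip_G[OF assms(5,1), of \<psi> \<psi>'] by (simp add: ip_def sum_distrib_left algebra_simps)
  then show ?thesis using assms(6) gaudin_eigen_real[OF assms(1,3,4,5)] by simp
qed

section \<open>Counting the spectrum\<close>

abbreviation level :: "nat \<Rightarrow> complex set set" where
  "level a \<equiv> {S. S \<subseteq> Z \<and> card S = a}"

lemma finite_level [simp]: "finite (level a)"
  by (rule finite_subset[of _ "Pow Z"]) auto

lemma homogeneous_G: "i \<in> Z \<Longrightarrow> homogeneous a \<phi> \<Longrightarrow> homogeneous a (G i \<phi>)"
  unfolding homogeneous_def G_def
  by (metis (no_types, lifting) card_swap_set diff_self div_0 sum.neutral swap_set_subset_iff)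

lemma homogeneous_sum: "(\<And>j. j \<in> J \<Longrightarrow> homogeneous a (f j)) \<Longrightarrow> homogeneous a (\<lambda>S. \<Sum>j\<in>J. x j * f j S)"
  unfolding homogeneous_def by (metis (no_types, lifting) mult_zero_right sum.neutral)

lemma primitive_G: "i \<in> Z \<Longrightarrow> primitive \<phi> \<Longrightarrow> primitive (G i \<phi>)"
  using primitive_lincomb[OF primitive_K primitive_lower, of i \<phi> \<phi> 1 "-1" i] by (simp add: K_def)

lemma ip_sum: "ip (\<lambda>S. \<Sum>j\<in>J. x j * f j S) \<psi> = (\<Sum>j\<in>J. x j * ip (f j) \<psi>)"
  unfolding ip_def sum_distrib_right sum_distrib_left
  by (subst sum.swap) (simp add: mult.assoc)

lemma norm_sq_pos: "homogeneous a \<phi> \<Longrightarrow> \<phi> S \<noteq> 0 \<Longrightarrow> norm_sq \<phi> \<noteq> 0"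
  using norm_sq_eq_0[OF _ homogeneous_supported] by blast

lemma homogeneous_total_raise:
  assumes "homogeneous (k - 1) \<theta>" "k \<ge> 1"
  shows "homogeneous k (total_raise \<theta>)"
  unfolding homogeneous_def
proof (intro allI impI)
  fix S assume S: "total_raise \<theta> S \<noteq> 0"
  then have SZ: "S \<subseteq> Z" by (metis total_raise_def)
  then have "finite S" using finite_subset by blast
  from S SZ obtain j where j: "j \<in> S" "\<theta> (S - {j}) \<noteq> 0"
    unfolding total_raise_def by (auto elim: sum.not_neutral_contains_not_neutral)
  then have "card (S - {j}) = k - 1" using assms by (auto simp: homogeneous_def)
  moreover have "card S \<noteq> 0" using \<open>finite S\<close> j by auto
  ultimately show "S \<subseteq> Z \<and> card S = k" using SZ j assms(2) by simp
qed

text \<open>Eigenvectors for different \<open>h\<close> are orthogonal and primitive; primitive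
  functions are orthogonal to the image of raising, which is injective on level
  \<open>k - 1\<close>. So eigenvectors and raised indicator functions are independent on level
  \<open>k\<close>. A finite \<open>F\<close> is taken because finiteness of the spectrum is a
  consequence.\<close>

lemma card_spectrum_upper:
  assumes Z: "Z \<subseteq> \<real>" "card Z = 2 * k" "k \<ge> 1" and F: "finite F" "F \<subseteq> spectrum k"
  shows "card F + card (level (k - 1)) \<le> card (level k)"
proof (rule ccontr)
  assume "\<not> ?thesis"
  then have less: "card (level k) < card (F <+> level (k - 1))" using F by (simp add: card_Plus)
  obtain \<Psi> where \<Psi>: "\<And>h. h \<in> F \<Longrightarrow> gaudin_eigen k h (\<Psi> h)" "\<And>h. h \<in> F \<Longrightarrow> \<exists>S. \<Psi> h S \<noteq> 0"
    using spectrum_gaudin_eigen[OF Z(2)] F(2) by (metis subsetD)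
  \<comment> \<open>The columns are the eigenvectors and, for \<open>Inr U\<close>, the indicator
    function of \<open>U\<close> under \<open>total_raise\<close>.\<close>
  define a where "a S j = (case j of Inl h \<Rightarrow> \<Psi> h S | Inr U \<Rightarrow> (\<Sum>i\<in>S. if U = S - {i} then 1 else 0))" for S j
  obtain x where x: "\<exists>j\<in>F <+> level (k - 1). x j \<noteq> 0" "\<forall>j. j \<notin> F <+> level (k - 1) \<longrightarrow> x j = 0"
    "\<forall>S\<in>level k. (\<Sum>j\<in>F <+> level (k - 1). a S j * x j) = 0"
    using underdetermined_system[OF finite_level _ less, of a] F(1) by auto
  define \<theta> where "\<theta> U = x (Inr U)" for U
  define \<eta> where "\<eta> = (\<lambda>S. \<Sum>h\<in>F. x (Inl h) * \<Psi> h S)"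
  have hom\<theta>: "homogeneous (k - 1) \<theta>" using x(2) unfolding homogeneous_def \<theta>_def by fastforce
  have hom\<eta>: "homogeneous k \<eta>" and prim\<eta>: "primitive \<eta>"
    unfolding \<eta>_def using \<Psi>(1) by (auto intro!: homogeneous_sum primitive_sum simp: gaudin_eigen_def)
  have raise: "total_raise \<theta> S = - \<eta> S" for S
  proof (cases "S \<in> level k")
    case True
    then have fS: "finite S" using finite_subset[OF _ finite_Z] by auto
    have "(\<Sum>U\<in>level (k - 1). a S (Inr U) * x (Inr U)) = (\<Sum>U\<in>level (k - 1). \<Sum>i\<in>S. if U = S - {i} then \<theta> U else 0)"
      by (intro sum.cong refl) (auto simp: a_def \<theta>_def sum_distrib_right intro!: sum.cong)
    also have "\<dots> = (\<Sum>i\<in>S. \<Sum>U\<in>level (k - 1). if U = S - {i} then \<theta> U else 0)"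
      by (rule sum.swap)
    also have "\<dots> = total_raise \<theta> S"
      using True fS by (auto simp: total_raise_def sum.delta intro!: sum.cong)
    finally have "\<eta> S + total_raise \<theta> S = (\<Sum>j\<in>F <+> level (k - 1). a S j * x j)"
      using F(1) by (simp add: sum.Plus \<eta>_def a_def mult.commute)
    with x(3) True have "\<eta> S + total_raise \<theta> S = 0" by simp
    then show ?thesis by (simp add: eq_neg_iff_add_eq_0 add.commute)
  next
    case False
    then have "\<eta> S = 0" "total_raise \<theta> S = 0"
      using hom\<eta> homogeneous_total_raise[OF hom\<theta> Z(3)] by (auto simp: homogeneous_def)
    then show ?thesis by simp
  qed
  \<comment> \<open>\<open>total_raise \<theta>\<close> equals \<open>- \<eta>\<close> and is
    primitive; by adjointness it is then orthogonal to itself.\<close>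
  have "total_lower (total_raise \<theta>) S = 0" for S
  proof -
    have "total_raise \<theta> = (\<lambda>S. (- 1) * \<eta> S + 0 * \<eta> S)" using raise by (simp add: fun_eq_iff)
    then show ?thesis using prim\<eta> by (simp only: total_lower_lincomb primitive_def) simp
  qed
  then have "ip (total_raise \<theta>) (total_raise \<theta>) = 0" by (simp add: ip_total_raise) (simp add: ip_def)
  then have nr: "norm_sq (total_raise \<theta>) = 0" by (simp add: ip_self)
  have r0: "total_raise \<theta> S = 0" for S
    using norm_sq_eq_0[OF nr] by (simp add: total_raise_def)
  have \<theta>0: "\<theta> U = 0" for U
    using Z(2,3) by (intro total_raise_inj[OF hom\<theta> _ r0]) simp
  have "x (Inl h) = 0" if h: "h \<in> F" for h
  proof -
    obtain S0 where S0: "\<Psi> h S0 \<noteq> 0" using \<Psi>(2) h by blast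
    have "\<eta> S = 0" for S using raise[of S] r0[of S] by simp
    then have "0 = ip \<eta> (\<Psi> h)" by (simp add: ip_def)
    also have "\<dots> = (\<Sum>h'\<in>F. x (Inl h') * ip (\<Psi> h') (\<Psi> h))" unfolding \<eta>_def by (rule ip_sum)
    also have "\<dots> = (\<Sum>h'\<in>{h}. x (Inl h') * ip (\<Psi> h') (\<Psi> h))"
    proof (rule sum.mono_neutral_right)
      show "\<forall>h'\<in>F - {h}. x (Inl h') * ip (\<Psi> h') (\<Psi> h) = 0"
      proof
        fix h' assume h': "h' \<in> F - {h}"
        then have "h' \<in> spectrum k" "h \<in> spectrum k" "h' \<noteq> h" using F h by auto
        then obtain i where "i \<in> Z" "h' i \<noteq> h i" unfolding spectrum_def fun_eq_iff by force
        then have "ip (\<Psi> h') (\<Psi> h) = 0"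
          using gaudin_eigen_orthogonal[OF Z(1) \<Psi>(1)[of h'] \<Psi>(1)[OF h] S0] h' by simp
        then show "x (Inl h') * ip (\<Psi> h') (\<Psi> h) = 0" by simp
      qed
    qed (use F h in auto)
    finally have "x (Inl h) * norm_sq (\<Psi> h) = 0" by (simp add: ip_self)
    moreover have "norm_sq (\<Psi> h) \<noteq> 0"
      using norm_sq_pos[of k "\<Psi> h" S0] S0 \<Psi>(1)[OF h] unfolding gaudin_eigen_def by blast
    ultimately show ?thesis by simp
  qed
  then show False using x(1) \<theta>0 by (auto simp: \<theta>_def)
qed

text \<open>Too small a count would leave a nonzero primitive function on level \<open>k\<close>
  orthogonal to all chosen eigenvectors. Such functions form a space invariant under the
  self-adjoint \<open>G i\<close>, so it contains a joint eigenvector. This is a multiple of a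
  chosen one, since joint eigenspaces are lines, and also orthogonal to it.\<close>

lemma card_spectrum_lower:
  assumes Z: "Z \<subseteq> \<real>" "card Z = 2 * k" "k \<ge> 1" and F: "finite (spectrum k)"
  shows "card (spectrum k) + card (level (k - 1)) \<ge> card (level k)"
proof (rule ccontr)
  assume "\<not> ?thesis"
  then have less: "card (spectrum k <+> level (k - 1)) < card (level k)" using F by (simp add: card_Plus)
  obtain \<Psi> where \<Psi>: "\<And>h. h \<in> spectrum k \<Longrightarrow> gaudin_eigen k h (\<Psi> h)" "\<And>h. h \<in> spectrum k \<Longrightarrow> \<exists>S. \<Psi> h S \<noteq> 0"
    using spectrum_gaudin_eigen[OF Z(2)] by metis
  \<comment> \<open>The rows express orthogonality to \<open>\<Psi> h\<close> and, for
    \<open>Inr U\<close>, the vanishing of \<open>total_lower\<close> at \<open>U\<close>.\<close>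
  define a where "a j S = (case j of Inl h \<Rightarrow> cnj (\<Psi> h S) | Inr U \<Rightarrow> (\<Sum>i\<in>Z - U. if S = insert i U then 1 else 0))" for j S
  have "finite (spectrum k <+> level (k - 1))" using F by simp
  then obtain x where x: "\<exists>S\<in>level k. x S \<noteq> 0" "\<forall>S. S \<notin> level k \<longrightarrow> x S = 0"
    "\<forall>j\<in>spectrum k <+> level (k - 1). (\<Sum>S\<in>level k. a j S * x S) = 0"
    using underdetermined_system[OF _ finite_level less, of a] by blast
  define Y where "Y = {\<phi>. homogeneous k \<phi> \<and> primitive \<phi> \<and> (\<forall>h\<in>spectrum k. ip \<phi> (\<Psi> h) = 0)}"
  have hom: "homogeneous k x" using x(2) by (auto simp: homogeneous_def)
  have "ip x (\<Psi> h) = 0" if h: "h \<in> spectrum k" for h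
  proof -
    have "ip x (\<Psi> h) = (\<Sum>S\<in>level k. a (Inl h) S * x S)"
      unfolding ip_def a_def using x(2) by (intro sum.mono_neutral_cong_right) auto
    then show ?thesis using x(3) h by (simp add: InlI)
  qed
  moreover have "total_lower x U = 0" for U
  proof (cases "U \<in> level (k - 1)")
    case True
    then have "0 = (\<Sum>S\<in>level k. a (Inr U) S * x S)" using x(3) by (simp add: InrI)
    also have "\<dots> = (\<Sum>S\<in>level k. \<Sum>i\<in>Z - U. if S = insert i U then x S else 0)"
      by (intro sum.cong refl) (auto simp: a_def sum_distrib_right intro!: sum.cong)
    also have "\<dots> = (\<Sum>i\<in>Z - U. \<Sum>S\<in>level k. if S = insert i U then x S else 0)" by (rule sum.swap)
    also have "\<dots> = (\<Sum>i\<in>Z - U. x (insert i U))"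
      using x(2) by (intro sum.cong refl) (simp add: sum.delta)
    finally show ?thesis using True by (simp add: total_lower_subset)
  next
    case False
    have "x (insert i U) = 0" if "i \<notin> U" for i
    proof (rule ccontr)
      assume "x (insert i U) \<noteq> 0"
      then have "insert i U \<in> level k" using x(2) by metis
      then have "insert i U \<subseteq> Z" "card (insert i U) = k" by auto
      moreover from this have "finite U" using finite_subset[OF _ finite_Z] by auto
      ultimately show False using False that by auto
    qed
    then show ?thesis by (auto simp: total_lower_def lower_def intro!: sum.neutral)
  qed
  ultimately have xY: "x \<in> Y" using hom homogeneous_supported[OF hom] by (simp add: Y_def primitive_def)
  obtain S0 where S0: "x S0 \<noteq> 0" using x(1) by blast
  have "\<exists>\<phi>\<in>Y. (\<exists>S. \<phi> S \<noteq> 0) \<and> (\<exists>g. \<forall>i\<in>Z. \<forall>S. G i \<phi> S = g i * \<phi> S)"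
  proof (rule joint_G_eigenvector[OF finite_Z order_refl xY S0])
    show "supported \<phi>" if "\<phi> \<in> Y" for \<phi> using that unfolding Y_def primitive_def by blast
    show "G i \<phi> \<in> Y" if i: "i \<in> Z" and \<phi>: "\<phi> \<in> Y" for \<phi> i
    proof -
      have "ip (G i \<phi>) (\<Psi> h) = 0" if h: "h \<in> spectrum k" for h
      proof -
        have "ip (G i \<phi>) (\<Psi> h) = cnj (h i) * ip \<phi> (\<Psi> h)"
          using \<Psi>(1)[OF h] i unfolding ip_G[OF i Z(1)]
          by (simp add: gaudin_eigen_def ip_def sum_distrib_left algebra_simps)
        then show ?thesis using \<phi> h by (simp add: Y_def)
      qed
      then show ?thesis using \<phi> i by (simp add: Y_def homogeneous_G primitive_G)
    qed
    show "(\<lambda>S. \<Sum>j\<le>M. x j * f j S) \<in> Y" if "\<And>j. f j \<in> Y" for x f and M :: nat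
      using that by (simp add: Y_def homogeneous_sum primitive_sum ip_sum)
  qed
  then obtain \<phi> g S1 where \<phi>: "\<phi> \<in> Y" "\<phi> S1 \<noteq> 0" "\<forall>i\<in>Z. \<forall>S. G i \<phi> S = g i * \<phi> S" by blast
  define h where "h = (\<lambda>z. if z \<in> Z then g z else 0)"
  have "gaudin_eigen k g \<phi>" using \<phi> by (simp add: gaudin_eigen_def Y_def)
  then have h: "h \<in> spectrum k" unfolding h_def using \<phi>(2) by (rule gaudin_eigen_spectrum[OF Z(2)])
  have "gaudin_eigen k h \<phi>" using \<phi> by (simp add: gaudin_eigen_def Y_def h_def)
  moreover obtain S2 where S2: "\<Psi> h S2 \<noteq> 0" using \<Psi>(2) h by blast
  ultimately obtain c where c: "\<And>S. \<phi> S = c * \<Psi> h S"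
    using gaudin_eigen_proportional[OF Z(2) _ \<Psi>(1)[OF h]] by metis
  have "c * norm_sq (\<Psi> h) = ip \<phi> (\<Psi> h)"
    unfolding ip_self[symmetric] by (simp add: ip_def c sum_distrib_left mult.assoc)
  also have "\<dots> = 0" using \<phi>(1) h by (simp add: Y_def)
  moreover have "norm_sq (\<Psi> h) \<noteq> 0"
    using norm_sq_pos[of k "\<Psi> h" S2] S2 \<Psi>(1)[OF h] unfolding gaudin_eigen_def by blast
  ultimately have "c = 0" by simp
  then show False using c \<phi>(2) by simp
qed

lemma card_spectrum:
  assumes Z: "Z \<subseteq> \<real>" "card Z = 2 * k" "k \<ge> 1"
  shows "card (spectrum k) + ((2 * k) choose (k - 1)) = (2 * k) choose k"
proof -
  have level: "card (level a) = (2 * k) choose a" for a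
    using n_subsets[OF finite_Z, of a] Z(2) by simp
  \<comment> \<open>A uniform bound on all finite subsets yields finiteness of the spectrum
    itself.\<close>
  have "finite (spectrum k) \<and> card (spectrum k) \<le> card (level k)"
    using card_spectrum_upper[OF Z] by (intro finite_if_finite_subsets_card_bdd) fastforce
  then show ?thesis
    using card_spectrum_upper[OF Z _ order_refl] card_spectrum_lower[OF Z] by (simp add: level)
qed

end

section \<open>Second-order equations with polynomial solutions\<close>

definition wronskian :: "complex poly \<Rightarrow> complex poly \<Rightarrow> complex poly" where
  "wronskian p q = pderiv p * q - p * pderiv q"

lemma coeff_mult_top:
  assumes "degree p \<le> a" "degree q \<le> b"
  shows "coeff (p * q) (a + b) = coeff p a * coeff q b"
proof -
  have "coeff (p * q) (a + b) = (\<Sum>i\<le>a + b. if i = a then coeff p a * coeff q b else 0)"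
    unfolding coeff_mult
  proof (intro sum.cong refl)
    fix i assume "i \<in> {..a + b}"
    show "coeff p i * coeff q (a + b - i) = (if i = a then coeff p a * coeff q b else 0)"
      using assms by (cases i a rule: linorder_cases) (auto simp: coeff_eq_0)
  qed
  then show ?thesis by simp
qed

text \<open>Multiplied by \<open>x\<close>, the derivative acts diagonally on coefficients, which
  avoids truncated subtraction in the degrees of derivatives. The Wronskian is treated likewise
  below, and the second-order equation with two factors \<open>x\<close>.\<close>

lemma coeff_euler: "coeff (pCons 0 (pderiv p)) m = of_nat m * coeff p m"
  by (cases m) (simp_all add: coeff_pderiv)

lemma coeff_euler2: "coeff (pCons 0 (pCons 0 (pderiv (pderiv p)))) m = of_nat m * (of_nat m - 1) * coeff p m"
  for p :: "complex poly"
  by (cases m) (simp_all add: coeff_pCons coeff_pderiv split: nat.split)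

lemma degree_euler: "degree (pCons 0 (pderiv p)) \<le> degree p"
  by (rule degree_le) (simp add: coeff_euler coeff_eq_0 del: coeff_pCons_Suc)

lemma degree_euler2: "degree (pCons 0 (pCons 0 (pderiv (pderiv p)))) \<le> degree p" for p :: "complex poly"
  by (rule degree_le) (simp only: coeff_euler2, simp add: coeff_eq_0)

lemma pderiv_sum: "pderiv (sum f A) = (\<Sum>a\<in>A. pderiv (f a))"
  by (induction A rule: infinite_finite_induct) (simp_all add: pderiv_add)

lemma pCons_0_sum: "pCons 0 (sum f A) = (\<Sum>a\<in>A. pCons 0 (f a))"
proof (induction A rule: infinite_finite_induct)
  case (insert x F)
  then show ?case by (simp add: insert.IH[symmetric])
qed simp_all

lemma pCons_0_smult: "pCons 0 (smult a p) = smult a (pCons 0 p)" by simp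

text \<open>The factor \<open>a - b\<close> is nonzero for a basis of solutions of degrees
  \<open>k + 1\<close> and \<open>k\<close>, and zero when both polynomials are given the same
  formal degree.\<close>

lemma degree_shift_wronskian:
  assumes "degree p \<le> a" "degree q \<le> b"
  shows "degree (pCons 0 (wronskian p q)) \<le> a + b"
    "coeff (pCons 0 (wronskian p q)) (a + b) = (of_nat a - of_nat b) * coeff p a * coeff q b"
proof -
  have eq: "pCons 0 (wronskian p q) = pCons 0 (pderiv p) * q - p * pCons 0 (pderiv q)"
    by (simp add: wronskian_def)
  have deg: "degree (pCons 0 (pderiv p)) \<le> a" "degree (pCons 0 (pderiv q)) \<le> b"
    using assms degree_euler[of p] degree_euler[of q] by linarith+
  show "degree (pCons 0 (wronskian p q)) \<le> a + b"
    unfolding eq using assms deg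
    by (intro degree_diff_le order_trans[OF degree_mult_le] add_mono)
  show "coeff (pCons 0 (wronskian p q)) (a + b) = (of_nat a - of_nat b) * coeff p a * coeff q b"
    unfolding eq coeff_diff coeff_mult_top[OF deg(1) assms(2)] coeff_mult_top[OF assms(1) deg(2)]
      coeff_euler by (simp add: algebra_simps)
qed

lemma vanishing_prod_dvd:
  fixes p :: "complex poly"
  assumes "finite A" "\<And>z. z \<in> A \<Longrightarrow> poly p z = 0"
  shows "(\<Prod>z\<in>A. [:- z, 1:]) dvd p"
  using assms
proof (induction A arbitrary: p rule: finite_induct)
  case (insert a A)
  then obtain q where q: "p = [:- a, 1:] * q" by (metis dvdE insertI1 poly_eq_0_iff_dvd)
  have "poly q z = 0" if "z \<in> A" for z
    using insert.prems[of z] insert.hyps that by (auto simp: q)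
  then have "(\<Prod>z\<in>A. [:- z, 1:]) dvd q" by (rule insert.IH)
  then show ?case unfolding q using insert.hyps by (simp add: mult_dvd_mono del: mult_pCons_left)
qed simp

section \<open>The differential equation attached to h\<close>

context gaudin begin

definition W :: "complex poly" where "W = (\<Prod>z\<in>Z. [:- z, 1:])"
definition Wdel :: "complex \<Rightarrow> complex poly" where "Wdel j = (\<Prod>z\<in>Z - {j}. [:- z, 1:])"
definition U :: "(complex \<Rightarrow> complex) \<Rightarrow> complex poly" where "U h = (\<Sum>j\<in>Z. smult (h j) (Wdel j))"

lemma W_Wdel: "j \<in> Z \<Longrightarrow> W = [:- j, 1:] * Wdel j"
  by (simp add: W_def Wdel_def prod.remove)

lemma degree_W: "degree W = card Z"
  unfolding W_def by (subst degree_prod_sum_eq) auto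

lemma monic_W: "coeff W (card Z) = 1"
proof -
  have "lead_coeff W = 1" unfolding W_def lead_coeff_prod by simp
  then show ?thesis by (simp add: degree_W)
qed

lemma W_nz: "W \<noteq> 0" by (simp add: W_def)

lemma degree_Wdel: "j \<in> Z \<Longrightarrow> degree (Wdel j) = card Z - 1"
  unfolding Wdel_def by (subst degree_prod_sum_eq) auto

lemma monic_Wdel: "j \<in> Z \<Longrightarrow> coeff (Wdel j) (card Z - 1) = 1"
proof -
  assume "j \<in> Z"
  have "lead_coeff (Wdel j) = 1" unfolding Wdel_def lead_coeff_prod by simp
  then show ?thesis by (simp add: degree_Wdel \<open>j \<in> Z\<close>)
qed

lemma poly_Wdel_neq_0: "poly (Wdel z) z \<noteq> 0"
  by (auto simp: Wdel_def poly_prod)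

lemma poly_W_eq_0_iff: "poly W z = 0 \<longleftrightarrow> z \<in> Z"
  by (auto simp: W_def poly_prod)

lemma poly_Wdel_other: "z \<in> Z \<Longrightarrow> j \<noteq> z \<Longrightarrow> poly (Wdel j) z = 0"
  by (auto simp: Wdel_def poly_prod)

lemma poly_pderiv_W: "z \<in> Z \<Longrightarrow> poly (pderiv W) z = poly (Wdel z) z"
  by (simp add: W_Wdel[of z] pderiv_mult pderiv_pCons del: mult_pCons_left)

lemma poly_pderiv2_W: "z \<in> Z \<Longrightarrow> poly (pderiv (pderiv W)) z = 2 * poly (pderiv (Wdel z)) z"
  by (simp add: W_Wdel[of z] pderiv_mult pderiv_add pderiv_pCons del: mult_pCons_left)

lemma poly_pderiv_Wdel_other:
  assumes "z \<in> Z" "j \<in> Z" "j \<noteq> z"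
  shows "poly (pderiv (Wdel j)) z = poly (Wdel z) z / (z - j)"
proof -
  define R where "R = (\<Prod>x\<in>Z - {j, z}. [:- x, 1:])"
  have sets: "Z - {j} = insert z (Z - {j, z})" "Z - {z} = insert j (Z - {j, z})" using assms by auto
  have 1: "Wdel j = [:- z, 1:] * R"
    unfolding Wdel_def R_def sets(1) by (rule prod.insert) auto
  have 2: "Wdel z = [:- j, 1:] * R"
    unfolding Wdel_def R_def sets(2) by (rule prod.insert) auto
  have "poly (pderiv (Wdel j)) z = poly R z"
    unfolding 1 by (simp add: pderiv_mult pderiv_pCons del: mult_pCons_left)
  moreover have "poly (Wdel z) z = (z - j) * poly R z"
    unfolding 2 poly_mult by simp
  ultimately show ?thesis using assms by simp
qed

lemma poly_pderiv_Wdel_same: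
  assumes "z \<in> Z"
  shows "poly (pderiv (Wdel z)) z = poly (Wdel z) z * (\<Sum>j\<in>Z - {z}. 1 / (z - j))"
proof -
  have "poly (pderiv (Wdel z)) z = (\<Sum>j\<in>Z - {z}. poly (\<Prod>x\<in>Z - {z} - {j}. [:- x, 1:]) z)"
    unfolding Wdel_def pderiv_prod by (simp add: pderiv_pCons poly_sum)
  also have "\<dots> = (\<Sum>j\<in>Z - {z}. poly (Wdel z) z * (1 / (z - j)))"
  proof (intro sum.cong refl)
    fix j assume j: "j \<in> Z - {z}"
    have "Wdel z = [:- j, 1:] * (\<Prod>x\<in>Z - {z} - {j}. [:- x, 1:])"
      unfolding Wdel_def using j by (intro prod.remove) auto
    then have "poly (Wdel z) z = (z - j) * poly (\<Prod>x\<in>Z - {z} - {j}. [:- x, 1:]) z"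
      by (simp only: poly_mult) simp
    then show "poly (\<Prod>x\<in>Z - {z} - {j}. [:- x, 1:]) z = poly (Wdel z) z * (1 / (z - j))"
      using j by auto
  qed
  finally show ?thesis by (simp add: sum_distrib_left)
qed

lemma poly_U:
  assumes "z \<in> Z"
  shows "poly (U h) z = h z * poly (Wdel z) z"
proof -
  have "poly (U h) z = h z * poly (Wdel z) z + (\<Sum>j\<in>Z - {z}. h j * poly (Wdel j) z)"
    using assms by (simp add: U_def poly_sum sum.remove)
  also have "(\<Sum>j\<in>Z - {z}. h j * poly (Wdel j) z) = 0"
    using assms by (intro sum.neutral) (auto simp: poly_Wdel_other)
  finally show ?thesis by simp
qed

text \<open>The left side is the derivative of \<open>ode (U h) y\<close> at \<open>z\<close> when
  \<open>y\<close> has value 1 and derivative \<open>h z\<close> there. Its vanishing is the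
  condition that excludes a logarithm at \<open>z\<close>.\<close>

lemma quadratic_at:
  assumes "z \<in> Z"
  shows "poly (U h) z * h z + poly (pderiv (U h)) z - poly (pderiv (pderiv W)) z * h z
    = poly (Wdel z) z * ((h z)^2 - (\<Sum>j\<in>Z. (h z - h j) / (z - j)))"
proof -
  define \<omega> where "\<omega> = poly (Wdel z) z"
  define s where "s = (\<Sum>j\<in>Z - {z}. 1 / (z - j))"
  define t where "t = (\<Sum>j\<in>Z - {z}. h j / (z - j))"
  have "poly (pderiv (U h)) z = (\<Sum>j\<in>Z. h j * poly (pderiv (Wdel j)) z)"
    by (simp add: U_def pderiv_sum pderiv_smult poly_sum)
  also have "\<dots> = h z * poly (pderiv (Wdel z)) z + (\<Sum>j\<in>Z - {z}. h j * poly (pderiv (Wdel j)) z)"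
    using assms by (simp add: sum.remove)
  also have "(\<Sum>j\<in>Z - {z}. h j * poly (pderiv (Wdel j)) z) = \<omega> * t"
    unfolding t_def sum_distrib_left using assms
    by (intro sum.cong refl) (auto simp: poly_pderiv_Wdel_other \<omega>_def)
  finally have 1: "poly (pderiv (U h)) z = h z * (\<omega> * s) + \<omega> * t"
    using assms by (simp add: poly_pderiv_Wdel_same \<omega>_def s_def)
  have "(\<Sum>j\<in>Z. (h z - h j) / (z - j)) = (\<Sum>j\<in>Z - {z}. (h z - h j) / (z - j))"
    using assms by (simp add: sum.remove)
  also have "\<dots> = h z * s - t"
    by (simp add: s_def t_def sum_distrib_left sum_subtractf[symmetric] diff_divide_distrib)
  finally have 2: "(\<Sum>j\<in>Z. (h z - h j) / (z - j)) = h z * s - t" .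
  show ?thesis using assms unfolding 1 2
    by (simp add: poly_U poly_pderiv2_W poly_pderiv_Wdel_same \<omega>_def[symmetric] s_def[symmetric] power2_eq_square algebra_simps)
qed

definition ode :: "complex poly \<Rightarrow> complex poly \<Rightarrow> complex poly" where
  "ode V y = W * pderiv (pderiv y) - pderiv W * pderiv y + V * y"

lemma poly_ode:
  assumes "z \<in> Z"
  shows "poly (ode (U h) y) z = poly (Wdel z) z * (h z * poly y z - poly (pderiv y) z)"
  using assms poly_W_eq_0_iff[of z] by (simp add: ode_def poly_U poly_pderiv_W algebra_simps)

text \<open>Differentiation produces \<open>W' y''\<close> twice with opposite signs, and
  \<open>W\<close> vanishes at \<open>z\<close>, so no derivative of \<open>y\<close> beyond the
  first survives.\<close>

lemma poly_pderiv_ode: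
  assumes "z \<in> Z" "poly (pderiv y) z = h z * poly y z"
  shows "poly (pderiv (ode (U h) y)) z =
    poly (Wdel z) z * ((h z)^2 - (\<Sum>j\<in>Z. (h z - h j) / (z - j))) * poly y z"
proof -
  have eq: "pderiv (ode (U h) y) = W * pderiv (pderiv (pderiv y)) - pderiv (pderiv W) * pderiv y
     + pderiv (U h) * y + U h * pderiv y"
    by (simp add: ode_def pderiv_add pderiv_diff pderiv_mult algebra_simps)
  have "poly (pderiv (ode (U h) y)) z =
     (poly (U h) z * h z + poly (pderiv (U h)) z - poly (pderiv (pderiv W)) z * h z) * poly y z"
    unfolding eq using assms poly_W_eq_0_iff[of z] by (simp add: algebra_simps)
  then show ?thesis unfolding quadratic_at[OF assms(1)] .
qed

lemma shift2_ode: "pCons 0 (pCons 0 (ode V y)) =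
   W * pCons 0 (pCons 0 (pderiv (pderiv y))) - pCons 0 (pderiv W) * pCons 0 (pderiv y) + pCons 0 (pCons 0 V) * y"
  by (simp add: ode_def)

text \<open>The bracket is the indicial polynomial at infinity; its roots are the possible degrees
  of polynomial solutions.\<close>

lemma coeff_shift2_ode:
  assumes "degree (pCons 0 (pCons 0 V)) \<le> card Z" "degree y \<le> m"
  shows "coeff (pCons 0 (pCons 0 (ode V y))) (card Z + m) =
    (of_nat m * (of_nat m - 1) - of_nat (card Z) * of_nat m + coeff (pCons 0 (pCons 0 V)) (card Z)) * coeff y m"
proof -
  have 1: "coeff (W * pCons 0 (pCons 0 (pderiv (pderiv y)))) (card Z + m) = of_nat m * (of_nat m - 1) * coeff y m"
    using assms(2) degree_euler2[of y]
    by (subst coeff_mult_top) (simp_all only: degree_W monic_W coeff_euler2 mult_1 order_refl order_trans)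
  have 2: "coeff (pCons 0 (pderiv W) * pCons 0 (pderiv y)) (card Z + m) = of_nat (card Z) * of_nat m * coeff y m"
    using assms(2) degree_euler[of y] degree_euler[of W] unfolding degree_W
    by (subst coeff_mult_top) (auto simp only: monic_W coeff_euler mult_1_right mult.assoc intro: order_trans)
  have 3: "coeff (pCons 0 (pCons 0 V) * y) (card Z + m) = coeff (pCons 0 (pCons 0 V)) (card Z) * coeff y m"
    using assms by (rule coeff_mult_top)
  show ?thesis unfolding shift2_ode coeff_add coeff_diff 1 2 3 by (simp add: algebra_simps)
qed

lemma degree_U_le: "degree (U h) \<le> card Z - 1"
  unfolding U_def by (intro degree_sum_le) (auto intro: order_trans[OF degree_smult_le] simp: degree_Wdel)

lemma coeff_U_top: "coeff (U h) (card Z - 1) = (\<Sum>j\<in>Z. h j)"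
  using monic_Wdel by (simp add: U_def coeff_sum)

text \<open>Since \<open>x * Wdel j = W + j * Wdel j\<close>, the polynomial \<open>x * U h\<close>
  is the sum of the \<open>h j\<close> times \<open>W\<close> plus the analogue of \<open>U\<close>
  with weights \<open>j * h j\<close>.\<close>

lemma coeff_shift_U:
  assumes "(\<Sum>j\<in>Z. h j) = 0" "card Z > 0"
  shows "degree (pCons 0 (pCons 0 (U h))) \<le> card Z"
    "coeff (pCons 0 (pCons 0 (U h))) (card Z) = (\<Sum>j\<in>Z. j * h j)"
proof -
  obtain n where n: "card Z = Suc n" using assms(2) by (cases "card Z") auto
  show "degree (pCons 0 (pCons 0 (U h))) \<le> card Z"
  proof (rule degree_le, intro allI impI)
    fix i assume i: "i > card Z"
    then obtain l where l: "i = Suc (Suc l)" "l \<ge> n" unfolding n by (metis Suc_le_D Suc_le_mono Suc_le_eq)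
    have "coeff (U h) l = 0"
      using degree_U_le[of h] coeff_U_top[of h] assms(1) l by (cases "l = n") (auto simp: n coeff_eq_0)
    then show "coeff (pCons 0 (pCons 0 (U h))) i = 0" by (simp add: l)
  qed
  have "pCons 0 (Wdel j) = W + smult j (Wdel j)" if "j \<in> Z" for j
    by (simp add: W_Wdel[OF that])
  then have "pCons 0 (U h) = (\<Sum>j\<in>Z. smult (h j) (W + smult j (Wdel j)))"
    unfolding U_def pCons_0_sum by (intro sum.cong refl) (simp add: pCons_0_smult)
  then have "coeff (pCons 0 (U h)) n = (\<Sum>j\<in>Z. h j * coeff W n + j * h j * coeff (Wdel j) n)"
    by (simp add: coeff_sum algebra_simps)
  also have "\<dots> = (\<Sum>j\<in>Z. h j) * coeff W n + (\<Sum>j\<in>Z. j * h j)"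
    using monic_Wdel by (simp add: sum.distrib sum_distrib_right n)
  finally show "coeff (pCons 0 (pCons 0 (U h))) (card Z) = (\<Sum>j\<in>Z. j * h j)"
    using assms(1) by (simp add: n)
qed

lemma degree_shift2_ode:
  assumes "degree (pCons 0 (pCons 0 V)) \<le> card Z" "degree y \<le> m"
  shows "degree (pCons 0 (pCons 0 (ode V y))) \<le> card Z + m"
proof -
  have "degree (pCons 0 (pCons 0 (pderiv (pderiv y)))) \<le> m" "degree (pCons 0 (pderiv y)) \<le> m"
    "degree (pCons 0 (pderiv W)) \<le> card Z" "degree W \<le> card Z"
    using degree_euler[of y] degree_euler2[of y] degree_euler[of W] assms(2) degree_W by linarith+
  then show ?thesis unfolding shift2_ode using assms
    by (intro degree_add_le degree_diff_le order_trans[OF degree_mult_le] add_mono)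
qed

lemma ode_degree:
  assumes "degree (pCons 0 (pCons 0 V)) \<le> card Z" "ode V y = 0" "y \<noteq> 0"
  shows "of_nat (degree y) * (of_nat (degree y) - 1) - of_nat (card Z) * of_nat (degree y)
     + coeff (pCons 0 (pCons 0 V)) (card Z) = 0"
  using coeff_shift2_ode[OF assms(1) order_refl, of y] assms(2,3) by simp

text \<open>The bound is \<open>card Z + 1\<close> and not the degree of the rational functions:
  \<open>card Z + 2\<close> coefficients against \<open>card Z\<close> conditions leave room for two
  independent solutions, and the differential equation forces the smaller degrees
  afterwards.\<close>

definition solution :: "(complex \<Rightarrow> complex) \<Rightarrow> complex poly \<Rightarrow> bool" where
  "solution h y \<longleftrightarrow> degree y \<le> card Z + 1 \<and> (\<forall>z\<in>Z. poly (pderiv y) z = h z * poly y z)"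

lemma solution_lincomb:
  "solution h p \<Longrightarrow> solution h q \<Longrightarrow> solution h (smult a p + smult b q)"
  by (auto simp: solution_def pderiv_add pderiv_smult algebra_simps intro!: degree_add_le order_trans[OF degree_smult_le])

text \<open>The conditions on \<open>y\<close> make \<open>ode (U h) y\<close> vanish on
  \<open>Z\<close>, and the quadratic relations make these zeros double. So \<open>W * W\<close>, of
  degree \<open>2 * card Z\<close>, divides a polynomial which, if nonzero, has degree at most
  \<open>2 * card Z - 1\<close>.\<close>

lemma solution_ode:
  assumes Z: "card Z = 2 * k" "k \<ge> 1" and h: "h \<in> spectrum k" and y: "solution h y"
  shows "ode (U h) y = 0"
proof (rule ccontr)
  assume nz: "ode (U h) y \<noteq> 0"
  have s0: "(\<Sum>z\<in>Z. h z) = 0" and quad: "\<And>z. z \<in> Z \<Longrightarrow> (h z)^2 = (\<Sum>j\<in>Z. (h z - h j) / (z - j))"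
    using h by (auto simp: spectrum_def quadratic_def)
  have "W dvd ode (U h) y"
    unfolding W_def using y by (intro vanishing_prod_dvd) (auto simp: poly_ode solution_def)
  then obtain g where g: "ode (U h) y = W * g" by (elim dvdE)
  have "poly g z = 0" if z: "z \<in> Z" for z
  proof -
    have "poly (pderiv (ode (U h) y)) z = 0"
      using y quad[OF z] z by (subst poly_pderiv_ode) (auto simp: solution_def)
    then have "poly (pderiv W) z * poly g z = 0"
      unfolding g using poly_W_eq_0_iff[of z] z by (auto simp: pderiv_mult)
    then show ?thesis using poly_Wdel_neq_0[of z] z by (simp add: poly_pderiv_W)
  qed
  then have "W dvd g" unfolding W_def by (intro vanishing_prod_dvd) auto
  then obtain g' where "g = W * g'" by (elim dvdE)
  then have g': "ode (U h) y = W * (W * g')" using g by simp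
  then have "g' \<noteq> 0" using nz by auto
  then have "degree (ode (U h) y) \<ge> 2 * card Z"
    unfolding g' using W_nz by (simp add: degree_mult_eq degree_W)
  moreover have "degree (pCons 0 (pCons 0 (ode (U h) y))) \<le> card Z + (card Z + 1)"
    using y Z by (intro degree_shift2_ode coeff_shift_U s0) (auto simp: solution_def)
  ultimately show False using nz by simp
qed

text \<open>The two sum conditions in \<open>spectrum\<close> turn the indicial polynomial into
  \<open>(m - k) * (m - (k + 1))\<close>.\<close>

lemma solution_degree:
  assumes Z: "card Z = 2 * k" "k \<ge> 1" and h: "h \<in> spectrum k" and y: "solution h y" "y \<noteq> 0"
  shows "degree y = k \<or> degree y = k + 1"
proof -
  have s0: "(\<Sum>z\<in>Z. h z) = 0" and s1: "(\<Sum>z\<in>Z. z * h z) = of_nat k * (of_nat k + 1)"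
    using h by (auto simp: spectrum_def)
  have cZ: "card Z > 0" using Z by simp
  define m where "m = degree y"
  have "of_nat m * (of_nat m - 1) - of_nat (card Z) * of_nat m + of_nat k * (of_nat k + 1) = (0 :: complex)"
    using ode_degree[OF coeff_shift_U(1)[OF s0 cZ] solution_ode[OF Z h y(1)] y(2)]
    unfolding coeff_shift_U(2)[OF s0 cZ] s1 m_def .
  then have "(of_nat m - of_nat k) * (of_nat m - of_nat (k + 1)) = (0 :: complex)"
    unfolding Z(1) by (simp add: algebra_simps)
  then have "of_nat m = (of_nat k :: complex) \<or> of_nat m = (of_nat (k + 1) :: complex)" by simp
  then show ?thesis unfolding m_def[symmetric] of_nat_eq_iff .
qed

text \<open>One extra linear condition, indexed by \<open>None\<close>, still leaves
  \<open>card Z + 2\<close> unknowns against \<open>card Z + 1\<close> equations. It serves to make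
  a second solution differ in degree from a first one.\<close>

lemma solution_exists:
  "\<exists>y. solution h y \<and> y \<noteq> 0 \<and> coeff y t = 0"
proof -
  define F where "F i y = (case i of Some z \<Rightarrow> poly (pderiv y) z - h z * poly y z | None \<Rightarrow> coeff y t)"
    for i and y :: "complex poly"
  define J where "J = {..card Z + 1}"
  have "card (insert None (Some ` Z)) < card J"
    by (simp add: J_def card_image card_insert_if)
  then obtain x where x: "\<exists>j\<in>J. x j \<noteq> 0" "\<forall>j. j \<notin> J \<longrightarrow> x j = 0"
      "\<forall>i\<in>insert None (Some ` Z). (\<Sum>j\<in>J. F i (monom 1 j) * x j) = 0"
    using underdetermined_system[of "insert None (Some ` Z)" J "\<lambda>i j. F i (monom 1 j)"] by (auto simp: J_def)
  define y where "y = (\<Sum>j\<in>J. smult (x j) (monom 1 j))"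
  have coeff: "coeff y j = x j" for j
  proof -
    have "coeff y j = (\<Sum>i\<in>J. if i = j then x j else 0)"
      unfolding y_def coeff_sum by (intro sum.cong refl) auto
    then show ?thesis using x(2) by (auto simp: J_def)
  qed
  have F: "F i y = (\<Sum>j\<in>J. F i (monom 1 j) * x j)" for i
    by (cases i)
      (simp_all add: F_def y_def poly_sum pderiv_sum pderiv_smult coeff_sum sum_subtractf[symmetric] sum_distrib_left algebra_simps)
  have "F i y = 0" if "i \<in> insert None (Some ` Z)" for i
    using x(3) that unfolding F by blast
  then have "F None y = 0" "\<And>z. z \<in> Z \<Longrightarrow> F (Some z) y = 0" by auto
  moreover have "degree y \<le> card Z + 1"
    using x(2) by (intro degree_le) (auto simp: coeff J_def)
  moreover have "y \<noteq> 0" using x(1) coeff by force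
  ultimately show ?thesis by (intro exI[of _ y]) (auto simp: solution_def F_def)
qed

lemma solution_basis:
  assumes Z: "card Z = 2 * k" "k \<ge> 1" and h: "h \<in> spectrum k"
  obtains p q where "solution h p" "solution h q" "degree p = k + 1" "degree q = k" "p \<noteq> 0" "q \<noteq> 0"
proof -
  obtain y1 where y1: "solution h y1" "y1 \<noteq> 0" using solution_exists by blast
  \<comment> \<open>A zero coefficient at the degree of \<open>y1\<close> forces a different degree,
    so the two degrees are \<open>k\<close> and \<open>k + 1\<close>.\<close>
  obtain y2 where y2: "solution h y2" "y2 \<noteq> 0" "coeff y2 (degree y1) = 0" using solution_exists by blast
  have "degree y1 \<noteq> degree y2" using y2 by (metis leading_coeff_0_iff)
  then show ?thesis using solution_degree[OF Z h y1] solution_degree[OF Z h y2(1,2)] that y1 y2 by metis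
qed

text \<open>At \<open>z\<close> both polynomials satisfy \<open>y' = h z * y\<close> with the same
  factor, so the Wronskian vanishes on \<open>Z\<close>. Its degree is at most
  \<open>card Z\<close>, and it is nonzero because the degrees of \<open>p\<close> and
  \<open>q\<close> differ.\<close>

lemma solution_wronskian:
  assumes "card Z = 2 * k" "solution h p" "solution h q" "degree p = k + 1" "degree q = k" "p \<noteq> 0" "q \<noteq> 0"
  obtains c where "c \<noteq> 0" "wronskian p q = smult c W"
proof -
  have "W dvd wronskian p q"
    unfolding W_def using assms(2,3) by (intro vanishing_prod_dvd) (auto simp: solution_def wronskian_def)
  then obtain g where g: "wronskian p q = W * g" by (elim dvdE)
  have "coeff (pCons 0 (wronskian p q)) (k + 1 + k) \<noteq> 0"
    using degree_shift_wronskian(2)[of p "k + 1" q k] assms leading_coeff_0_iff[of p] leading_coeff_0_iff[of q] by simp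
  then have "wronskian p q \<noteq> 0" by auto
  moreover have "degree (pCons 0 (wronskian p q)) \<le> k + 1 + k"
    using assms by (intro degree_shift_wronskian) auto
  ultimately have "degree (wronskian p q) \<le> card Z" using assms(1) by simp
  moreover have "g \<noteq> 0" using g \<open>wronskian p q \<noteq> 0\<close> by auto
  ultimately have "degree g = 0" unfolding g using W_nz by (simp add: degree_mult_eq degree_W)
  then obtain c where "g = [:c:]" by (meson degree_eq_zeroE)
  then show ?thesis using that[of c] g \<open>g \<noteq> 0\<close> by simp
qed

lemma solution_span:
  assumes Z: "card Z = 2 * k" "k \<ge> 1" and h: "h \<in> spectrum k"
    and pq: "solution h p" "solution h q" "degree p = k + 1" "degree q = k" "p \<noteq> 0" "q \<noteq> 0"
    and y: "solution h y"
  obtains a b where "y = smult a p + smult b q"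
proof -
  define a where "a = coeff y (k + 1) / coeff p (k + 1)"
  define r where "r = smult 1 y + smult (- a) p"
  define b where "b = coeff r k / coeff q k"
  define s where "s = smult 1 r + smult (- b) q"
  have lc: "coeff p (k + 1) \<noteq> 0" "coeff q k \<noteq> 0" "coeff q (k + 1) = 0"
    using pq leading_coeff_0_iff[of p] leading_coeff_0_iff[of q] by (auto simp: coeff_eq_0)
  have r: "solution h r" unfolding r_def using y pq by (intro solution_lincomb)
  have s: "solution h s" unfolding s_def using r pq by (intro solution_lincomb)
  have "coeff r (k + 1) = 0" using lc by (simp add: r_def a_def)
  then have "coeff s (k + 1) = 0" "coeff s k = 0" using lc by (simp_all add: s_def b_def)
  then have "s = 0" using solution_degree[OF Z h s] by (metis leading_coeff_0_iff)
  then have "y = smult a p + smult b q" by (simp add: s_def r_def algebra_simps)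
  then show ?thesis using that by blast
qed

text \<open>Up to a nonzero constant, \<open>ode V y\<close> is the determinant with rows
  \<open>y, y', y''\<close> and \<open>p, p', p''\<close> and \<open>q, q', q''\<close>, which has
  two equal rows for \<open>y = p\<close> and \<open>y = q\<close>.\<close>

lemma wronskian_ode:
  "ode V p = 0 \<and> ode V q = 0" if c: "c \<noteq> 0" "wronskian p q = smult c W"
    and V: "V = smult (1 / c) (pderiv (pderiv p) * pderiv q - pderiv p * pderiv (pderiv q))"
proof -
  define w where "w = wronskian p q"
  define v where "v = pderiv (pderiv p) * pderiv q - pderiv p * pderiv (pderiv q)"
  have W: "W = smult (1 / c) w" using c by (simp add: w_def)
  have w': "pderiv w = pderiv (pderiv p) * q - p * pderiv (pderiv q)"
    by (simp add: w_def wronskian_def pderiv_diff pderiv_mult algebra_simps)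
  have "ode V y = smult (1 / c) (w * pderiv (pderiv y) - pderiv w * pderiv y + v * y)" for y
    unfolding ode_def W V v_def[symmetric] by (simp add: pderiv_smult smult_add_right smult_diff_right)
  moreover have "w * pderiv (pderiv p) - pderiv w * pderiv p + v * p = 0"
    "w * pderiv (pderiv q) - pderiv w * pderiv q + v * q = 0"
    unfolding w' by (simp_all add: w_def v_def wronskian_def algebra_simps)
  ultimately show ?thesis by simp
qed

lemma degree_ode_potential:
  assumes "ode V y = 0" "y \<noteq> 0"
  shows "degree (pCons 0 (pCons 0 V)) \<le> card Z"
proof (cases "V = 0")
  case False
  have "pCons 0 (pCons 0 V) * y = pCons 0 (pderiv W) * pCons 0 (pderiv y) - W * pCons 0 (pCons 0 (pderiv (pderiv y)))"
    using shift2_ode[of V y] assms(1) by (simp add: algebra_simps)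
  moreover have "degree (pCons 0 (pderiv W) * pCons 0 (pderiv y) - W * pCons 0 (pCons 0 (pderiv (pderiv y)))) \<le> card Z + degree y"
    using degree_euler[of y] degree_euler2[of y] degree_euler[of W] unfolding degree_W
    by (intro degree_diff_le order_trans[OF degree_mult_le] add_mono) (auto simp: degree_W simp del: degree_pCons_eq_if)
  ultimately have "degree (pCons 0 (pCons 0 V) * y) \<le> card Z + degree y" by simp
  then show ?thesis using False assms(2) by (subst (asm) degree_mult_eq) auto
qed simp

text \<open>Lagrange interpolation: both polynomials have degree below \<open>card Z\<close> and
  agree on \<open>Z\<close>.\<close>

lemma U_interpolates:
  assumes "degree (pCons 0 (pCons 0 V)) \<le> card Z" "Z \<noteq> {}"
  shows "V = U (\<lambda>z. if z \<in> Z then poly V z / poly (Wdel z) z else 0)" (is "V = U ?h")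
proof (rule ccontr)
  assume "V \<noteq> U ?h"
  then have nz: "V - U ?h \<noteq> 0" by simp
  have "W dvd V - U ?h"
    unfolding W_def using poly_Wdel_neq_0 by (intro vanishing_prod_dvd) (auto simp: poly_U)
  then have "card Z \<le> degree (V - U ?h)" using dvd_imp_degree_le[OF _ nz, of W] by (simp only: degree_W)
  moreover have "degree V \<le> card Z - 1" using assms(1) by (cases "V = 0") auto
  then have "degree (V - U ?h) \<le> card Z - 1" using degree_U_le by (intro degree_diff_le)
  moreover have "card Z > 0" using assms(2) by (simp add: card_gt_0_iff)
  ultimately show False by simp
qed

text \<open>The equation is rebuilt from the plane spanned by \<open>p\<close> and \<open>q\<close>,
  and \<open>h\<close> is read off its potential. The sum conditions come from the behaviour at
  infinity of a member of degree \<open>k + 1\<close>, the quadratic ones from the derivative of the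
  equation on \<open>Z\<close>.\<close>

lemma wronskian_spectrum:
  assumes Z: "card Z = 2 * k" "k \<ge> 1" and c: "c \<noteq> 0" "wronskian p q = smult c W"
    and deg: "max (degree p) (degree q) = k + 1"
  obtains h where "h \<in> spectrum k" "solution h p" "solution h q"
proof -
  define V where "V = smult (1 / c) (pderiv (pderiv p) * pderiv q - pderiv p * pderiv (pderiv q))"
  have ode: "ode V p = 0" "ode V q = 0" using wronskian_ode[OF c V_def] by auto
  obtain y where y: "ode V y = 0" "degree y = k + 1" using ode deg by (auto simp: max_def split: if_splits)
  then have "y \<noteq> 0" by auto
  have degV: "degree (pCons 0 (pCons 0 V)) \<le> card Z" using y(1) \<open>y \<noteq> 0\<close> by (rule degree_ode_potential)
  define h where "h = (\<lambda>z. if z \<in> Z then poly V z / poly (Wdel z) z else 0)"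
  have "Z \<noteq> {}" and cZ: "card Z > 0" using Z by auto
  then have V: "V = U h" unfolding h_def by (intro U_interpolates degV)
  have s0: "(\<Sum>z\<in>Z. h z) = 0"
  proof -
    have "coeff V (card Z - 1) = coeff (pCons 0 (pCons 0 V)) (Suc (card Z))" using cZ by (cases "card Z") auto
    also have "\<dots> = 0" using degV by (intro coeff_eq_0) simp
    finally show ?thesis unfolding V coeff_U_top .
  qed
  have sol: "poly (pderiv x) z = h z * poly x z" if "ode V x = 0" "z \<in> Z" for x z
    using poly_ode[OF that(2), of h x] that(1) poly_Wdel_neq_0[of z] unfolding V by simp
  have solp: "solution h p" and solq: "solution h q"
    using sol ode deg Z by (auto simp: solution_def)
  have "quadratic h"
    unfolding quadratic_def
  proof
    fix z assume z: "z \<in> Z"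
    \<comment> \<open>A member not vanishing at \<open>z\<close> is needed in order to cancel its
      value. It exists: a common zero of \<open>p\<close> and \<open>q\<close> would be a double
      zero of their Wronskian, whereas the zeros of \<open>W\<close> are simple.\<close>
    obtain x where x: "ode V x = 0" "poly x z \<noteq> 0"
    proof (cases "poly p z = 0 \<and> poly q z = 0")
      case True
      have "pderiv (wronskian p q) = pderiv (pderiv p) * q - p * pderiv (pderiv q)"
        by (simp add: wronskian_def pderiv_diff pderiv_mult algebra_simps)
      then have "poly (pderiv (wronskian p q)) z = 0" using True by simp
      then show ?thesis using c poly_Wdel_neq_0[of z] z by (simp add: pderiv_smult poly_pderiv_W)
    qed (use ode that in blast)
    have "poly (pderiv (ode (U h) x)) z = 0" using x(1) by (simp add: V)
    then show "(h z)^2 = (\<Sum>j\<in>Z. (h z - h j) / (z - j))"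
      using poly_pderiv_ode[where h = h and y = x, OF z sol[OF x(1) z]] x(2) poly_Wdel_neq_0[of z] by simp
  qed
  moreover have "(\<Sum>z\<in>Z. z * h z) = of_nat k * (of_nat k + 1)"
  proof -
    have "of_nat (k + 1) * (of_nat (k + 1) - 1) - of_nat (card Z) * of_nat (k + 1) + (\<Sum>z\<in>Z. z * h z) = 0"
      using ode_degree[OF degV y(1) \<open>y \<noteq> 0\<close>] unfolding V coeff_shift_U(2)[OF s0 cZ] y(2) .
    then show ?thesis unfolding Z(1) by (simp add: algebra_simps eq_neg_iff_add_eq_0)
  qed
  ultimately have "h \<in> spectrum k" using s0 by (simp add: spectrum_def h_def)
  then show ?thesis using that solp solq by blast
qed

end

section \<open>Rational maps of the sphere\<close>

text \<open>The point with homogeneous coordinates \<open>u : v\<close>, which treats infinity like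
  any other point. \<open>ratio 0 0\<close> has no such meaning, whence the hypotheses of
  \<open>ratio_eq_iff\<close>.\<close>

definition ratio :: "complex \<Rightarrow> complex \<Rightarrow> sphere" where
  "ratio u v = (if v = 0 then None else Some (u / v))"

lemma ratio_eq_iff:
  assumes "u \<noteq> 0 \<or> v \<noteq> 0" "u' \<noteq> 0 \<or> v' \<noteq> 0"
  shows "ratio u v = ratio u' v' \<longleftrightarrow> u * v' = u' * v"
  using assms by (auto simp: ratio_def frac_eq_eq)

lemma ratio_mult: "c \<noteq> 0 \<Longrightarrow> ratio (c * u) (c * v) = ratio u v"
  by (simp add: ratio_def)

lemma rat_map_Some: "rat_map p q (Some z) = ratio (poly p z) (poly q z)"
  by (simp add: rat_map_def ratio_def)

lemma rat_map_None: "max (degree p) (degree q) = N \<Longrightarrow> rat_map p q None = ratio (coeff p N) (coeff q N)"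
  by (simp add: rat_map_def ratio_def)

lemma moebius_ratio:
  assumes "a * e - b * c \<noteq> 0" "u \<noteq> 0 \<or> v \<noteq> 0"
  shows "rat_map [:b, a:] [:e, c:] (ratio u v) = ratio (a * u + b * v) (c * u + e * v)"
proof (cases "v = 0")
  case True
  have "max (degree [:b, a:]) (degree [:e, c:]) = 1" using assms(1) by auto
  from rat_map_None[OF this] show ?thesis
    using True assms by (simp add: ratio_def)
next
  case False
  have "rat_map [:b, a:] [:e, c:] (ratio u v) = ratio (b + u / v * a) (e + u / v * c)"
    using False by (simp add: ratio_def rat_map_Some)
  also have "\<dots> = ratio (v * (b + u / v * a)) (v * (e + u / v * c))"
    using False by (simp only: ratio_mult not_False_eq_True)
  also have "\<dots> = ratio (a * u + b * v) (c * u + e * v)"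
    using False by (simp add: distrib_left mult.commute add.commute)
  finally show ?thesis .
qed

lemma coprime_iff_no_common_root:
  fixes p q :: "complex poly"
  shows "coprime p q \<longleftrightarrow> (\<forall>z. poly p z \<noteq> 0 \<or> poly q z \<noteq> 0)"
proof
  assume cop: "coprime p q"
  show "\<forall>z. poly p z \<noteq> 0 \<or> poly q z \<noteq> 0"
  proof (rule allI, rule ccontr)
    fix z assume "\<not> (poly p z \<noteq> 0 \<or> poly q z \<noteq> 0)"
    then have "[:- z, 1:] dvd p" "[:- z, 1:] dvd q" by (auto simp: poly_eq_0_iff_dvd)
    then have "is_unit [:- z, 1:]" using cop by (metis coprime_common_divisor)
    then show False by (simp add: is_unit_poly_iff)
  qed
next
  assume nr: "\<forall>z. poly p z \<noteq> 0 \<or> poly q z \<noteq> 0"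
  show "coprime p q"
  proof (rule coprimeI)
    fix r assume r: "r dvd p" "r dvd q"
    have "degree r = 0"
    proof (rule ccontr)
      assume "degree r \<noteq> 0"
      then obtain z where "poly r z = 0"
        using fundamental_theorem_of_algebra[of r] by (auto simp: constant_degree)
      then have "poly p z = 0" "poly q z = 0" using r by (metis dvdE mult_zero_left poly_mult)+
      then show False using nr by blast
    qed
    then obtain c where c: "r = [:c:]" by (meson degree_eq_zeroE)
    have "c \<noteq> 0" using r nr by (auto simp: c)
    then show "is_unit r" by (simp add: c is_unit_const_poly_iff dvd_field_iff)
  qed
qed

lemma top_coeffs_eq_0:
  assumes "degree q \<le> degree p" "coeff p (degree p) = 0" "coeff q (degree p) = 0"
  shows "p = 0 \<and> q = 0"
proof -
  have "p = 0" using assms(2) leading_coeff_0_iff by blast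
  moreover from this have "degree q = 0" "coeff q 0 = 0" using assms by auto
  then have "q = 0" by (metis leading_coeff_0_iff)
  ultimately show ?thesis by simp
qed

lemma coprime_top_coeff:
  fixes p q :: "complex poly"
  assumes "coprime p q" "max (degree p) (degree q) = N"
  shows "coeff p N \<noteq> 0 \<or> coeff q N \<noteq> 0"
proof (rule ccontr)
  assume "\<not> ?thesis"
  then have "p = 0 \<and> q = 0"
    using assms(2) top_coeffs_eq_0[of q p] top_coeffs_eq_0[of p q] by (auto simp: max_def split: if_splits)
  then show False using assms(1) by simp
qed

lemma max_degree_eqI:
  assumes "degree p \<le> N" "degree q \<le> N" "coeff p N \<noteq> 0 \<or> coeff q N \<noteq> 0"
  shows "max (degree p) (degree q) = N"
  using assms le_degree[of p N] le_degree[of q N] by auto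

lemma linear_system_2:
  fixes a b c e u v :: complex
  assumes "a * e - b * c \<noteq> 0" "a * u + b * v = 0" "c * u + e * v = 0"
  shows "u = 0 \<and> v = 0"
proof -
  have "(a * e - b * c) * u = e * (a * u + b * v) - b * (c * u + e * v)" by (simp add: algebra_simps)
  moreover have "(a * e - b * c) * v = a * (c * u + e * v) - c * (a * u + b * v)" by (simp add: algebra_simps)
  ultimately show ?thesis using assms by simp
qed

lemma moebius_comp:
  fixes p q :: "complex poly"
  assumes "coprime p q" "max (degree p) (degree q) = N" and det: "a * e - b * c \<noteq> 0"
  defines "P \<equiv> smult a p + smult b q" and "Q \<equiv> smult c p + smult e q"
  shows "coprime P Q" "max (degree P) (degree Q) = N"
    "rat_map [:b, a:] [:e, c:] \<circ> rat_map p q = rat_map P Q"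
proof -
  have nr: "poly p z \<noteq> 0 \<or> poly q z \<noteq> 0" for z using assms(1) coprime_iff_no_common_root by blast
  show cop: "coprime P Q"
    unfolding coprime_iff_no_common_root
  proof
    fix z show "poly P z \<noteq> 0 \<or> poly Q z \<noteq> 0"
      using nr[of z] linear_system_2[OF det, of "poly p z" "poly q z"] by (auto simp: P_def Q_def)
  qed
  have top: "coeff p N \<noteq> 0 \<or> coeff q N \<noteq> 0" using assms(1,2) by (rule coprime_top_coeff)
  show deg: "max (degree P) (degree Q) = N"
  proof (rule max_degree_eqI)
    show "degree P \<le> N" "degree Q \<le> N" using assms(2)
      by (auto simp: P_def Q_def intro!: degree_add_le order_trans[OF degree_smult_le])
    show "coeff P N \<noteq> 0 \<or> coeff Q N \<noteq> 0"
      using top linear_system_2[OF det, of "coeff p N" "coeff q N"] by (auto simp: P_def Q_def)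
  qed
  show "rat_map [:b, a:] [:e, c:] \<circ> rat_map p q = rat_map P Q"
  proof
    fix x show "(rat_map [:b, a:] [:e, c:] \<circ> rat_map p q) x = rat_map P Q x"
    proof (cases x)
      case None
      then show ?thesis using moebius_ratio[OF det top]
        by (simp add: rat_map_None[OF assms(2)] rat_map_None[OF deg]) (simp add: P_def Q_def)
    next
      case (Some z)
      then show ?thesis using moebius_ratio[OF det nr[of z]]
        by (simp add: rat_map_Some) (simp add: P_def Q_def)
    qed
  qed
qed

text \<open>The roots of \<open>p\<close> are split off one at a time; each is a root of
  \<open>P\<close> because it is none of \<open>q\<close>.\<close>

lemma dvd_mult_no_common_root:
  fixes p q P :: "complex poly"
  assumes "p dvd P * q" "\<And>z. poly p z \<noteq> 0 \<or> poly q z \<noteq> 0"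
  shows "p dvd P"
  using assms
proof (induction "degree p" arbitrary: p P)
  case 0
  then obtain c where c: "p = [:c:]" by (metis degree_eq_zeroE)
  show ?case
  proof (cases "c = 0")
    case True
    then have "q \<noteq> 0" "P * q = 0" using 0 by (auto simp: c)
    then show ?thesis by simp
  next
    case False
    then show ?thesis by (simp add: c is_unit_const_poly_iff dvd_field_iff unit_imp_dvd)
  qed
next
  case (Suc n)
  then obtain z where z: "poly p z = 0"
    using fundamental_theorem_of_algebra[of p] by (auto simp: constant_degree)
  then obtain p1 where p1: "p = [:- z, 1:] * p1" by (metis dvdE poly_eq_0_iff_dvd)
  have "poly (P * q) z = 0" using Suc.prems(1) z by (metis dvdE mult_zero_left poly_mult)
  then have "poly P z = 0" using Suc.prems(2)[of z] z by simp
  then obtain P1 where P1: "P = [:- z, 1:] * P1" by (metis dvdE poly_eq_0_iff_dvd)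
  have "p1 \<noteq> 0" using Suc.hyps(2) p1 by auto
  then have "degree p = Suc (degree p1)" unfolding p1 by (subst degree_mult_eq) auto
  then have deg: "n = degree p1" using Suc.hyps(2) by simp
  have "[:- z, 1:] * p1 dvd [:- z, 1:] * (P1 * q)"
    using Suc.prems(1) unfolding p1 P1 by (simp only: mult.assoc)
  then have "p1 dvd P1 * q" by (subst (asm) dvd_mult_cancel_left) auto
  moreover have "poly p1 x \<noteq> 0 \<or> poly q x \<noteq> 0" for x
    using Suc.prems(2)[of x] by (auto simp: p1)
  ultimately have "p1 dvd P1" by (rule Suc.hyps(1)[OF deg])
  then show ?case unfolding p1 P1 by (intro mult_dvd_mono dvd_refl)
qed

lemma rat_map_eqD:
  fixes p q :: "complex poly"
  assumes "coprime p q" "coprime P Q" "rat_map p q = rat_map P Q"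
  obtains c where "c \<noteq> 0" "P = smult c p" "Q = smult c q"
proof -
  have "poly (p * Q) z = poly (P * q) z" for z
  proof -
    have "ratio (poly p z) (poly q z) = ratio (poly P z) (poly Q z)"
      using assms(3) by (simp flip: rat_map_Some)
    then show ?thesis using assms(1,2) by (simp add: ratio_eq_iff coprime_iff_no_common_root)
  qed
  then have eq: "p * Q = P * q" by (intro poly_ext) auto
  then have "p dvd P * q" by (metis dvd_triv_left)
  then have "p dvd P" using assms(1) dvd_mult_no_common_root[of p P q] coprime_iff_no_common_root by blast
  then obtain g where g: "P = p * g" by (elim dvdE)
  have "q dvd Q * p" using eq by (metis dvd_triv_right mult.commute)
  then have "q dvd Q" using assms(1) dvd_mult_no_common_root[of q Q p] coprime_iff_no_common_root by blast
  then obtain g' where g': "Q = q * g'" by (elim dvdE)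
  have pq: "p * q * g' = p * q * g" using eq unfolding g g' by (simp add: algebra_simps)
  \<comment> \<open>For \<open>p = 0\<close> the equation \<open>P = p * g\<close> says nothing
    about \<open>g\<close>, so the unit is then taken to be \<open>g'\<close>.\<close>
  have unit: "is_unit (if p = 0 then g' else g)"
  proof (cases "p = 0")
    case True
    then have "is_unit Q" using assms(2) g by simp
    then show ?thesis using True g' by (simp add: is_unit_mult_iff)
  next
    case False
    show ?thesis
    proof (cases "q = 0")
      case True
      then have "is_unit P" using assms(2) g' by simp
      then show ?thesis using False g by (simp add: is_unit_mult_iff)
    next
      case q: False
      then have "g' = g" using pq False by simp
      then have "g dvd P" "g dvd Q" using g g' by auto
      then show ?thesis using coprime_common_divisor[OF assms(2)] False by simp
    qed
  qed
  then obtain c where c: "(if p = 0 then g' else g) = [:c:]" unfolding is_unit_poly_iff by blast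
  then have "c \<noteq> 0" using unit by auto
  have "P = smult c p" "Q = smult c q"
  proof -
    show "P = smult c p" using c g by (cases "p = 0") auto
    show "Q = smult c q"
    proof (cases "p = 0 \<or> q = 0")
      case True
      then show ?thesis using c g' by (auto split: if_splits)
    next
      case False
      then have "g' = g" using pq by simp
      then show ?thesis using False c g' by auto
    qed
  qed
  then show ?thesis using that \<open>c \<noteq> 0\<close> by blast
qed

lemma rational_functionE:
  assumes "rational_function d f"
  obtains p q where "coprime p q" "max (degree p) (degree q) = d" "f = rat_map p q"
  using assms by (auto simp: rational_function_def)

lemma rat_equiv_iff:
  assumes pq: "coprime p q" "max (degree p) (degree q) = d"
  shows "(g, rat_map p q) \<in> rat_equiv d \<longleftrightarrow>
    (\<exists>a b c e. a * e - b * c \<noteq> 0 \<and> g = rat_map (smult a p + smult b q) (smult c p + smult e q))"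
proof
  assume "(g, rat_map p q) \<in> rat_equiv d"
  then obtain a b c e where "a * e - b * c \<noteq> 0" "g = rat_map [:b, a:] [:e, c:] \<circ> rat_map p q"
    by (auto simp: rat_equiv_def moebius_def)
  then show "\<exists>a b c e. a * e - b * c \<noteq> 0 \<and> g = rat_map (smult a p + smult b q) (smult c p + smult e q)"
    using moebius_comp(3)[OF pq] by metis
next
  assume "\<exists>a b c e. a * e - b * c \<noteq> 0 \<and> g = rat_map (smult a p + smult b q) (smult c p + smult e q)"
  then obtain a b c e where det: "a * e - b * c \<noteq> 0" and g: "g = rat_map (smult a p + smult b q) (smult c p + smult e q)"
    by blast
  have "rational_function d g" unfolding g rational_function_def
    using moebius_comp(1,2)[OF pq det] by blast
  moreover have "rational_function d (rat_map p q)" using pq unfolding rational_function_def by blast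
  moreover have "g = rat_map [:b, a:] [:e, c:] \<circ> rat_map p q" unfolding g using moebius_comp(3)[OF pq det] by simp
  moreover have "rat_map [:b, a:] [:e, c:] \<in> moebius" using det unfolding moebius_def by blast
  ultimately show "(g, rat_map p q) \<in> rat_equiv d" by (auto simp: rat_equiv_def)
qed

lemma equiv_rat_equiv: "equiv {f. rational_function d f} (rat_equiv d)"
proof (rule equivI)
  show "rat_equiv d \<subseteq> {f. rational_function d f} \<times> {f. rational_function d f}"
    by (auto simp: rat_equiv_def)
  show "refl_on {f. rational_function d f} (rat_equiv d)"
  proof (rule refl_onI)
    fix f assume "f \<in> {f. rational_function d f}"
    then obtain p q where pq: "coprime p q" "max (degree p) (degree q) = d" and f: "f = rat_map p q"
      by (auto elim: rational_functionE)
    show "(f, f) \<in> rat_equiv d" unfolding f rat_equiv_iff[OF pq]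
      by (intro exI[of _ 1] exI[of _ 0] conjI) simp_all
  qed
  show "sym (rat_equiv d)"
  proof (rule symI)
    fix g f assume gf: "(g, f) \<in> rat_equiv d"
    then obtain p q where pq: "coprime p q" "max (degree p) (degree q) = d" and f: "f = rat_map p q"
      by (auto simp: rat_equiv_def elim: rational_functionE)
    obtain a b c e where det: "a * e - b * c \<noteq> 0" and g: "g = rat_map (smult a p + smult b q) (smult c p + smult e q)"
      using gf unfolding f rat_equiv_iff[OF pq] by blast
    define t where "t = 1 / (a * e - b * c)"
    have t: "t * (a * e - b * c) = 1" using det by (simp add: t_def)
    have "p = smult (t * e) (smult a p + smult b q) + smult (- t * b) (smult c p + smult e q)"
    proof -
      have "smult (t * e) (smult a p + smult b q) + smult (- t * b) (smult c p + smult e q) = smult (t * (a * e - b * c)) p"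
        by (rule poly_eqI) (simp add: algebra_simps)
      then show ?thesis by (simp add: t)
    qed
    moreover have "q = smult (- t * c) (smult a p + smult b q) + smult (t * a) (smult c p + smult e q)"
    proof -
      have "smult (- t * c) (smult a p + smult b q) + smult (t * a) (smult c p + smult e q) = smult (t * (a * e - b * c)) q"
        by (rule poly_eqI) (simp add: algebra_simps)
      then show ?thesis by (simp add: t)
    qed
    moreover have "(t * e) * (t * a) - (- t * b) * (- t * c) \<noteq> 0"
    proof -
      have "(t * e) * (t * a) - (- t * b) * (- t * c) = t * (t * (a * e - b * c))" by (simp add: algebra_simps)
      then show ?thesis using t det by (simp add: t_def)
    qed
    ultimately show "(f, g) \<in> rat_equiv d"
      unfolding g f rat_equiv_iff[OF moebius_comp(1,2)[OF pq det]] by metis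
  qed
  show "trans (rat_equiv d)"
  proof (rule transI)
    fix g f f' assume gf: "(g, f) \<in> rat_equiv d" and ff: "(f, f') \<in> rat_equiv d"
    then obtain p q where pq: "coprime p q" "max (degree p) (degree q) = d" and f': "f' = rat_map p q"
      by (auto simp: rat_equiv_def elim: rational_functionE)
    obtain a b c e where det: "a * e - b * c \<noteq> 0" and f: "f = rat_map (smult a p + smult b q) (smult c p + smult e q)"
      using ff unfolding f' rat_equiv_iff[OF pq] by blast
    obtain a' b' c' e' where det': "a' * e' - b' * c' \<noteq> 0" and g: "g = rat_map (smult a' (smult a p + smult b q) + smult b' (smult c p + smult e q))
       (smult c' (smult a p + smult b q) + smult e' (smult c p + smult e q))"
      using gf unfolding f rat_equiv_iff[OF moebius_comp(1,2)[OF pq det]] by blast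
    have eq: "smult x (smult a p + smult b q) + smult y (smult c p + smult e q) = smult (x * a + y * c) p + smult (x * b + y * e) q" for x y
      by (rule poly_eqI) (simp add: algebra_simps)
    have "(a' * a + b' * c) * (c' * b + e' * e) - (a' * b + b' * e) * (c' * a + e' * c) = (a' * e' - b' * c') * (a * e - b * c)"
      by (simp add: algebra_simps)
    then have "(a' * a + b' * c) * (c' * b + e' * e) - (a' * b + b' * e) * (c' * a + e' * c) \<noteq> 0" using det det' by simp
    then show "(g, f') \<in> rat_equiv d" unfolding f' rat_equiv_iff[OF pq] g eq by blast
  qed
qed

section \<open>Critical sets\<close>

lemma derivative_quotient_at_0:
  assumes "poly q z \<noteq> 0"
  shows "((\<lambda>t. poly p (z + t) / poly q (z + t)) has_field_derivative 0) (at 0) \<longleftrightarrow> poly (wronskian p q) z = 0"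
proof -
  have D: "((\<lambda>t. poly p (z + t)) has_field_derivative poly (pderiv p) z) (at 0)" for p :: "complex poly"
    using DERIV_shift[of "poly p" "poly (pderiv p) z" 0 z] poly_DERIV[of p z] by (simp add: add.commute)
  have "((\<lambda>t. poly p (z + t) / poly q (z + t)) has_field_derivative
      (poly (pderiv p) z * poly q (z + 0) - poly p (z + 0) * poly (pderiv q) z) / (poly q (z + 0) * poly q (z + 0))) (at 0)"
    using assms by (intro DERIV_divide D) simp
  then have D': "((\<lambda>t. poly p (z + t) / poly q (z + t)) has_field_derivative
      poly (wronskian p q) z / (poly q z * poly q z)) (at 0)"
    by (simp add: wronskian_def)
  show ?thesis using DERIV_unique[OF D', of 0] D' assms by auto
qed

lemma wronskian_swap: "wronskian q p = - wronskian p q"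
  by (simp add: wronskian_def algebra_simps)

lemma critical_Some:
  assumes "coprime p q"
  shows "Some z \<in> critical_set (rat_map p q) \<longleftrightarrow> poly (wronskian p q) z = 0"
proof (cases "poly q z = 0")
  case False
  have "coord (rat_map p q (Some z)) (rat_map p q (param (Some z) t)) = poly p (z + t) / poly q (z + t)" for t
    using False by (simp add: rat_map_Some ratio_def coord_def param_def)
  then show ?thesis using derivative_quotient_at_0[OF False, of p] by (simp add: critical_set_def)
next
  case True
  then have nz: "poly p z \<noteq> 0" using assms coprime_iff_no_common_root by blast
  \<comment> \<open>At a pole the chart \<open>1 / w\<close> turns \<open>p / q\<close> into
    \<open>q / p\<close>, whose Wronskian differs only in sign.\<close>
  have "coord (rat_map p q (Some z)) (rat_map p q (param (Some z) t)) = poly q (z + t) / poly p (z + t)" for t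
    using True by (simp add: rat_map_Some ratio_def coord_def param_def)
  then show ?thesis using derivative_quotient_at_0[OF nz, of q] by (simp add: critical_set_def wronskian_swap[of q p])
qed

section \<open>Inversion and translation of the sphere\<close>

definition sphere_inv :: "sphere \<Rightarrow> sphere" where
  "sphere_inv x = (case x of None \<Rightarrow> Some 0 | Some z \<Rightarrow> if z = 0 then None else Some (1 / z))"

lemma sphere_inv_invol [simp]: "sphere_inv (sphere_inv x) = x"
  by (simp add: sphere_inv_def split: option.split)

lemma comp_sphere_inv_invol [simp]: "f \<circ> sphere_inv \<circ> sphere_inv = f"
  by (simp add: fun_eq_iff)

lemma critical_None_inv: "None \<in> critical_set f \<longleftrightarrow> Some 0 \<in> critical_set (f \<circ> sphere_inv)"
proof -
  have "param None t = sphere_inv (param (Some 0) t)" for t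
    by (simp add: param_def sphere_inv_def)
  moreover have "sphere_inv (Some 0) = None" by (simp add: sphere_inv_def)
  ultimately show ?thesis by (simp add: critical_set_def)
qed

text \<open>For \<open>degree p \<le> N\<close> this is \<open>x ^ N * p (1 / x)\<close>. Taking for
  \<open>N\<close> the degree of the rational map scales numerator and denominator by the same
  power.\<close>

definition rev_poly :: "nat \<Rightarrow> complex poly \<Rightarrow> complex poly" where
  "rev_poly N p = (\<Sum>i\<le>N. monom (coeff p (N - i)) i)"

lemma coeff_rev_poly: "coeff (rev_poly N p) i = (if i \<le> N then coeff p (N - i) else 0)"
  by (simp add: rev_poly_def coeff_sum)

lemma degree_rev_poly: "degree (rev_poly N p) \<le> N"
  by (rule degree_le) (simp add: coeff_rev_poly)

lemma poly_rev_poly_0: "poly (rev_poly N p) 0 = coeff p N"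
  by (simp add: poly_0_coeff_0 coeff_rev_poly)

lemma poly_rev_poly:
  assumes "degree p \<le> N" "x \<noteq> 0"
  shows "poly (rev_poly N p) x = x ^ N * poly p (1 / x)"
proof -
  have "poly (rev_poly N p) x = (\<Sum>i\<le>N. coeff p (N - i) * x ^ i)"
    by (simp add: rev_poly_def poly_sum poly_monom)
  also have "\<dots> = (\<Sum>i\<le>N. coeff p i * x ^ (N - i))"
    by (rule sum.reindex_bij_witness[of _ "\<lambda>i. N - i" "\<lambda>i. N - i"]) auto
  also have "\<dots> = (\<Sum>i\<le>N. x ^ N * (coeff p i * (1 / x) ^ i))"
    using assms(2) by (intro sum.cong refl) (simp add: power_diff power_inverse divide_inverse)
  also have "\<dots> = x ^ N * (\<Sum>i\<le>N. coeff p i * (1 / x) ^ i)" by (simp add: sum_distrib_left)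
  also have "(\<Sum>i\<le>N. coeff p i * (1 / x) ^ i) = poly p (1 / x)"
    unfolding poly_altdef using assms(1) by (intro sum.mono_neutral_right) (auto simp: coeff_eq_0)
  finally show ?thesis .
qed

lemma rev_poly_coprime:
  assumes "coprime p q" "max (degree p) (degree q) = N"
  shows "coprime (rev_poly N p) (rev_poly N q)" "max (degree (rev_poly N p)) (degree (rev_poly N q)) = N"
    "rat_map p q \<circ> sphere_inv = rat_map (rev_poly N p) (rev_poly N q)"
proof -
  have nr: "poly p z \<noteq> 0 \<or> poly q z \<noteq> 0" for z using assms(1) coprime_iff_no_common_root by blast
  have deg: "degree p \<le> N" "degree q \<le> N" using assms(2) by auto
  show "coprime (rev_poly N p) (rev_poly N q)"
    unfolding coprime_iff_no_common_root
  proof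
    fix z show "poly (rev_poly N p) z \<noteq> 0 \<or> poly (rev_poly N q) z \<noteq> 0"
      using coprime_top_coeff[OF assms] nr[of "1 / z"] deg
      by (cases "z = 0") (auto simp: poly_rev_poly_0 poly_rev_poly)
  qed
  show deg': "max (degree (rev_poly N p)) (degree (rev_poly N q)) = N"
    using nr[of 0] by (intro max_degree_eqI degree_rev_poly) (simp add: coeff_rev_poly poly_0_coeff_0)
  show "rat_map p q \<circ> sphere_inv = rat_map (rev_poly N p) (rev_poly N q)"
  proof
    fix x show "(rat_map p q \<circ> sphere_inv) x = rat_map (rev_poly N p) (rev_poly N q) x"
    proof (cases x)
      case None
      then show ?thesis by (simp add: sphere_inv_def rat_map_Some rat_map_None[OF deg'] coeff_rev_poly poly_0_coeff_0)
    next
      case (Some z)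
      then show ?thesis using deg
        by (cases "z = 0") (simp_all add: sphere_inv_def rat_map_Some rat_map_None[OF assms(2)] poly_rev_poly_0 poly_rev_poly ratio_mult)
    qed
  qed
qed

lemma euler_rev_poly:
  assumes "degree p \<le> N"
  shows "pCons 0 (pderiv (rev_poly N p)) = smult (of_nat N) (rev_poly N p) - rev_poly N (pCons 0 (pderiv p))"
  by (rule poly_eqI)
     (auto simp only: coeff_euler coeff_diff coeff_smult coeff_rev_poly of_nat_diff split: if_splits, auto simp: algebra_simps)

text \<open>With the same formal degree \<open>N\<close> for both polynomials the factor
  \<open>a - b\<close> in the top coefficient is zero. This brings the bound down to
  \<open>2 * N - 2\<close>, the number of critical points of a generic map.\<close>

lemma degree_shift_wronskian_strict:
  assumes "degree p \<le> N" "degree q \<le> N" "N \<ge> 1"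
  shows "degree (pCons 0 (wronskian p q)) \<le> 2 * N" "coeff (pCons 0 (wronskian p q)) (2 * N) = 0"
    "degree (wronskian p q) \<le> 2 * N - 2"
proof -
  show 1: "degree (pCons 0 (wronskian p q)) \<le> 2 * N" "coeff (pCons 0 (wronskian p q)) (2 * N) = 0"
    using degree_shift_wronskian[OF assms(1,2)] by (simp_all only: mult_2, simp_all)
  show "degree (wronskian p q) \<le> 2 * N - 2"
  proof (rule degree_le, intro allI impI)
    fix i assume i: "i > 2 * N - 2"
    have "coeff (pCons 0 (wronskian p q)) (Suc i) = 0"
      using 1 i assms(3) by (cases "Suc i = 2 * N") (auto intro!: coeff_eq_0 simp del: coeff_pCons_Suc degree_pCons_eq_if)
    then show "coeff (wronskian p q) i = 0" by simp
  qed
qed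

text \<open>Reversal replaces \<open>x d/dx\<close> by \<open>N\<close> minus itself; the terms with
  \<open>N\<close> cancel in the Wronskian and a sign remains.\<close>

lemma wronskian_rev_poly:
  assumes "degree p \<le> N" "degree q \<le> N" "N \<ge> 1"
  shows "pCons 0 (wronskian (rev_poly N p) (rev_poly N q)) = - rev_poly (2 * N) (pCons 0 (wronskian p q))"
proof -
  have "poly (pCons 0 (wronskian (rev_poly N p) (rev_poly N q))) x = poly (- rev_poly (2 * N) (pCons 0 (wronskian p q))) x" for x
  proof (cases "x = 0")
    case True
    then show ?thesis using degree_shift_wronskian_strict(2)[OF assms] by (simp add: poly_rev_poly_0 del: coeff_pCons_Suc)
  next
    case False
    have degE: "degree (pCons 0 (pderiv p)) \<le> N" "degree (pCons 0 (pderiv q)) \<le> N"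
      using degree_euler[of p] degree_euler[of q] assms by linarith+
    have "pCons 0 (wronskian (rev_poly N p) (rev_poly N q)) =
       pCons 0 (pderiv (rev_poly N p)) * rev_poly N q - rev_poly N p * pCons 0 (pderiv (rev_poly N q))"
      by (simp add: wronskian_def)
    also have "\<dots> = rev_poly N p * rev_poly N (pCons 0 (pderiv q)) - rev_poly N (pCons 0 (pderiv p)) * rev_poly N q"
      unfolding euler_rev_poly[OF assms(1)] euler_rev_poly[OF assms(2)] by (simp add: algebra_simps)
    finally have "poly (pCons 0 (wronskian (rev_poly N p) (rev_poly N q))) x =
      x ^ N * poly p (1 / x) * (x ^ N * poly (pCons 0 (pderiv q)) (1 / x)) - x ^ N * poly (pCons 0 (pderiv p)) (1 / x) * (x ^ N * poly q (1 / x))"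
      using assms degE False by (simp only: poly_diff poly_mult poly_rev_poly not_False_eq_True)
    also have "\<dots> = - (x ^ (2 * N) * poly (pCons 0 (wronskian p q)) (1 / x))"
      unfolding mult_2 power_add by (simp add: wronskian_def algebra_simps)
    finally show ?thesis using poly_rev_poly[OF degree_shift_wronskian_strict(1)[OF assms] False] by simp
  qed
  then show ?thesis by (intro poly_ext)
qed

text \<open>The Wronskian acts as a form of degree \<open>2 * N - 2\<close>, whose zero at infinity
  is a vanishing top coefficient. Reversal moves that coefficient to the value at 0.\<close>

lemma critical_None:
  assumes pq: "coprime p q" "max (degree p) (degree q) = N" and N: "N \<ge> 1"
  shows "None \<in> critical_set (rat_map p q) \<longleftrightarrow> coeff (wronskian p q) (2 * N - 2) = 0"
proof -
  have deg: "degree p \<le> N" "degree q \<le> N" using pq(2) by auto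
  have "poly (wronskian (rev_poly N p) (rev_poly N q)) 0 = coeff (pCons 0 (wronskian (rev_poly N p) (rev_poly N q))) 1"
    by (simp add: poly_0_coeff_0)
  also have "\<dots> = - coeff (pCons 0 (wronskian p q)) (2 * N - 1)"
    unfolding wronskian_rev_poly[OF deg N] using N by (simp add: coeff_rev_poly)
  also have "2 * N - 1 = Suc (2 * N - 2)" using N by simp
  finally show ?thesis
    unfolding critical_None_inv rev_poly_coprime(3)[OF pq] critical_Some[OF rev_poly_coprime(1)[OF pq]] by simp
qed

lemma rational_function_inv: "rational_function d f \<Longrightarrow> rational_function d (f \<circ> sphere_inv)"
  unfolding rational_function_def using rev_poly_coprime by metis

lemma critical_set_inv:
  assumes "rational_function d f" "d \<ge> 1"
  shows "critical_set (f \<circ> sphere_inv) = sphere_inv -` critical_set f"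
proof -
  obtain p q where pq: "coprime p q" "max (degree p) (degree q) = d" and f: "f = rat_map p q"
    using assms by (auto elim: rational_functionE)
  have deg: "degree p \<le> d" "degree q \<le> d" using pq(2) by auto
  have "x \<in> critical_set (f \<circ> sphere_inv) \<longleftrightarrow> sphere_inv x \<in> critical_set f" for x
  proof (cases x)
    case None
    then show ?thesis using critical_None_inv[of "f \<circ> sphere_inv"] by (simp add: sphere_inv_def)
  next
    case (Some z)
    show ?thesis
    proof (cases "z = 0")
      case True
      then show ?thesis using critical_None_inv[of f] Some by (simp add: sphere_inv_def)
    next
      case False
      have "z * poly (wronskian (rev_poly d p) (rev_poly d q)) z = poly (pCons 0 (wronskian (rev_poly d p) (rev_poly d q))) z"
        by simp
      also have "\<dots> = - (z ^ (2 * d) * poly (pCons 0 (wronskian p q)) (1 / z))"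
        unfolding wronskian_rev_poly[OF deg assms(2)] poly_minus
        using poly_rev_poly[OF degree_shift_wronskian_strict(1)[OF deg assms(2)] False] by simp
      finally have "z * poly (wronskian (rev_poly d p) (rev_poly d q)) z = - (z ^ (2 * d) * (1 / z * poly (wronskian p q) (1 / z)))"
        by simp
      then have "poly (wronskian (rev_poly d p) (rev_poly d q)) z = 0 \<longleftrightarrow> poly (wronskian p q) (1 / z) = 0"
        using False by (metis divide_eq_0_iff mult_eq_0_iff neg_equal_0_iff_equal power_not_zero zero_neq_one)
      then show ?thesis
        using Some False unfolding f rev_poly_coprime(3)[OF pq]
        by (simp add: critical_Some[OF rev_poly_coprime(1)[OF pq]] sphere_inv_def critical_Some[OF pq(1)])
    qed
  qed
  then show ?thesis by auto
qed

definition sphere_shift :: "complex \<Rightarrow> sphere \<Rightarrow> sphere" where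
  "sphere_shift r = map_option (\<lambda>z. z + r)"

lemma sphere_shift_inverse: "sphere_shift r \<circ> sphere_shift (- r) = id"
  by (simp add: fun_eq_iff sphere_shift_def option.map_comp o_def option.map_ident)

lemma coeff_pcompose_shift:
  fixes p :: "complex poly"
  assumes "degree p \<le> N"
  shows "coeff (pcompose p [:r, 1:]) N = coeff p N"
proof (cases "degree p = N")
  case True
  have "lead_coeff (pcompose p [:r, 1:]) = lead_coeff p" by (subst lead_coeff_comp) auto
  then show ?thesis using True by (simp add: degree_pcompose)
next
  case False
  then show ?thesis using assms by (simp add: coeff_eq_0 degree_pcompose)
qed

lemma pcompose_shift:
  fixes p q :: "complex poly"
  assumes "coprime p q" "max (degree p) (degree q) = N"
  shows "coprime (pcompose p [:r, 1:]) (pcompose q [:r, 1:])"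
    "max (degree (pcompose p [:r, 1:])) (degree (pcompose q [:r, 1:])) = N"
    "rat_map p q \<circ> sphere_shift r = rat_map (pcompose p [:r, 1:]) (pcompose q [:r, 1:])"
proof -
  have nr: "poly p z \<noteq> 0 \<or> poly q z \<noteq> 0" for z using assms(1) coprime_iff_no_common_root by blast
  show "coprime (pcompose p [:r, 1:]) (pcompose q [:r, 1:])"
    unfolding coprime_iff_no_common_root poly_pcompose using nr by blast
  show deg: "max (degree (pcompose p [:r, 1:])) (degree (pcompose q [:r, 1:])) = N"
    using assms(2) by (simp add: degree_pcompose)
  have le: "degree p \<le> N" "degree q \<le> N" using assms(2) by auto
  show "rat_map p q \<circ> sphere_shift r = rat_map (pcompose p [:r, 1:]) (pcompose q [:r, 1:])"
  proof
    fix x show "(rat_map p q \<circ> sphere_shift r) x = rat_map (pcompose p [:r, 1:]) (pcompose q [:r, 1:]) x"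
      by (cases x) (simp_all add: sphere_shift_def rat_map_Some rat_map_None[OF assms(2)] rat_map_None[OF deg]
        coeff_pcompose_shift[OF le(1)] coeff_pcompose_shift[OF le(2)] poly_pcompose add.commute)
  qed
qed

lemma rational_function_shift: "rational_function d f \<Longrightarrow> rational_function d (f \<circ> sphere_shift r)"
  unfolding rational_function_def using pcompose_shift by metis

lemma wronskian_pcompose: "wronskian (pcompose p [:r, 1:]) (pcompose q [:r, 1:]) = pcompose (wronskian p q) [:r, 1:]"
  by (simp add: wronskian_def pderiv_pcompose pcompose_diff pcompose_mult pderiv_pCons)

lemma critical_set_shift:
  assumes "rational_function d f" "d \<ge> 1"
  shows "critical_set (f \<circ> sphere_shift r) = sphere_shift r -` critical_set f"
proof -
  obtain p q where pq: "coprime p q" "max (degree p) (degree q) = d" and f: "f = rat_map p q"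
    using assms by (auto elim: rational_functionE)
  have deg: "degree p \<le> d" "degree q \<le> d" using pq(2) by auto
  have "x \<in> critical_set (f \<circ> sphere_shift r) \<longleftrightarrow> sphere_shift r x \<in> critical_set f" for x
  proof (cases x)
    case None
    then show ?thesis unfolding f pcompose_shift(3)[OF pq]
      by (simp add: sphere_shift_def critical_None[OF pq assms(2)] critical_None[OF pcompose_shift(1,2)[OF pq] assms(2)]
        wronskian_pcompose coeff_pcompose_shift[OF degree_shift_wronskian_strict(3)[OF deg assms(2)]])
  next
    case (Some z)
    then show ?thesis unfolding f pcompose_shift(3)[OF pq]
      by (simp add: sphere_shift_def critical_Some[OF pq(1)] critical_Some[OF pcompose_shift(1)[OF pq]]
        wronskian_pcompose poly_pcompose add.commute)
  qed
  then show ?thesis by auto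
qed

text \<open>Equivalence composes with Moebius maps on the left, the change of variable on the right;
  the two commute, so classes go to classes.\<close>

lemma card_quotient_transport:
  assumes inv: "\<mu> \<circ> \<nu> = id" "\<nu> \<circ> \<mu> = id"
    and rat: "\<And>f. rational_function d f \<Longrightarrow> rational_function d (f \<circ> \<mu>)"
      "\<And>f. rational_function d f \<Longrightarrow> rational_function d (f \<circ> \<nu>)"
    and crit: "\<And>f. rational_function d f \<Longrightarrow> critical_set (f \<circ> \<mu>) = \<mu> -` critical_set f"
  shows "card ({f. generic d f \<and> critical_set f = \<mu> -` C} // rat_equiv d) = card ({f. generic d f \<and> critical_set f = C} // rat_equiv d)"
proof -
  define A where "A = {f. generic d f \<and> critical_set f = C}"
  define A' where "A' = {f. generic d f \<and> critical_set f = \<mu> -` C}"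
  define \<Phi> where "\<Phi> = (\<lambda>X. (\<lambda>f :: sphere \<Rightarrow> sphere. f \<circ> \<mu>) ` X)"
  have bij: "bij \<mu>" using inv by (metis o_bij)
  have cardv: "card (\<mu> -` X) = card X" for X
    using bij by (intro card_vimage_inj) (auto simp: bij_def)
  have \<mu>\<nu>: "f \<circ> \<mu> \<circ> \<nu> = f" "f \<circ> \<nu> \<circ> \<mu> = f" for f :: "sphere \<Rightarrow> sphere" using inv by (simp_all add: comp_assoc)
  have "inj (\<lambda>f :: sphere \<Rightarrow> sphere. f \<circ> \<mu>)" by (rule injI) (metis \<mu>\<nu>(1))
  then have inj: "inj \<Phi>" unfolding \<Phi>_def by (intro injI) (simp add: inj_image_eq_iff)
  have rat_class: "\<Phi> (rat_equiv d `` {f}) = rat_equiv d `` {f \<circ> \<mu>}" for f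
  proof (intro equalityI subsetI)
    fix g assume "g \<in> \<Phi> (rat_equiv d `` {f})"
    then obtain g' where "(f, g') \<in> rat_equiv d" "g = g' \<circ> \<mu>" by (auto simp: \<Phi>_def)
    then show "g \<in> rat_equiv d `` {f \<circ> \<mu>}" using rat(1) by (auto simp: rat_equiv_def comp_assoc)
  next
    fix g assume "g \<in> rat_equiv d `` {f \<circ> \<mu>}"
    then obtain \<sigma> where \<sigma>: "rational_function d (f \<circ> \<mu>)" "rational_function d g" "\<sigma> \<in> moebius" "f \<circ> \<mu> = \<sigma> \<circ> g"
      by (auto simp: rat_equiv_def)
    have "f = \<sigma> \<circ> (g \<circ> \<nu>)" using \<mu>\<nu>(1)[of f] \<sigma>(4) by (simp add: comp_assoc)
    moreover have "rational_function d f" using rat(2)[OF \<sigma>(1)] by (simp add: \<mu>\<nu>)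
    ultimately have "(f, g \<circ> \<nu>) \<in> rat_equiv d" using \<sigma>(3) rat(2)[OF \<sigma>(2)] unfolding rat_equiv_def by blast
    then show "g \<in> \<Phi> (rat_equiv d `` {f})" unfolding \<Phi>_def using \<mu>\<nu>(2)[of g] by (metis ImageI image_eqI singletonI)
  qed
  have A': "A' = (\<lambda>f. f \<circ> \<mu>) ` A"
  proof (intro equalityI subsetI)
    fix g assume g: "g \<in> A'"
    then have rg: "rational_function d (g \<circ> \<nu>)" using rat(2) by (simp add: A'_def generic_def)
    have "critical_set g = \<mu> -` critical_set (g \<circ> \<nu>)" using crit[OF rg] by (simp add: \<mu>\<nu>)
    then have "\<mu> -` critical_set (g \<circ> \<nu>) = \<mu> -` C" using g by (simp add: A'_def)
    then have "critical_set (g \<circ> \<nu>) = C" using bij by (metis bij_def surj_image_vimage_eq)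
    moreover have "card C = 2 * d - 2" using g cardv[of C] by (auto simp: A'_def generic_def)
    ultimately have "g \<circ> \<nu> \<in> A" using rg by (simp add: A_def generic_def)
    then show "g \<in> (\<lambda>f. f \<circ> \<mu>) ` A" using \<mu>\<nu>(2)[of g] by (metis image_eqI)
  next
    fix g assume "g \<in> (\<lambda>f. f \<circ> \<mu>) ` A"
    then show "g \<in> A'" using crit rat(1) cardv by (auto simp: A_def A'_def generic_def)
  qed
  have "A' // rat_equiv d = \<Phi> ` (A // rat_equiv d)"
    unfolding quotient_def A' by (auto simp: rat_class image_UN)
  then show ?thesis using inj by (simp add: A_def A'_def card_image inj_on_subset)
qed

text \<open>Each \<open>h\<close> gives the quotient of a basis of its solution plane. Changing the
  basis amounts to composing with a Moebius transformation, so the class corresponds to the plane,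
  and the plane determines \<open>h\<close>.\<close>

lemma card_rational_classes_finite:
  assumes fin: "finite Z" and Z: "card Z = 2 * k" "k \<ge> 1"
  shows "card ({f. generic (k + 1) f \<and> critical_set f = Some ` Z} // rat_equiv (k + 1)) = card (gaudin.spectrum Z k)"
proof -
  interpret gaudin Z using fin by unfold_locales
  define r where "r = rat_equiv (k + 1)"
  define A where "A = {f. generic (k + 1) f \<and> critical_set f = Some ` Z}"
  have "\<exists>pq. solution h (fst pq) \<and> solution h (snd pq) \<and> degree (fst pq) = k + 1 \<and> degree (snd pq) = k \<and> fst pq \<noteq> 0 \<and> snd pq \<noteq> 0"
    if "h \<in> spectrum k" for h
    using solution_basis[OF Z that] by (metis fst_conv snd_conv)
  then obtain PQ where PQ: "\<And>h. h \<in> spectrum k \<Longrightarrow> solution h (fst (PQ h)) \<and> solution h (snd (PQ h))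
     \<and> degree (fst (PQ h)) = k + 1 \<and> degree (snd (PQ h)) = k \<and> fst (PQ h) \<noteq> 0 \<and> snd (PQ h) \<noteq> 0"
    by metis
  define P where "P h = fst (PQ h)" for h
  define Q where "Q h = snd (PQ h)" for h
  have PQ: "solution h (P h)" "solution h (Q h)" "degree (P h) = k + 1" "degree (Q h) = k" "P h \<noteq> 0" "Q h \<noteq> 0"
    if "h \<in> spectrum k" for h using PQ[OF that] by (simp_all add: P_def Q_def)
  have simple: "poly p z \<noteq> 0 \<or> poly q z \<noteq> 0" if c: "c \<noteq> 0" "wronskian p q = smult c W" for c p q z
  proof (rule ccontr)
    assume "\<not> ?thesis"
    then have pq: "poly p z = 0" "poly q z = 0" by auto
    have "pderiv (wronskian p q) = pderiv (pderiv p) * q - p * pderiv (pderiv q)"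
      by (simp add: wronskian_def pderiv_diff pderiv_mult algebra_simps)
    then have "poly (smult c (pderiv W)) z = 0" using pq c(2) by (simp add: pderiv_smult)
    moreover have "poly (smult c W) z = 0" using pq by (simp add: c(2)[symmetric] wronskian_def)
    ultimately show False using c(1) poly_W_eq_0_iff[of z] poly_pderiv_W[of z] poly_Wdel_neq_0[of z] by simp
  qed
  have cop: "coprime (P h) (Q h)" if "h \<in> spectrum k" for h
    using solution_wronskian[OF Z(1) PQ[OF that]] simple unfolding coprime_iff_no_common_root by metis
  have deg: "max (degree (P h)) (degree (Q h)) = k + 1" if "h \<in> spectrum k" for h
    using PQ[OF that] by simp
  define F where "F h = rat_map (P h) (Q h)" for h
  have ratF: "rational_function (k + 1) (F h)" if "h \<in> spectrum k" for h
    using cop deg that unfolding F_def rational_function_def by blast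
  have FA: "F h \<in> A" if h: "h \<in> spectrum k" for h
  proof -
    obtain c where c: "c \<noteq> 0" "wronskian (P h) (Q h) = smult c W" using solution_wronskian[OF Z(1) PQ[OF h]] by blast
    have "x \<in> critical_set (F h) \<longleftrightarrow> x \<in> Some ` Z" for x
    proof (cases x)
      case None
      have "coeff (wronskian (P h) (Q h)) (2 * (k + 1) - 2) = c" using monic_W Z by (simp add: c)
      then show ?thesis using None c(1) critical_None[OF cop[OF h] deg[OF h]] by (simp add: F_def image_iff)
    next
      case (Some z)
      then show ?thesis using critical_Some[OF cop[OF h]] c poly_W_eq_0_iff[of z] by (auto simp: F_def)
    qed
    then have "critical_set (F h) = Some ` Z" by blast
    moreover have "card (Some ` Z) = 2 * (k + 1) - 2" using Z by (simp add: card_image)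
    ultimately show ?thesis using ratF[OF h] by (simp add: A_def generic_def)
  qed
  have cover: "\<exists>h\<in>spectrum k. (f, F h) \<in> r" if f: "f \<in> A" for f
  proof -
    obtain p q where pq: "coprime p q" "max (degree p) (degree q) = k + 1" and fpq: "f = rat_map p q"
      using f by (auto simp: A_def generic_def elim: rational_functionE)
    have crit: "critical_set (rat_map p q) = Some ` Z" using f by (simp add: A_def fpq)
    define w where "w = wronskian p q"
    have "None \<notin> critical_set (rat_map p q)" unfolding crit by auto
    then have w0: "w \<noteq> 0" using critical_None[OF pq] by (auto simp: w_def)
    have "poly w z = 0" if "z \<in> Z" for z using critical_Some[OF pq(1), of z] that unfolding crit by (simp add: w_def)
    then have "W dvd w" unfolding W_def using fin by (intro vanishing_prod_dvd) auto
    then obtain g where g: "w = W * g" by (elim dvdE)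
    have "degree w \<le> 2 * (k + 1) - 2" unfolding w_def using pq(2) by (intro degree_shift_wronskian_strict) auto
    moreover have "g \<noteq> 0" using w0 g by auto
    ultimately have "degree g = 0" unfolding g using W_nz Z by (simp add: degree_mult_eq degree_W)
    then obtain c where "g = [:c:]" by (meson degree_eq_zeroE)
    then have c: "c \<noteq> 0" "wronskian p q = smult c W" using g \<open>g \<noteq> 0\<close> by (auto simp: w_def)
    obtain h where h: "h \<in> spectrum k" "solution h p" "solution h q"
      using wronskian_spectrum[OF Z c pq(2)] by blast
    obtain a b where p: "p = smult a (P h) + smult b (Q h)" using solution_span[OF Z h(1) PQ[OF h(1)] h(2)] by blast
    obtain a' b' where q: "q = smult a' (P h) + smult b' (Q h)" using solution_span[OF Z h(1) PQ[OF h(1)] h(3)] by blast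
    have "wronskian p q = smult (a * b' - b * a') (wronskian (P h) (Q h))"
      unfolding p q wronskian_def by (rule poly_ext) (simp add: pderiv_add pderiv_smult algebra_simps)
    then have "a * b' - b * a' \<noteq> 0" using w0 by (auto simp: w_def)
    then have "(f, F h) \<in> r" unfolding r_def F_def fpq rat_equiv_iff[OF cop[OF h(1)] deg[OF h(1)]] using p q by blast
    then show ?thesis using h(1) by blast
  qed
  have inj: "h = h'" if h: "h \<in> spectrum k" "h' \<in> spectrum k" and eq: "(F h, F h') \<in> r" for h h'
  proof -
    obtain a b c e where det: "a * e - b * c \<noteq> 0" and
      "F h = rat_map (smult a (P h') + smult b (Q h')) (smult c (P h') + smult e (Q h'))"
      using eq unfolding r_def F_def rat_equiv_iff[OF cop[OF h(2)] deg[OF h(2)]] by blast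
    then obtain t where t: "t \<noteq> 0" "smult a (P h') + smult b (Q h') = smult t (P h)" "smult c (P h') + smult e (Q h') = smult t (Q h)"
      unfolding F_def using rat_map_eqD[OF cop[OF h(1)] moebius_comp(1)[OF cop[OF h(2)] deg[OF h(2)] det]] by metis
    have "solution h' (smult t (P h))" "solution h' (smult t (Q h))"
      unfolding t(2,3)[symmetric] by (intro solution_lincomb PQ h)+
    \<comment> \<open>\<open>P h\<close> and \<open>Q h\<close> satisfy the conditions for
      \<open>h\<close> and for \<open>h'\<close>. At each \<open>z\<close> one of them is nonzero
      and can be cancelled.\<close>
    then have "h z * poly (P h) z = h' z * poly (P h) z" "h z * poly (Q h) z = h' z * poly (Q h) z" if "z \<in> Z" for z
      using PQ(1,2)[OF h(1)] that t(1) by (auto simp: solution_def pderiv_smult)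
    then have "h z = h' z" if "z \<in> Z" for z
      using cop[OF h(1)] that unfolding coprime_iff_no_common_root by (metis mult_right_cancel)
    moreover have "h z = h' z" if "z \<notin> Z" for z using h that by (simp add: spectrum_def)
    ultimately show ?thesis by blast
  qed
  have equiv: "equiv {f. rational_function (k + 1) f} r" unfolding r_def by (rule equiv_rat_equiv)
  have AR: "A \<subseteq> {f. rational_function (k + 1) f}" by (auto simp: A_def generic_def)
  have "A // r = (\<lambda>h. r `` {F h}) ` spectrum k"
  proof (intro equalityI subsetI)
    fix X assume "X \<in> A // r"
    then obtain f where f: "f \<in> A" "X = r `` {f}" by (auto elim: quotientE)
    then obtain h where h: "h \<in> spectrum k" "(f, F h) \<in> r" using cover by blast
    then show "X \<in> (\<lambda>h. r `` {F h}) ` spectrum k" using equiv_class_eq[OF equiv h(2)] f by blast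
  qed (use FA in \<open>auto intro: quotientI\<close>)
  moreover have "inj_on (\<lambda>h. r `` {F h}) (spectrum k)"
  proof (rule inj_onI)
    fix h h' assume h: "h \<in> spectrum k" "h' \<in> spectrum k" and "r `` {F h} = r `` {F h'}"
    then have "(F h, F h') \<in> r" using eq_equiv_class[OF _ equiv] ratF by simp
    then show "h = h'" by (rule inj[OF h])
  qed
  ultimately show ?thesis by (simp add: A_def r_def card_image)
qed

text \<open>By absorption, the binomial at \<open>k - 1\<close> is \<open>k / (k + 1)\<close> times
  the central one.\<close>

lemma catalan_number:
  assumes "c + ((2 * k) choose (k - 1)) = (2 * k) choose k" "k \<ge> 1"
  shows "real c = 1 / real (k + 1) * real ((2 * k) choose k)"
proof -
  obtain j where j: "k = Suc j" using assms(2) by (cases k) auto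
  have "(2 * k - j) * ((2 * k) choose j) = Suc j * ((2 * k) choose Suc j)"
    using binomial_absorption[of j "2 * k"] binomial_absorb_comp[of "2 * k" j] by simp
  then have "(k + 1) * ((2 * k) choose (k - 1)) = k * ((2 * k) choose k)"
    by (simp add: j)
  then have "real (k + 1) * real ((2 * k) choose (k - 1)) = real k * real ((2 * k) choose k)"
    by (metis of_nat_mult)
  moreover have "real c = real ((2 * k) choose k) - real ((2 * k) choose (k - 1))"
    by (simp flip: assms(1))
  then have "real (k + 1) * real c = real (k + 1) * real ((2 * k) choose k) - real (k + 1) * real ((2 * k) choose (k - 1))"
    by (simp only: right_diff_distrib)
  ultimately have "real (k + 1) * real c = real ((2 * k) choose k)" by (simp add: algebra_simps)
  then show ?thesis by (simp add: field_simps)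
qed

lemma card_rational_classes:
  assumes fin: "finite Z" and Z: "Z \<subseteq> \<real>" "card Z = 2 * d - 2" "d \<ge> 2"
  shows "real (card ({f. generic d f \<and> critical_set f = Some ` Z} // rat_equiv d)) = 1 / real d * real ((2 * d - 2) choose (d - 1))"
proof -
  define k where "k = d - 1"
  have k: "d = k + 1" "k \<ge> 1" "card Z = 2 * k" using Z by (auto simp: k_def)
  interpret gaudin Z using fin by unfold_locales
  show ?thesis
    using catalan_number[OF card_spectrum[OF Z(1) k(3,2)] k(2)] card_rational_classes_finite[OF fin k(3,2)] k by simp
qed

theorem corollary6:
  fixes d :: nat and C :: "sphere set"
  assumes "d \<ge> 2"
    and "C \<subseteq> real_circle"
    and "card C = 2 * d - 2"
  shows "real (card ({f. generic d f \<and> critical_set f = C} // rat_equiv d)) =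
           1 / real d * real ((2 * d - 2) choose (d - 1))"
proof -
  have "card C \<noteq> 0" using assms(1,3) by simp
  then have finC: "finite C" using card_gt_0_iff[of C] by simp
  have "infinite (range (\<lambda>n. Some (of_nat n) :: sphere))" by (intro range_inj_infinite injI) simp
  then obtain n :: nat where n: "Some (of_nat n) \<notin> C" using finC by (meson finite_subset image_subsetI)
  \<comment> \<open>The preimage of \<open>C\<close> under the map sending \<open>x\<close> to
    \<open>1 / x + n\<close>. Infinity goes to \<open>n\<close>, so \<open>D\<close> consists of
    finite points, and they are real because \<open>n\<close> is.\<close>
  define D where "D = sphere_inv -` (sphere_shift (of_nat n) -` C)"
  have d1: "d \<ge> 1" using assms(1) by simp
  have shift: "sphere_shift (of_nat n) \<circ> sphere_shift (- of_nat n) = id" "sphere_shift (- of_nat n) \<circ> sphere_shift (of_nat n) = id"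
    using sphere_shift_inverse[of "of_nat n"] sphere_shift_inverse[of "- of_nat n"] by simp_all
  have inv: "sphere_inv \<circ> sphere_inv = id" by (simp add: fun_eq_iff)
  have card_eq: "card ({f. generic d f \<and> critical_set f = D} // rat_equiv d) = card ({f. generic d f \<and> critical_set f = C} // rat_equiv d)"
    unfolding D_def
    using card_quotient_transport[OF inv inv, of d, OF rational_function_inv rational_function_inv critical_set_inv[OF _ d1]]
      card_quotient_transport[OF shift, of d, OF rational_function_shift rational_function_shift critical_set_shift[OF _ d1]]
    by simp
  have "None \<notin> D" using n by (simp add: D_def sphere_inv_def sphere_shift_def)
  define Z where "Z = {z. Some z \<in> D}"
  have D: "D = Some ` Z" using \<open>None \<notin> D\<close> by (auto simp: Z_def image_iff) (metis not_None_eq)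
  have "bij sphere_inv" using inv by (metis o_bij)
  moreover have "bij (sphere_shift (of_nat n))" using shift by (metis o_bij)
  ultimately have cardD: "card D = card C" "finite D"
    unfolding D_def using finC by (auto simp: card_vimage_inj bij_def intro!: finite_vimageI)
  have Zr: "Z \<subseteq> \<real>"
  proof
    fix z assume "z \<in> Z"
    then have "sphere_shift (of_nat n) (sphere_inv (Some z)) \<in> real_circle" using assms(2) by (auto simp: Z_def D_def)
    \<comment> \<open>The point \<open>z = 0\<close> is the one that comes from infinity in
      \<open>C\<close>.\<close>
    then show "z \<in> \<real>"
    proof (cases "z = 0")
      case False
      then have "1 / z + of_nat n \<in> \<real>"
        using \<open>sphere_shift (of_nat n) (sphere_inv (Some z)) \<in> real_circle\<close>
        by (auto simp: sphere_inv_def sphere_shift_def real_circle_def)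
      then have "(1 / z + of_nat n) - of_nat n \<in> \<real>" by (intro Reals_diff) auto
      then have "inverse (1 / z) \<in> \<real>" by (intro Reals_inverse) simp
      then show ?thesis by simp
    qed simp
  qed
  have "finite Z" "card Z = 2 * d - 2"
    using cardD assms(3) unfolding D by (auto simp: card_image finite_image_iff)
  then show ?thesis using card_rational_classes[OF _ Zr _ assms(1)] card_eq unfolding D by simp
qed

end
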